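(* Let $d\ge 1$, let $N$ be a non-negative integer, let $\omega$ be an admissible radial measure on $\overline{\mathbb{B}_d}$, and let $B^N_\omega$ be the associated radially weighted Besov space. Let $\phi\in\mathrm{Mult}(B^N_\omega)$ have no zeros in $\mathbb{B}_d$ and bounded argument. Then there are $\psi\in\mathrm{Mult}(B^N_\omega)$ and $n\in\mathbb{N}$ such that $\log\phi=\frac{\psi}{\phi^n}$. Consequently, if $\phi$ is weak$^\ast$ sequentially cyclic, then $\log\phi\in N^+_\ast(B^N_\omega)$.
   Context: $\mathbb{B}_d$ is the open unit ball of $\mathbb{C}^d$, $\sigma$ the normalized rotation-invariant measure on $\partial\mathbb{B}_d$, $\mathrm{Hol}(\mathbb{B}_d)$ the holomorphic functions on $\mathbb{B}_d$. An admissible radial measure $\omega$ on $\overline{\mathbb{B}_d}$ is a measure of the form $d\omega(z)=d\mu(r)\,d\sigma(w)$, $z=rw$, where $\mu$ is a finite Borel measure on $[0,1]$ with $\mu((r,1])>0$ for all $0<r<1$. For $f\in\mathrm{Hol}(\mathbb{B}_d)$ put $\|f\|^2_{L^2(\omega)}=\int_{\mathbb{B}_d}|f|^2d\omega+\mu(\{1\})\|f\|^2_{H^2(\partial\mathbb{B}_d)}$, where $\|f\|^2_{H^2(\partial\mathbb{B}_d)}=\sup_{0\le r<1}\int_{\partial\mathbb{B}_d}|f(rz)|^2d\sigma(z)$ (the second term is absent if $\mu(\{1\})=0$). With $R=\sum_{j=1}^d z_j\frac{\partial}{\partial z_j}$, the radially weighted Besov space is $B^N_\omega=\{f\in\mathrm{Hol}(\mathbb{B}_d):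 R^Nf\in L^2(\omega)\}$, with norm $\|f\|^2=\|f\|^2_{L^2(\omega)}$ if $N=0$ and $\|f\|^2=\omega(\overline{\mathbb{B}_d})|f(0)|^2+\|R^Nf\|^2_{L^2(\omega)}$ if $N>0$; it is a Hilbert space with continuous point evaluations. For a Hilbert function space $H$ on $\mathbb{B}_d$, $\mathrm{Mult}(H)=\{\phi:\mathbb{B}_d\to\mathbb{C}:\ \phi f\in H\text{ for all }f\in H\}$, normed by $\|\phi\|_{\mathrm{Mult}(H)}=\|M_\phi\|$, the operator norm of multiplication by $\phi$ on $H$. Via $\phi\mapsto M_\phi$ it is a weak$^\ast$-closed subalgebra of the bounded operators $\mathcal{B}(H)$ (the dual of the trace class) and carries the resulting weak$^\ast$ topology. A sequence $\phi_n$ converges weak$^\ast$ to $\phi$ in $\mathrm{Mult}(H)$ if and only if $\sup_n\|\phi_n\|_{\mathrm{Mult}(H)}<\infty$ and $\phi_n(z)\to\phi(z)$ for all $z\in\mathbb{B}_d$. $\phi\in\mathrm{Mult}(H)$ is weak$^\ast$ sequentially cyclic if there is a sequence $\{u_n\}\subseteq\mathrm{Mult}(H)$ with $u_n\phi\to1$ weak$^\ast$. Define $N^+_\ast(B^N_\omega)=\{u/v: u,v\in\mathrm{Mult}(B^N_\omega),\ v\text{ weak}^\ast\text{ sequentially cyclic}\}$. For zero-free holomorphic $\phi$ on $\mathbb{B}_d$, $\log\phi$ denotes an analytic logarithm of $\phi$ on $\mathbb{B}_d$, and $\phi$ has bounded argument if $\operatorname{Im}\log\phi$ is bounded on $\mathbb{B}_d$.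 *)

theory Defs
  imports "HOL-Probability.Probability"
begin

section \<open>The normalized rotation-invariant measure on the unit sphere\<close>

text \<open>The normalized cone measure: $\sigma(A)$ is the normalized volume of
  $\{z : 0 < |z| < 1,\ z/|z| \in A\}$. It is regarded as a Borel measure on the whole space which is
  carried by the unit sphere. It is a probability measure
  (prob_space_sphere_measure), it is concentrated on the sphere (AE_sphere_measure), and it is
  invariant under all linear isometries, in particular under the unitary group
  (distr_sphere_measure_isometry); these properties characterize it.\<close>

definition sphere_measure :: "(complex ^ 'd) measure" where
  "sphere_measure = distr (uniform_measure lborel (ball 0 1)) borel sgn"

lemma sets_sphere_measure [simp, measurable_cong]: "sets sphere_measure = sets borel"
  by (simp add: sphere_measure_def)

lemma space_sphere_measure [simp]: "space sphere_measure = UNIV"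
  by (simp add: sphere_measure_def)

lemma emeasure_unit_ball_neq_0: "emeasure lborel (ball (0 :: complex ^ 'd) 1) \<noteq> 0"
proof
  assume "emeasure lborel (ball (0 :: complex ^ 'd) 1) = 0"
  then have "ball (0 :: complex ^ 'd) 1 \<in> null_sets lebesgue"
    by (intro null_sets_completionI) auto
  then show False
    using open_not_negligible[of "ball (0 :: complex ^ 'd) 1"]
    by (simp add: negligible_iff_null_sets)
qed

lemma emeasure_unit_ball_neq_top: "emeasure lborel (ball (0 :: complex ^ 'd) 1) \<noteq> \<infinity>"
  using emeasure_lborel_ball_finite[of "0 :: complex ^ 'd" 1] by simp

lemma prob_space_uniform_ball: "prob_space (uniform_measure lborel (ball (0 :: complex ^ 'd) 1))"
  using emeasure_unit_ball_neq_0 emeasure_unit_ball_neq_top by (rule prob_space_uniform_measure)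

lemma prob_space_sphere_measure: "prob_space (sphere_measure :: (complex ^ 'd) measure)"
  unfolding sphere_measure_def
  by (rule prob_space.prob_space_distr[OF prob_space_uniform_ball]) (simp add: uniform_measure_def)

lemma AE_sphere_measure: "AE w in (sphere_measure :: (complex ^ 'd) measure). norm w = 1"
proof -
  have "AE z in lborel. z \<noteq> (0 :: complex ^ 'd)"
    by (rule AE_lborel_singleton)
  then have "AE z in uniform_measure lborel (ball (0 :: complex ^ 'd) 1). z \<noteq> 0"
    using emeasure_unit_ball_neq_0 emeasure_unit_ball_neq_top
    by (intro AE_uniform_measureI) auto
  then have "AE z in uniform_measure lborel (ball (0 :: complex ^ 'd) 1). norm (sgn z) = 1"
    by eventually_elim (simp add: norm_sgn)
  then show ?thesis
    unfolding sphere_measure_def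
    by (subst AE_distr_iff) (auto simp: uniform_measure_def)
qed

lemma nn_integral_lborel_translate:
  fixes g :: "complex ^ 'd \<Rightarrow> ennreal"
  assumes [measurable]: "g \<in> borel_measurable borel"
  shows "(\<integral>\<^sup>+x. g (t + x) \<partial>lborel) = (\<integral>\<^sup>+x. g x \<partial>lborel)"
  by (subst (2) lborel_distr_plus[symmetric, where c = t]) (simp add: nn_integral_distr)

lemma nn_integral_lborel_reflect:
  fixes g :: "complex ^ 'd \<Rightarrow> ennreal"
  assumes [measurable]: "g \<in> borel_measurable borel"
  shows "(\<integral>\<^sup>+x. g (t - x) \<partial>lborel) = (\<integral>\<^sup>+x. g x \<partial>lborel)"
  by (subst (2) lborel_affine[where c = "-1" and t = t])
     (simp_all add: nn_integral_density nn_integral_distr)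

lemma emeasure_lborel_isometry:
  fixes U :: "complex ^ 'd \<Rightarrow> complex ^ 'd"
  assumes lin: "linear U" and iso: "\<And>z. norm (U z) = norm z"
    and A[measurable]: "A \<in> sets borel"
  shows "emeasure lborel (U -` A) = emeasure lborel A"
proof -
  have U[measurable]: "U \<in> borel_measurable borel"
    using lin by (simp add: borel_measurable_continuous_onI linear_continuous_on linear_linear)
  have "inj U"
    using lin iso by (metis linear_injective_0 norm_eq_zero)
  then have "surj U"
    using lin linear_injective_imp_surjective by blast
  let ?B = "ball (0 :: complex ^ 'd) 1"
  have B[measurable, simp]: "?B \<in> sets borel"
    by (rule borel_open) simp
  have vB: "U -` ?B = ?B"
    by (auto simp: iso)
  have mA: "U -` A \<in> sets borel"
    using measurable_sets[OF U A] by simp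
  have "emeasure lborel (U -` A) * emeasure lborel ?B =
      (\<integral>\<^sup>+x. indicator A (U x) * (\<integral>\<^sup>+y. indicator ?B (U x + y) \<partial>lborel) \<partial>lborel)"
  proof -
    have "(\<integral>\<^sup>+y. indicator ?B (U x + y) \<partial>lborel) = emeasure lborel ?B" for x
      by (subst nn_integral_lborel_translate) simp_all
    moreover have "(\<integral>\<^sup>+x. indicator A (U x) \<partial>lborel) = emeasure lborel (U -` A)"
      using mA by (simp flip: nn_integral_indicator add: indicator_vimage)
    ultimately show ?thesis
      by (simp add: nn_integral_multc)
  qed
  also have "\<dots> = (\<integral>\<^sup>+x. \<integral>\<^sup>+y. indicator A (U x) * indicator ?B (U x + y) \<partial>lborel \<partial>lborel)"
    by (intro nn_integral_cong nn_integral_cmult[symmetric]) measurable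
  also have "\<dots> = (\<integral>\<^sup>+y. \<integral>\<^sup>+x. indicator A (U x) * indicator ?B (U x + y) \<partial>lborel \<partial>lborel)"
    by (rule lborel_pair.Fubini') measurable
  also have "\<dots> = (\<integral>\<^sup>+y. \<integral>\<^sup>+x. indicator A (U x - y) * indicator ?B (U x) \<partial>lborel \<partial>lborel)"
  proof (rule nn_integral_cong)
    fix y :: "complex ^ 'd"
    obtain s where s: "U s = y"
      using \<open>surj U\<close> by (metis surjD)
    have "(\<integral>\<^sup>+x. indicator A (U x - y) * indicator ?B (U x) \<partial>lborel) =
        (\<integral>\<^sup>+x. indicator A (U (s + x) - y) * indicator ?B (U (s + x)) \<partial>lborel)"
      by (rule nn_integral_lborel_translate[symmetric]) measurable
    also have "\<dots> = (\<integral>\<^sup>+x. indicator A (U x) * indicator ?B (U x + y) \<partial>lborel)"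
      by (simp add: linear_add[OF lin] s add.commute)
    finally show "(\<integral>\<^sup>+x. indicator A (U x) * indicator ?B (U x + y) \<partial>lborel) =
        (\<integral>\<^sup>+x. indicator A (U x - y) * indicator ?B (U x) \<partial>lborel)" ..
  qed
  also have "\<dots> = (\<integral>\<^sup>+x. \<integral>\<^sup>+y. indicator A (U x - y) * indicator ?B (U x) \<partial>lborel \<partial>lborel)"
    by (rule lborel_pair.Fubini'[symmetric]) measurable
  also have "\<dots> = (\<integral>\<^sup>+x. emeasure lborel A * indicator ?B (U x) \<partial>lborel)"
  proof (rule nn_integral_cong)
    fix x :: "complex ^ 'd"
    have "(\<integral>\<^sup>+y. indicator A (U x - y) * indicator ?B (U x) \<partial>lborel) =
        (\<integral>\<^sup>+y. indicator A (U x - y) \<partial>lborel) * indicator ?B (U x)"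
      by (rule nn_integral_multc) measurable
    also have "(\<integral>\<^sup>+y. indicator A (U x - y) \<partial>lborel) = emeasure lborel A"
      by (subst nn_integral_lborel_reflect) (simp_all add: A)
    finally show "(\<integral>\<^sup>+y. indicator A (U x - y) * indicator ?B (U x) \<partial>lborel) =
        emeasure lborel A * indicator ?B (U x)" .
  qed
  also have "\<dots> = emeasure lborel A * emeasure lborel (U -` ?B)"
    by (simp add: nn_integral_cmult indicator_vimage[symmetric] vB)
  finally have "emeasure lborel ?B * emeasure lborel (U -` A) =
      emeasure lborel ?B * emeasure lborel A"
    by (simp add: vB mult.commute)
  then show ?thesis
    using emeasure_unit_ball_neq_0[where 'd = 'd] emeasure_unit_ball_neq_top[where 'd = 'd]
    by (simp add: ennreal_mult_cancel_left)
qed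

lemma distr_sphere_measure_isometry:
  fixes U :: "complex ^ 'd \<Rightarrow> complex ^ 'd"
  assumes lin: "linear U" and iso: "\<And>z. norm (U z) = norm z"
  shows "distr sphere_measure borel U = sphere_measure"
proof -
  let ?B = "ball (0 :: complex ^ 'd) 1"
  let ?u = "uniform_measure lborel ?B"
  have U[measurable]: "U \<in> borel_measurable borel"
    using lin by (simp add: borel_measurable_continuous_onI linear_continuous_on linear_linear)
  have U'[measurable]: "U \<in> measurable ?u borel" and sgn'[measurable]: "sgn \<in> measurable ?u borel"
    by (simp_all add: uniform_measure_def)
  have comm: "U \<circ> sgn = sgn \<circ> U"
    by (auto simp: fun_eq_iff sgn_div_norm linear_scale[OF lin] iso)
  have inv: "distr ?u borel U = ?u"
  proof (rule measure_eqI)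
    fix A assume "A \<in> sets (distr ?u borel U)"
    then have A[measurable]: "A \<in> sets borel" by simp
    have mA: "U -` A \<in> sets borel"
      using measurable_sets[OF U A] by simp
    have "?B \<inter> U -` A = U -` (?B \<inter> A)"
      by (auto simp: iso)
    moreover have "emeasure lborel (U -` (?B \<inter> A)) = emeasure lborel (?B \<inter> A)"
      by (rule emeasure_lborel_isometry[OF lin iso]) measurable
    ultimately show "emeasure (distr ?u borel U) A = emeasure ?u A"
      using mA by (simp add: emeasure_distr emeasure_uniform_measure)
  qed simp
  have "distr sphere_measure borel U = distr ?u borel (U \<circ> sgn)"
    unfolding sphere_measure_def by (rule distr_distr) simp_all
  also have "\<dots> = distr (distr ?u borel U) borel sgn"
    unfolding comm by (rule distr_distr[symmetric]) simp_all
  finally show ?thesis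
    by (simp add: inv sphere_measure_def)
qed


section \<open>Holomorphic functions on the unit ball\<close>

text \<open>Functions on the ball are total functions on $\mathbb{C}^d$ whose values outside
  \<^term>\<open>ball 0 1\<close> are irrelevant: everything below depends only on the values on the ball.\<close>

definition holomorphic_ball :: "(complex ^ 'd \<Rightarrow> complex) \<Rightarrow> bool" where
  "holomorphic_ball f \<longleftrightarrow>
     (\<forall>z\<in>ball 0 1. \<exists>D. (f has_derivative D) (at z) \<and> (\<forall>c v. D (c *s v) = c * D v))"

definition partial_deriv :: "'d \<Rightarrow> (complex ^ 'd \<Rightarrow> complex) \<Rightarrow> complex ^ 'd \<Rightarrow> complex" where
  "partial_deriv j f z = deriv (\<lambda>w. f (z + axis j w)) 0"

definition radial_deriv :: "(complex ^ 'd \<Rightarrow> complex) \<Rightarrow> complex ^ 'd \<Rightarrow> complex" where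
  "radial_deriv f z = (\<Sum>j\<in>UNIV. z $ j * partial_deriv j f z)"


section \<open>Radially weighted Besov spaces\<close>

text \<open>Borel measures on $[0,1]$ are Borel measures on the line carried by $[0,1]$.\<close>

definition admissible :: "real measure \<Rightarrow> bool" where
  "admissible \<mu> \<longleftrightarrow> finite_measure \<mu> \<and> sets \<mu> = sets borel \<and> emeasure \<mu> (- {0..1}) = 0 \<and>
     (\<forall>r. 0 < r \<and> r < 1 \<longrightarrow> emeasure \<mu> {r<..1} > 0)"

definition radial_measure :: "real measure \<Rightarrow> (complex ^ 'd) measure" where
  "radial_measure \<mu> = distr (\<mu> \<Otimes>\<^sub>M sphere_measure) borel (\<lambda>(r, w). r *\<^sub>R w)"

definition hardy_normsq :: "(complex ^ 'd \<Rightarrow> complex) \<Rightarrow> ennreal" where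
  "hardy_normsq f = (SUP r\<in>{0..<1}. \<integral>\<^sup>+w. ennreal ((cmod (f (r *\<^sub>R w)))\<^sup>2) \<partial>sphere_measure)"

text \<open>If \<^term>\<open>\<mu>\<close> has no mass at $1$ then the second summand vanishes even for infinite
  \<^term>\<open>hardy_normsq f\<close>, because $0 \cdot \infty = 0$ in \<^typ>\<open>ennreal\<close>.\<close>

definition L2_normsq :: "real measure \<Rightarrow> (complex ^ 'd \<Rightarrow> complex) \<Rightarrow> ennreal" where
  "L2_normsq \<mu> f =
     (\<integral>\<^sup>+z\<in>ball 0 1. ennreal ((cmod (f z))\<^sup>2) \<partial>radial_measure \<mu>) + emeasure \<mu> {1} * hardy_normsq f"

definition besov :: "nat \<Rightarrow> real measure \<Rightarrow> (complex ^ 'd \<Rightarrow> complex) set" where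
  "besov N \<mu> = {f. holomorphic_ball f \<and> L2_normsq \<mu> ((radial_deriv ^^ N) f) < \<infinity>}"

definition besov_norm :: "nat \<Rightarrow> real measure \<Rightarrow> (complex ^ 'd \<Rightarrow> complex) \<Rightarrow> real" where
  "besov_norm N \<mu> f = sqrt (enn2real
     (if N = 0 then L2_normsq \<mu> f
      else emeasure (radial_measure \<mu> :: (complex ^ 'd) measure) (cball 0 1) * ennreal ((cmod (f 0))\<^sup>2)
        + L2_normsq \<mu> ((radial_deriv ^^ N) f)))"


section \<open>Multipliers of a Hilbert function space and the weak* topology\<close>

text \<open>In this section \<^term>\<open>H\<close> is the set of elements of a Hilbert function space and
  \<^term>\<open>nrm\<close> its norm. The inner product (linear in the first argument) is recovered from the norm
  by polarization.\<close>

definition norm_inner ::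
  "(('a \<Rightarrow> complex) \<Rightarrow> real) \<Rightarrow> ('a \<Rightarrow> complex) \<Rightarrow> ('a \<Rightarrow> complex) \<Rightarrow> complex" where
  "norm_inner nrm f g =
     (\<Sum>k<4. \<i> ^ k * complex_of_real ((nrm (\<lambda>z. f z + \<i> ^ k * g z))\<^sup>2)) / 4"

definition Mult :: "('a \<Rightarrow> complex) set \<Rightarrow> ('a \<Rightarrow> complex) set" where
  "Mult H = {\<phi>. \<forall>f\<in>H. (\<lambda>z. \<phi> z * f z) \<in> H}"

text \<open>The trace class operators on $H$ are the operators
  $T = \sum_k \langle \cdot, g_k\rangle f_k$ with $\sum_k \|f_k\|^2 < \infty$ and
  $\sum_k \|g_k\|^2 < \infty$, and such a $T$ acts on bounded operators by
  $\mathrm{tr}(M T) = \sum_k \langle M f_k, g_k\rangle$. Thus the following is convergence of the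
  multiplication operators in the weak* topology of $\mathcal{B}(H)$ as the dual of the trace class.\<close>

definition weak_star_tendsto ::
  "('a \<Rightarrow> complex) set \<Rightarrow> (('a \<Rightarrow> complex) \<Rightarrow> real) \<Rightarrow>
     (nat \<Rightarrow> 'a \<Rightarrow> complex) \<Rightarrow> ('a \<Rightarrow> complex) \<Rightarrow> bool" where
  "weak_star_tendsto H nrm \<phi>s \<phi> \<longleftrightarrow>
     (\<forall>f g. (\<forall>k::nat. f k \<in> H \<and> g k \<in> H) \<and>
            summable (\<lambda>k. (nrm (f k))\<^sup>2) \<and> summable (\<lambda>k. (nrm (g k))\<^sup>2) \<longrightarrow>
        (\<lambda>n. \<Sum>k. norm_inner nrm (\<lambda>z. \<phi>s n z * f k z) (g k))
          \<longlonglongrightarrow> (\<Sum>k. norm_inner nrm (\<lambda>z. \<phi> z * f k z) (g k)))"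

definition weak_star_seq_cyclic ::
  "('a \<Rightarrow> complex) set \<Rightarrow> (('a \<Rightarrow> complex) \<Rightarrow> real) \<Rightarrow> ('a \<Rightarrow> complex) \<Rightarrow> bool" where
  "weak_star_seq_cyclic H nrm \<phi> \<longleftrightarrow> \<phi> \<in> Mult H \<and>
     (\<exists>u. (\<forall>n. u n \<in> Mult H) \<and> weak_star_tendsto H nrm (\<lambda>n z. u n z * \<phi> z) (\<lambda>z. 1))"

text \<open>The class $N^+_*$ of quotients; the identity $h = u/v$ is understood on the ball.\<close>

definition N_plus_star ::
  "(complex ^ 'd \<Rightarrow> complex) set \<Rightarrow> ((complex ^ 'd \<Rightarrow> complex) \<Rightarrow> real) \<Rightarrow> (complex ^ 'd \<Rightarrow> complex) set" where
  "N_plus_star H nrm = {h. \<exists>u\<in>Mult H. \<exists>v\<in>Mult H. weak_star_seq_cyclic H nrm v \<and>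
     (\<forall>z\<in>ball 0 1. h z = u z / v z)}"


section \<open>Logarithms\<close>

definition analytic_log :: "(complex ^ 'd \<Rightarrow> complex) \<Rightarrow> (complex ^ 'd \<Rightarrow> complex) \<Rightarrow> bool" where
  "analytic_log \<phi> L \<longleftrightarrow> holomorphic_ball L \<and> (\<forall>z\<in>ball 0 1. exp (L z) = \<phi> z)"

text \<open>Two analytic logarithms differ by a constant in $2\pi i\mathbb{Z}$, so it does not matter
  which one is used.\<close>

definition bounded_argument :: "(complex ^ 'd \<Rightarrow> complex) \<Rightarrow> bool" where
  "bounded_argument \<phi> \<longleftrightarrow> (\<exists>L. analytic_log \<phi> L \<and> bounded ((\<lambda>z. Im (L z)) ` ball 0 1))"

end

theory Submission
  imports Defs "HOL-Complex_Analysis.Complex_Analysis"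
begin

text \<open>
  The function $\psi = \phi^{N+1} \log\phi$ is a multiplier. To see this, let $f \in B^N_\omega$ and consider
  $R^N(\psi f)$ at a point $w$. The function $x^{N+1}\log x$ is expanded in powers of $x - \phi(w)$, with the
  branch of the logarithm that takes the given value at $\phi(w)$, and $\phi$ is inserted for $x$. The
  powers $(\phi - \phi(w))^i$ with $i > N$ are annihilated at $w$ by $R^N$, and the others are resolved
  by the binomial theorem. This expresses $R^N(\psi f)(w)$ as a combination of the values
  $R^N(\phi^k f)(w)$ with $k \le N$ (lemmas \<open>radial_deriv_iter_power_log\<close> and
  \<open>radial_deriv_iter_binomial\<close>). The coefficients are products of powers of $\phi(w)$ with at most one
  factor $\log\phi(w)$. As $\phi$ and its argument are bounded and a power of $\phi(w)$ always accompanies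
  the logarithm, the coefficients are bounded (\<open>radial_deriv_iter_power_log_bound\<close>). They are not
  holomorphic in $w$, but the norm of $L^2(\omega)$ does not mind (\<open>L2_normsq_le_sum\<close>), and each
  $R^N(\phi^k f)$ lies in $L^2(\omega)$ because $\phi^k$ is a multiplier.

  For the second assertion, $\log\phi = \psi/\phi^{N+1}$, and powers of weak* sequentially cyclic
  multipliers are weak* sequentially cyclic: from $u_n\phi \to 1$ follows $u_n^m\phi^m \to 1$
  (\<open>weak_star_seq_cyclic_power\<close>), since weak* convergence of a sequence of multipliers means that the
  multipliers are bounded and that their homogeneous components converge pointwise.

  This equivalence and the boundedness of multipliers need the Hilbert space structure of $B^N_\omega$.
  It is obtained from the expansion $f = \sum_j f_j$ into homogeneous components. Since $\sigma$ is
  invariant under multiplication by unimodular scalars, the components are orthogonal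
  (\<open>circle_invariant_Parseval\<close>), so the norm of $B^N_\omega$ is a weighted $\ell^2$-sum of the norms of
  the $f_j$ in $L^2(\sigma)$ (\<open>besov_normsq_eq\<close>). The same identity for Lebesgue measure on small balls
  yields bounds for point evaluations (\<open>besov_evaluation_bound\<close>), and these imply completeness
  (\<open>besov_complete\<close>). What remains is abstract Hilbert space theory in the locale
  \<open>L2_function_space\<close>: the uniform boundedness principle, and the Riesz representation of the
  functionals $f \mapsto f_j(w)$.
\<close>

section \<open>Holomorphic functions on the ball\<close>

lemma norm_vector_scalar_mult: "norm (c *s v) = cmod c * norm (v :: complex ^ 'd)"
  by (simp add: norm_vec_def L2_set_def norm_mult power_mult_distrib real_sqrt_mult
      flip: sum_distrib_left)

lemma scaleR_eq_vector_scalar_mult: "r *\<^sub>R v = complex_of_real r *s (v :: complex ^ 'd)"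
  by (simp add: vec_eq_iff, simp add: scaleR_conv_of_real)

lemma bounded_linear_vector_scalar_mult_left: "bounded_linear (\<lambda>c. c *s (v :: complex ^ 'd))"
  by (intro bounded_linear_intro[where K = "norm v"])
     (simp_all add: vec_eq_iff algebra_simps norm_vector_scalar_mult)

lemma bounded_linear_vector_scalar_mult_right: "bounded_linear (\<lambda>v :: complex ^ 'd. c *s v)"
  by (intro bounded_linear_intro[where K = "cmod c"])
     (simp_all add: vec_eq_iff algebra_simps norm_vector_scalar_mult)

lemma holomorphic_ballE:
  assumes "holomorphic_ball f" "z \<in> ball 0 1"
  obtains D where "(f has_derivative D) (at z)" "\<And>c v. D (c *s v) = c * D v"
  using assms unfolding holomorphic_ball_def by blast

lemma holomorphic_ball_const [simp]: "holomorphic_ball (\<lambda>z. c)"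
  unfolding holomorphic_ball_def by (intro ballI exI[of _ "\<lambda>v. 0"]) auto

lemma holomorphic_ball_add:
  assumes "holomorphic_ball f" "holomorphic_ball g"
  shows "holomorphic_ball (\<lambda>z. f z + g z)"
  unfolding holomorphic_ball_def
proof
  fix z :: "complex ^ 'a" assume z: "z \<in> ball 0 1"
  obtain D where "(f has_derivative D) (at z)" "\<And>c v. D (c *s v) = c * D v"
    using holomorphic_ballE[OF assms(1) z] by blast
  moreover obtain E where "(g has_derivative E) (at z)" "\<And>c v. E (c *s v) = c * E v"
    using holomorphic_ballE[OF assms(2) z] by blast
  ultimately show "\<exists>D. ((\<lambda>z. f z + g z) has_derivative D) (at z) \<and> (\<forall>c v. D (c *s v) = c * D v)"
    by (intro exI[of _ "\<lambda>v. D v + E v"]) (auto intro!: has_derivative_add simp: algebra_simps)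
qed

lemma holomorphic_ball_mult:
  assumes "holomorphic_ball f" "holomorphic_ball g"
  shows "holomorphic_ball (\<lambda>z. f z * g z)"
  unfolding holomorphic_ball_def
proof
  fix z :: "complex ^ 'a" assume z: "z \<in> ball 0 1"
  obtain D where "(f has_derivative D) (at z)" "\<And>c v. D (c *s v) = c * D v"
    using holomorphic_ballE[OF assms(1) z] by blast
  moreover obtain E where "(g has_derivative E) (at z)" "\<And>c v. E (c *s v) = c * E v"
    using holomorphic_ballE[OF assms(2) z] by blast
  ultimately show "\<exists>D. ((\<lambda>z. f z * g z) has_derivative D) (at z) \<and> (\<forall>c v. D (c *s v) = c * D v)"
    by (intro exI[of _ "\<lambda>v. f z * E v + D v * g z"] conjI has_derivative_mult)
       (auto simp: algebra_simps)
qed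

lemma holomorphic_ball_cmult: "holomorphic_ball f \<Longrightarrow> holomorphic_ball (\<lambda>z. c * f z)"
  by (intro holomorphic_ball_mult holomorphic_ball_const)

lemma holomorphic_ball_diff:
  "holomorphic_ball f \<Longrightarrow> holomorphic_ball g \<Longrightarrow> holomorphic_ball (\<lambda>z. f z - g z)"
  using holomorphic_ball_add[of f "\<lambda>z. (-1) * g z"] holomorphic_ball_cmult[of g "-1"] by simp

lemma holomorphic_ball_power: "holomorphic_ball f \<Longrightarrow> holomorphic_ball (\<lambda>z. f z ^ n)"
  by (induction n) (simp_all add: holomorphic_ball_mult)

lemma holomorphic_ball_cong:
  assumes "\<And>z. z \<in> ball 0 1 \<Longrightarrow> f z = g z"
  shows "holomorphic_ball f \<longleftrightarrow> holomorphic_ball g"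
proof -
  have *: "holomorphic_ball g" if "holomorphic_ball f" "\<And>z. z \<in> ball 0 1 \<Longrightarrow> f z = g z"
    for f g :: "complex ^ 'a \<Rightarrow> complex"
    using that unfolding holomorphic_ball_def
    by (metis (no_types, lifting) has_derivative_transform_within_open open_ball)
  show ?thesis
    using *[of f g] *[of g f] assms by auto
qed

lemma holomorphic_ball_affine:
  fixes p :: "complex ^ 'd"
  assumes f: "holomorphic_ball f" and le: "norm p + \<bar>r\<bar> \<le> 1"
  shows "holomorphic_ball (\<lambda>w. f (p + r *\<^sub>R w))"
proof (cases "r = 0")
  case False
  show ?thesis
    unfolding holomorphic_ball_def
  proof
    fix w :: "complex ^ 'd" assume w: "w \<in> ball 0 1"
    have "norm (p + r *\<^sub>R w) \<le> norm p + \<bar>r\<bar> * norm w"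
      using norm_triangle_ineq[of p "r *\<^sub>R w"] by simp
    also have "\<dots> < norm p + \<bar>r\<bar>"
      using w False by simp
    finally have "p + r *\<^sub>R w \<in> ball 0 1"
      using le by simp
    then obtain D where D: "(f has_derivative D) (at (p + r *\<^sub>R w))"
        "\<And>c v. D (c *s v) = c * D v"
      using holomorphic_ballE[OF f] by blast
    have "((\<lambda>w. p + r *\<^sub>R w) has_derivative (\<lambda>v. r *\<^sub>R v)) (at w)"
      by (auto intro!: derivative_eq_intros)
    from has_derivative_compose[OF this D(1)]
    have "((\<lambda>w. f (p + r *\<^sub>R w)) has_derivative (\<lambda>v. D (r *\<^sub>R v))) (at w)" .
    moreover have "D (r *\<^sub>R (c *s v)) = c * D (r *\<^sub>R v)" for c v
      by (simp add: scaleR_eq_vector_scalar_mult D(2))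
    ultimately show "\<exists>D. ((\<lambda>w. f (p + r *\<^sub>R w)) has_derivative D) (at w) \<and>
        (\<forall>c v. D (c *s v) = c * D v)"
      by blast
  qed
qed simp

lemma holomorphic_ball_scaleR:
  "holomorphic_ball f \<Longrightarrow> \<bar>r\<bar> \<le> 1 \<Longrightarrow> holomorphic_ball (\<lambda>w. f (r *\<^sub>R w))"
  using holomorphic_ball_affine[of f 0 r] by simp

lemma holomorphic_ball_continuous_on: "holomorphic_ball f \<Longrightarrow> continuous_on (ball 0 1) f"
  by (meson continuous_at_imp_continuous_on has_derivative_continuous holomorphic_ball_def)

lemma holomorphic_ball_measurable:
  "holomorphic_ball f \<Longrightarrow> (\<lambda>z. indicator (ball 0 1) z *\<^sub>R f z) \<in> borel_measurable borel"
  by (intro borel_measurable_continuous_on_indicator holomorphic_ball_continuous_on) auto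

lemma holomorphic_ball_bounded:
  assumes "holomorphic_ball f" "\<rho> < 1"
  obtains K where "K > 0" "\<And>z. norm z \<le> \<rho> \<Longrightarrow> cmod (f z) \<le> K"
proof -
  have "compact (f ` cball 0 \<rho>)"
    using assms by (intro compact_continuous_image continuous_on_subset[OF holomorphic_ball_continuous_on]) auto
  then obtain K where "\<forall>x\<in>f ` cball 0 \<rho>. norm x \<le> K"
    using compact_imp_bounded bounded_iff by metis
  then show thesis
    using that[of "max K 1"] by force
qed

text \<open>Several-variable statements are reduced to one complex variable by restricting a function to the
  complex lines $\zeta \mapsto p + \zeta v$.\<close>

lemma has_derivative_slice:
  fixes p v :: "complex ^ 'd"
  assumes "(f has_derivative D) (at (p + \<zeta> *s v))" and "\<And>c u. D (c *s u) = c * D u"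
  shows "((\<lambda>\<zeta>. f (p + \<zeta> *s v)) has_field_derivative D v) (at \<zeta>)"
proof -
  have "((\<lambda>\<zeta>. p + \<zeta> *s v) has_derivative (\<lambda>h. h *s v)) (at \<zeta>)"
    using bounded_linear_imp_has_derivative[OF bounded_linear_vector_scalar_mult_left, of v "at \<zeta>"]
    by (auto intro!: derivative_eq_intros)
  from has_derivative_compose[OF this assms(1)] show ?thesis
    by (simp add: has_field_derivative_def assms(2) mult_commute_abs)
qed

lemma open_slice: "open {\<zeta>. p + \<zeta> *s v \<in> ball (0 :: complex ^ 'd) 1}"
proof -
  have "{\<zeta>. p + \<zeta> *s v \<in> ball 0 1} = (\<lambda>\<zeta>. p + \<zeta> *s v) -` ball 0 1"
    by auto
  moreover have "open ((\<lambda>\<zeta>. p + \<zeta> *s v) -` ball 0 1)"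
    by (intro open_vimage continuous_intros
        linear_continuous_on[OF bounded_linear_vector_scalar_mult_left]) auto
  ultimately show ?thesis by simp
qed

lemma holomorphic_on_slice:
  assumes "holomorphic_ball f"
  shows "(\<lambda>\<zeta>. f (p + \<zeta> *s v)) holomorphic_on {\<zeta>. p + \<zeta> *s v \<in> ball 0 1}"
proof (subst holomorphic_on_open[OF open_slice], safe)
  fix \<zeta> assume "p + \<zeta> *s v \<in> ball 0 1"
  then obtain D where "(f has_derivative D) (at (p + \<zeta> *s v))" "\<And>c u. D (c *s u) = c * D u"
    using holomorphic_ballE[OF assms] by blast
  from has_derivative_slice[OF this]
  show "\<exists>f'. ((\<lambda>\<zeta>. f (p + \<zeta> *s v)) has_field_derivative f') (at \<zeta>)" by blast
qed

text \<open>The derivative in the direction $v$ is the derivative of a slice, which is holomorphic on the disk of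
  radius $\delta/|v|$.\<close>

lemma Cauchy_estimate_derivative:
  fixes z :: "complex ^ 'd"
  assumes f: "holomorphic_ball f" and D: "(f has_derivative D) (at z)" "\<And>c v. D (c *s v) = c * D v"
    and B: "\<And>w. norm w \<le> \<rho> \<Longrightarrow> cmod (f w) \<le> B" and z: "norm z + \<delta> \<le> \<rho>" "0 < \<delta>" "\<rho> < 1"
  shows "cmod (D v) \<le> B / \<delta> * norm v"
proof (cases "v = 0")
  case True
  then show ?thesis using D(2)[of 0 v] by simp
next
  case False
  let ?s = "\<lambda>\<zeta>. f (z + \<zeta> *s v)" and ?r = "\<delta> / norm v"
  have r: "0 < ?r" using False z by simp
  have le: "norm (z + \<zeta> *s v) \<le> \<rho>" if "cmod \<zeta> \<le> ?r" for \<zeta>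
  proof -
    have "norm (z + \<zeta> *s v) \<le> norm z + cmod \<zeta> * norm v"
      using norm_triangle_ineq[of z "\<zeta> *s v"] by (simp add: norm_vector_scalar_mult)
    also have "cmod \<zeta> * norm v \<le> \<delta>"
      using that False by (simp add: field_simps)
    finally show ?thesis using z by simp
  qed
  have "?s holomorphic_on cball 0 ?r"
    using le z by (intro holomorphic_on_subset[OF holomorphic_on_slice[OF f]]) force
  then have "cmod ((deriv ^^ 1) ?s 0) \<le> fact 1 * B / ?r ^ 1"
    using r B le
    by (intro Cauchy_inequality) (auto intro: holomorphic_on_subset holomorphic_on_imp_continuous_on)
  moreover have "deriv ?s 0 = D v"
    using D by (intro DERIV_imp_deriv has_derivative_slice) simp_all
  ultimately show ?thesis
    using False by (simp add: field_simps)
qed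

text \<open>By the Cauchy estimate the derivatives form a locally uniform Cauchy sequence, and the limit of the
  derivatives is the derivative of the limit.\<close>

lemma holomorphic_ball_uniform_limit:
  fixes f :: "complex ^ 'd \<Rightarrow> complex"
  assumes F: "\<And>n. holomorphic_ball (F n)"
    and lim: "\<And>\<rho>. 0 < \<rho> \<Longrightarrow> \<rho> < 1 \<Longrightarrow> uniform_limit (cball 0 \<rho>) F f sequentially"
  shows "holomorphic_ball f"
  unfolding holomorphic_ball_def
proof
  fix z :: "complex ^ 'd" assume z: "z \<in> ball 0 1"
  define \<rho> where "\<rho> = (1 + norm z) / 2"
  define \<rho>' where "\<rho>' = (1 + \<rho>) / 2"
  have \<rho>: "norm z < \<rho>" "\<rho> < \<rho>'" "\<rho>' < 1" "0 < \<rho>'"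
    using z by (auto simp: \<rho>_def \<rho>'_def add_pos_nonneg)
  have "\<exists>D. \<forall>n. \<forall>x\<in>ball 0 1. (F n has_derivative D n x) (at x) \<and> (\<forall>c v. D n x (c *s v) = c * D n x v)"
    using F unfolding holomorphic_ball_def by metis
  then obtain D where D: "\<And>n x. x \<in> ball 0 1 \<Longrightarrow> (F n has_derivative D n x) (at x)"
      "\<And>n x c v. x \<in> ball 0 1 \<Longrightarrow> D n x (c *s v) = c * D n x v"
    by blast
  have inball: "x \<in> ball 0 1" if "x \<in> ball 0 \<rho>" for x :: "complex ^ 'd"
    using that \<rho> by simp
  have diff: "cmod (D n x v - D m x v) \<le> e * norm v"
    if x: "x \<in> ball 0 \<rho>" and e: "\<And>w. norm w \<le> \<rho>' \<Longrightarrow> cmod (F n w - F m w) \<le> e * (\<rho>' - \<rho>)"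
    for n m x v e
  proof -
    have "cmod (D n x v - D m x v) \<le> e * (\<rho>' - \<rho>) / (\<rho>' - \<rho>) * norm v"
      using x \<rho> D[OF inball[OF x]] e
      by (intro Cauchy_estimate_derivative[where f = "\<lambda>w. F n w - F m w" and \<rho> = \<rho>' and z = x])
         (auto intro!: holomorphic_ball_diff F has_derivative_diff simp: algebra_simps)
    then show ?thesis using \<rho> by simp
  qed
  have ev: "\<forall>\<^sub>F n in sequentially. \<forall>w. norm w \<le> \<rho>' \<longrightarrow> cmod (F n w - f w) \<le> e" if "e > 0" for e
  proof -
    have "\<forall>\<^sub>F n in sequentially. \<forall>w\<in>cball 0 \<rho>'. dist (F n w) (f w) < e"
      using uniform_limitD[OF lim[of \<rho>'] that] \<rho> by simp
    then show ?thesis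
      by eventually_elim (force simp: dist_norm)
  qed
  have Cau: "\<exists>M. \<forall>m\<ge>M. \<forall>n\<ge>M. \<forall>x\<in>ball 0 \<rho>. \<forall>v. cmod (D n x v - D m x v) \<le> e * norm v"
    if e: "e > 0" for e
  proof -
    have "e * (\<rho>' - \<rho>) / 2 > 0" using e \<rho> by simp
    from ev[OF this] obtain M where
      M: "\<And>n w. n \<ge> M \<Longrightarrow> norm w \<le> \<rho>' \<Longrightarrow> cmod (F n w - f w) \<le> e * (\<rho>' - \<rho>) / 2"
      unfolding eventually_sequentially by blast
    have "cmod (F n w - F m w) \<le> e * (\<rho>' - \<rho>)" if "m \<ge> M" "n \<ge> M" "norm w \<le> \<rho>'" for m n w
      using M[of m w] M[of n w] that norm_triangle_ineq4[of "F n w - f w" "F m w - f w"] by simp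
    then show ?thesis using diff by meson
  qed
  define g where "g x v = lim (\<lambda>n. D n x v)" for x v
  have Dg: "(\<lambda>n. D n x v) \<longlonglongrightarrow> g x v" if x: "x \<in> ball 0 \<rho>" for x v
  proof -
    have "Cauchy (\<lambda>n. D n x v)"
    proof (rule metric_CauchyI)
      fix e :: real assume e: "e > 0"
      then have "e / (norm v + 1) > 0" by (simp add: add_nonneg_pos)
      from Cau[OF this] obtain M where M: "\<And>m n. m \<ge> M \<Longrightarrow> n \<ge> M \<Longrightarrow>
          cmod (D n x v - D m x v) \<le> e / (norm v + 1) * norm v"
        using x by blast
      have "e / (norm v + 1) * norm v < e"
        using e by (simp add: pos_divide_less_eq add_nonneg_pos distrib_left)
      then show "\<exists>M. \<forall>m\<ge>M. \<forall>n\<ge>M. dist (D m x v) (D n x v) < e"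
        using M by (intro exI[of _ M]) (force simp: dist_norm)
    qed
    then show ?thesis unfolding g_def by (simp add: Cauchy_convergent convergent_LIMSEQ_iff[symmetric])
  qed
  have "\<exists>h. \<forall>x\<in>ball 0 \<rho>. (\<lambda>n. F n x) \<longlonglongrightarrow> h x \<and> (h has_derivative g x) (at x within ball 0 \<rho>)"
  proof (rule has_derivative_sequence)
    show "convex (ball 0 \<rho> :: (complex ^ 'd) set)" by simp
    show "(F n has_derivative D n x) (at x within ball 0 \<rho>)" if "x \<in> ball 0 \<rho>" for n x
      using D(1)[OF inball[OF that]] by (rule has_derivative_at_withinI)
    show "z \<in> ball 0 \<rho>" using \<rho> by simp
    show "(\<lambda>n. F n z) \<longlonglongrightarrow> f z"
      using tendsto_uniform_limitI[OF lim[of \<rho>'], of z] \<rho> by simp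
    fix e :: real assume "e > 0"
    then obtain M where M: "\<And>m n x v. m \<ge> M \<Longrightarrow> n \<ge> M \<Longrightarrow> x\<in>ball 0 \<rho> \<Longrightarrow> cmod (D n x v - D m x v) \<le> e * norm v"
      using Cau by blast
    have "cmod (D n x v - g x v) \<le> e * norm v" if "n \<ge> M" "x \<in> ball 0 \<rho>" for n x v
    proof (rule LIMSEQ_le_const2)
      show "(\<lambda>m. cmod (D n x v - D m x v)) \<longlonglongrightarrow> cmod (D n x v - g x v)"
        by (intro tendsto_intros Dg that)
      show "\<exists>K. \<forall>m\<ge>K. cmod (D n x v - D m x v) \<le> e * norm v"
        using M that by blast
    qed
    then show "\<forall>\<^sub>F n in sequentially. \<forall>x\<in>ball 0 \<rho>. \<forall>v. cmod (D n x v - g x v) \<le> e * norm v"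
      unfolding eventually_sequentially by blast
  qed
  then obtain h where h: "\<And>x. x \<in> ball 0 \<rho> \<Longrightarrow> (\<lambda>n. F n x) \<longlonglongrightarrow> h x"
      "\<And>x. x \<in> ball 0 \<rho> \<Longrightarrow> (h has_derivative g x) (at x within ball 0 \<rho>)"
    by blast
  have hf: "h x = f x" if "x \<in> ball 0 \<rho>" for x
    using LIMSEQ_unique[OF h(1)[OF that] tendsto_uniform_limitI[OF lim[of \<rho>'], of x]] that \<rho> by simp
  have zb: "z \<in> ball 0 \<rho>" using \<rho> by simp
  have "(h has_derivative g z) (at z)"
    using h(2)[OF zb] zb at_within_open[of z "ball 0 \<rho>"] by simp
  then have "(f has_derivative g z) (at z)"
    by (rule has_derivative_transform_within_open[OF _ open_ball zb hf])
  moreover have "g z (c *s v) = c * g z v" for c v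
  proof (rule LIMSEQ_unique)
    show "(\<lambda>n. D n z (c *s v)) \<longlonglongrightarrow> g z (c *s v)" by (rule Dg[OF zb])
    show "(\<lambda>n. D n z (c *s v)) \<longlonglongrightarrow> c * g z v"
      unfolding D(2)[OF inball[OF zb]] by (intro tendsto_intros Dg zb)
  qed
  ultimately show "\<exists>D. (f has_derivative D) (at z) \<and> (\<forall>c v. D (c *s v) = c * D v)"
    by blast
qed

section \<open>The radial derivative\<close>

text \<open>The radial derivative is the derivative in the direction of the point itself, since
  $\sum_j z_j D(e_j) = D(z)$.\<close>

lemma radial_deriv_eq:
  fixes z :: "complex ^ 'd"
  assumes "(f has_derivative D) (at z)" and hom: "\<And>c v. D (c *s v) = c * D v"
  shows "radial_deriv f z = D z"
proof -
  have "partial_deriv j f z = D (axis j 1)" for j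
  proof -
    have ax: "axis j w = w *s axis j 1" for w :: complex
      by (simp add: axis_def vec_eq_iff)
    have "(\<lambda>w. f (z + axis j w)) = (\<lambda>w. f (z + w *s axis j 1))"
      by (rule ext, subst ax, rule refl)
    moreover have "((\<lambda>w. f (z + w *s axis j 1)) has_field_derivative D (axis j 1)) (at 0)"
      using assms by (intro has_derivative_slice) simp_all
    ultimately show ?thesis
      by (simp add: partial_deriv_def DERIV_imp_deriv)
  qed
  moreover have "linear D"
    using assms(1) has_derivative_linear by blast
  then have "D z = (\<Sum>j\<in>UNIV. D (z $ j *s axis j 1))"
    by (subst basis_expansion[of z, symmetric]) (rule linear_sum)
  ultimately show ?thesis
    by (simp add: radial_deriv_def hom)
qed

lemma slice_has_field_derivative:
  fixes w :: "complex ^ 'd"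
  assumes "holomorphic_ball f" "\<zeta> *s w \<in> ball 0 1"
  shows "((\<lambda>\<zeta>. f (\<zeta> *s w)) has_field_derivative deriv (\<lambda>\<zeta>. f (\<zeta> *s w)) \<zeta>) (at \<zeta>)"
  using holomorphic_derivI[OF holomorphic_on_slice[OF assms(1), of 0 w] open_slice, of \<zeta>] assms(2)
  by simp

lemma slice_analytic:
  fixes w :: "complex ^ 'd"
  assumes "holomorphic_ball f" "\<zeta> *s w \<in> ball 0 1"
  shows "(\<lambda>\<zeta>. f (\<zeta> *s w)) analytic_on {\<zeta>}"
proof -
  have "(\<lambda>\<zeta>. f (0 + \<zeta> *s w)) analytic_on {\<zeta>}"
    unfolding analytic_at using assms(2)
    by (intro exI[of _ "{\<zeta>. 0 + \<zeta> *s w \<in> ball 0 1}"] conjI holomorphic_on_slice open_slice assms(1)) simp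
  then show ?thesis by simp
qed

lemma radial_deriv_slice:
  fixes w :: "complex ^ 'd"
  assumes "holomorphic_ball f" "\<zeta> *s w \<in> ball 0 1"
  shows "radial_deriv f (\<zeta> *s w) = \<zeta> * deriv (\<lambda>\<zeta>. f (\<zeta> *s w)) \<zeta>"
proof -
  obtain D where D: "(f has_derivative D) (at (\<zeta> *s w))" "\<And>c v. D (c *s v) = c * D v"
    using holomorphic_ballE[OF assms] by blast
  have "deriv (\<lambda>\<zeta>. f (\<zeta> *s w)) \<zeta> = D w"
    using D has_derivative_slice[of f D 0 \<zeta> w] by (intro DERIV_imp_deriv) simp
  then show ?thesis
    using radial_deriv_eq[OF D] by (simp add: D(2))
qed

lemma first_order_Taylor_bound:
  fixes s :: "complex \<Rightarrow> complex"
  assumes hol: "s holomorphic_on cball a \<delta>" and \<delta>: "0 < \<delta>"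
    and K: "\<And>z. z \<in> cball a \<delta> \<Longrightarrow> cmod (s z) \<le> K" and t: "cmod t \<le> \<delta> / 2"
  shows "cmod (s (a + t) - (s a + deriv s a * t)) \<le> 8 * K / \<delta>\<^sup>2 * (cmod t)\<^sup>2"
proof -
  let ?S = "cball a (\<delta> / 2)" and ?F = "\<lambda>i. (deriv ^^ i) s"
  have sub: "cball x (\<delta> / 2) \<subseteq> cball a \<delta>" if "x \<in> ?S" for x
    using that by (subst cball_subset_cball_iff) (auto simp: dist_commute)
  have hol': "s holomorphic_on ball a \<delta>"
    using hol by (rule holomorphic_on_subset) auto
  have "cmod (?F 0 (a + t) - (\<Sum>i\<le>1. ?F i a * ((a + t) - a) ^ i / fact i))
      \<le> 8 * K / \<delta>\<^sup>2 * cmod ((a + t) - a) ^ Suc 1 / fact 1"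
  proof (rule complex_Taylor[where S = ?S])
    show "a \<in> ?S" "a + t \<in> ?S" using \<delta> t by (auto simp: dist_norm)
    show "(?F i has_field_derivative ?F (Suc i) x) (at x within ?S)" if "x \<in> ?S" for i x
    proof -
      have "x \<in> ball a \<delta>" using that \<delta> by auto
      then have "(?F i has_field_derivative deriv (?F i) x) (at x)"
        by (rule holomorphic_derivI[OF holomorphic_higher_deriv[OF hol' open_ball] open_ball])
      then show ?thesis by (simp add: DERIV_subset[OF _ subset_UNIV])
    qed
    show "cmod (?F (Suc 1) x) \<le> 8 * K / \<delta>\<^sup>2" if x: "x \<in> ?S" for x
    proof -
      have "norm (?F (Suc 1) x) \<le> fact (Suc 1) * K / (\<delta> / 2) ^ Suc 1"
      proof (rule Cauchy_inequality)
        show "s holomorphic_on ball x (\<delta> / 2)"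
          using sub[OF x] by (intro holomorphic_on_subset[OF hol]) auto
        show "continuous_on (cball x (\<delta> / 2)) s"
          using sub[OF x] holomorphic_on_imp_continuous_on[OF hol] continuous_on_subset by blast
        show "norm (s y) \<le> K" if "norm (x - y) = \<delta> / 2" for y
          using sub[OF x] that by (intro K) (auto simp: dist_norm)
      qed (use \<delta> in auto)
      then show ?thesis by (simp add: power2_eq_square)
    qed
  qed auto
  then show ?thesis by (simp add: power2_eq_square)
qed

text \<open>The radial derivative is the locally uniform limit of the difference quotients
  $(f((1+t)z)-f(z))/t$.\<close>

lemma holomorphic_ball_radial_deriv:
  fixes f :: "complex ^ 'd \<Rightarrow> complex"
  assumes f: "holomorphic_ball f"
  shows "holomorphic_ball (radial_deriv f)"
proof -
  have scaled: "holomorphic_ball (\<lambda>x. radial_deriv f (\<rho> *\<^sub>R x))" if \<rho>: "0 < \<rho>" "\<rho> < 1" for \<rho>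
  proof -
    define \<rho>' where "\<rho>' = (1 + \<rho>) / 2"
    have \<rho>': "\<rho> < \<rho>'" "\<rho>' < 1" using \<rho> by (auto simp: \<rho>'_def)
    define \<delta> where "\<delta> = \<rho>' / \<rho> - 1"
    have \<delta>: "0 < \<delta>" "(1 + \<delta>) * \<rho> = \<rho>'" using \<rho> \<rho>' by (auto simp: \<delta>_def field_simps)
    obtain K where K: "K > 0" "\<And>z. norm z \<le> \<rho>' \<Longrightarrow> cmod (f z) \<le> K"
      using holomorphic_ball_bounded[OF f \<rho>'(2)] by blast
    define t where "t n = \<delta> / (2 * (real n + 1))" for n :: nat
    have t: "0 < t n" "t n \<le> \<delta> / 2" for n
      using \<delta> by (auto simp: t_def field_simps)
    have t0: "t \<longlonglongrightarrow> 0"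
      unfolding t_def by real_asymp
    have small: "\<bar>(1 + t n) * \<rho>\<bar> \<le> 1" for n
    proof -
      have "(1 + t n) * \<rho> \<le> (1 + \<delta>) * \<rho>"
        using t[of n] \<delta> \<rho> by (intro mult_right_mono) auto
      then show ?thesis
        using t[of n] \<rho> \<rho>' \<delta> by (simp add: abs_of_pos)
    qed
    define F where "F n x = (f (((1 + t n) * \<rho>) *\<^sub>R x) - f (\<rho> *\<^sub>R x)) * (1 / of_real (t n))"
      for n and x :: "complex ^ 'd"
    have bound: "cmod (F n x - radial_deriv f (\<rho> *\<^sub>R x)) \<le> 8 * K / \<delta>\<^sup>2 * t n"
      if x: "norm x \<le> 1" for n x
    proof -
      let ?s = "\<lambda>\<zeta>. f (\<zeta> *s (\<rho> *\<^sub>R x))"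
      have le: "norm (\<zeta> *s (\<rho> *\<^sub>R x)) \<le> \<rho>'" if "\<zeta> \<in> cball 1 \<delta>" for \<zeta>
      proof -
        have "cmod \<zeta> \<le> 1 + \<delta>"
          using that norm_triangle_ineq2[of \<zeta> 1] by (simp add: dist_norm norm_minus_commute)
        then have "cmod \<zeta> * (\<rho> * norm x) \<le> (1 + \<delta>) * (\<rho> * 1)"
          using x \<rho> \<delta> by (intro mult_mono) auto
        then show ?thesis using \<rho> \<delta> by (simp add: norm_vector_scalar_mult)
      qed
      have "?s holomorphic_on cball 1 \<delta>"
        using le \<rho>'
        by (intro holomorphic_on_subset[OF holomorphic_on_slice[OF f, of 0 "\<rho> *\<^sub>R x", simplified]]) force
      then have "cmod (?s (1 + of_real (t n)) - (?s 1 + deriv ?s 1 * of_real (t n)))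
          \<le> 8 * K / \<delta>\<^sup>2 * (cmod (of_real (t n)))\<^sup>2"
        using \<delta> t[of n] le K by (intro first_order_Taylor_bound) auto
      moreover have "radial_deriv f (\<rho> *\<^sub>R x) = deriv ?s 1"
        using radial_deriv_slice[OF f, of 1 "\<rho> *\<^sub>R x"] le[of 1] \<rho>' \<delta> by simp
      moreover have "?s (1 + of_real (t n)) = f (((1 + t n) * \<rho>) *\<^sub>R x)"
      proof -
        have "(1 + of_real (t n)) *s (\<rho> *\<^sub>R x) = ((1 + t n) * \<rho>) *\<^sub>R x"
          by (simp add: scaleR_eq_vector_scalar_mult vector_smult_assoc)
        then show ?thesis by simp
      qed
      ultimately have "cmod (f (((1 + t n) * \<rho>) *\<^sub>R x) - f (\<rho> *\<^sub>R x)
          - radial_deriv f (\<rho> *\<^sub>R x) * of_real (t n)) \<le> 8 * K / \<delta>\<^sup>2 * t n * t n"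
        using t[of n] by (simp add: power2_eq_square algebra_simps)
      moreover have "f (((1 + t n) * \<rho>) *\<^sub>R x) - f (\<rho> *\<^sub>R x) - radial_deriv f (\<rho> *\<^sub>R x) * of_real (t n)
          = (F n x - radial_deriv f (\<rho> *\<^sub>R x)) * of_real (t n)"
        using t[of n] by (simp add: F_def field_simps)
      ultimately have "cmod (F n x - radial_deriv f (\<rho> *\<^sub>R x)) * t n \<le> 8 * K / \<delta>\<^sup>2 * t n * t n"
        using t[of n] by (simp add: norm_mult)
      then show ?thesis using t(1)[of n] by (rule mult_right_le_imp_le)
    qed
    show ?thesis
    proof (rule holomorphic_ball_uniform_limit[where F = F])
      show "holomorphic_ball (F n)" for n
      proof -
        have "holomorphic_ball (\<lambda>x. f (((1 + t n) * \<rho>) *\<^sub>R x) - f (\<rho> *\<^sub>R x))"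
          using small[of n] \<rho> by (intro holomorphic_ball_diff holomorphic_ball_scaleR[OF f]) auto
        from holomorphic_ball_mult[OF this holomorphic_ball_const] show ?thesis
          unfolding F_def .
      qed
      have "(\<lambda>n. 8 * K / \<delta>\<^sup>2 * t n) \<longlonglongrightarrow> 0"
        using tendsto_mult_right_zero[OF t0] .
      then show "uniform_limit (cball 0 r) F (\<lambda>x. radial_deriv f (\<rho> *\<^sub>R x)) sequentially"
        if "r < 1" for r
      proof (intro uniform_limitI)
        fix e :: real assume "e > 0"
        with \<open>(\<lambda>n. 8 * K / \<delta>\<^sup>2 * t n) \<longlonglongrightarrow> 0\<close> have "\<forall>\<^sub>F n in sequentially. 8 * K / \<delta>\<^sup>2 * t n < e"
          by (rule order_tendstoD)
        then show "\<forall>\<^sub>F n in sequentially. \<forall>x\<in>cball 0 r. dist (F n x) (radial_deriv f (\<rho> *\<^sub>R x)) < e"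
        proof eventually_elim
          case (elim n)
          show ?case
          proof
            fix x :: "complex ^ 'd" assume "x \<in> cball 0 r"
            then have "norm x \<le> 1" using that by simp
            from bound[OF this, of n] elim show "dist (F n x) (radial_deriv f (\<rho> *\<^sub>R x)) < e"
              by (simp add: dist_norm)
          qed
        qed
      qed
    qed
  qed
  show ?thesis
    unfolding holomorphic_ball_def
  proof
    fix z :: "complex ^ 'd" assume z: "z \<in> ball 0 1"
    define \<rho> where "\<rho> = (1 + norm z) / 2"
    have \<rho>: "0 < \<rho>" "\<rho> < 1" "norm z < \<rho>" using z by (auto simp: \<rho>_def add_pos_nonneg)
    have "(1 / \<rho>) *\<^sub>R z \<in> ball 0 1" using \<rho> by simp
    then obtain D where D: "((\<lambda>x. radial_deriv f (\<rho> *\<^sub>R x)) has_derivative D) (at ((1 / \<rho>) *\<^sub>R z))"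
        "\<And>c v. D (c *s v) = c * D v"
      using holomorphic_ballE[OF scaled[OF \<rho>(1,2)]] by blast
    have "((\<lambda>x. (1 / \<rho>) *\<^sub>R x) has_derivative (\<lambda>v. (1 / \<rho>) *\<^sub>R v)) (at z)"
      by (auto intro!: derivative_eq_intros)
    from has_derivative_compose[OF this D(1)]
    have "(radial_deriv f has_derivative (\<lambda>v. D ((1 / \<rho>) *\<^sub>R v))) (at z)"
      using \<rho> by simp
    moreover have "D ((1 / \<rho>) *\<^sub>R (c *s v)) = c * D ((1 / \<rho>) *\<^sub>R v)" for c v
      by (simp add: scaleR_eq_vector_scalar_mult D(2))
    ultimately show "\<exists>D. (radial_deriv f has_derivative D) (at z) \<and> (\<forall>c v. D (c *s v) = c * D v)"
      by blast
  qed
qed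

lemma holomorphic_ball_radial_deriv_iter:
  "holomorphic_ball f \<Longrightarrow> holomorphic_ball ((radial_deriv ^^ N) f)"
  by (induction N) (simp_all add: holomorphic_ball_radial_deriv)

text \<open>Along the curves $t \mapsto e^t w$ the radial derivative becomes $d/dt$, without the factors that
  iteration produces along $\zeta \mapsto \zeta w$.\<close>

lemma radial_deriv_iter_exp_slice:
  fixes w :: "complex ^ 'd"
  assumes f: "holomorphic_ball f" and t: "exp t *s w \<in> ball 0 1"
  shows "(radial_deriv ^^ N) f (exp t *s w) = (deriv ^^ N) (\<lambda>t. f (exp t *s w)) t"
  using t
proof (induction N arbitrary: t)
  case (Suc N)
  let ?g = "(radial_deriv ^^ N) f" and ?T = "{t. exp t *s w \<in> ball 0 1}"
  have "open ?T"
  proof -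
    have "continuous_on UNIV (\<lambda>t. exp t *s w)"
      by (intro bounded_linear.continuous_on[OF bounded_linear_vector_scalar_mult_left] continuous_intros)
    from open_vimage[OF open_ball this, of 0 1] show ?thesis by (simp add: vimage_def)
  qed
  have g: "holomorphic_ball ?g"
    using f by (rule holomorphic_ball_radial_deriv_iter)
  have "deriv (\<lambda>t. ?g (exp t *s w)) t = exp t * deriv (\<lambda>\<zeta>. ?g (\<zeta> *s w)) (exp t)"
    using DERIV_chain'[OF DERIV_exp slice_has_field_derivative[OF g Suc.prems]]
    by (simp add: DERIV_imp_deriv mult.commute)
  also have "\<dots> = radial_deriv ?g (exp t *s w)"
    using radial_deriv_slice[OF g Suc.prems] by simp
  also have "deriv (\<lambda>t. ?g (exp t *s w)) t = deriv ((deriv ^^ N) (\<lambda>t. f (exp t *s w))) t"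
    using Suc \<open>open ?T\<close>
    by (intro deriv_cong_ev refl eventually_mono[OF eventually_nhds_in_open[of ?T]]) auto
  finally show ?case by simp
qed simp

lemma analytic_exp_slice:
  fixes w :: "complex ^ 'd"
  assumes f: "holomorphic_ball f" and w: "w \<in> ball 0 1"
  shows "(\<lambda>t. f (exp t *s w)) analytic_on {0}"
proof -
  have "(\<lambda>\<zeta>. f (\<zeta> *s w)) analytic_on {1}"
    using w by (intro slice_analytic[OF f]) simp
  then have "((\<lambda>\<zeta>. f (\<zeta> *s w)) \<circ> exp) analytic_on {0}"
    by (intro analytic_on_compose) (auto intro: analytic_intros)
  then show ?thesis by (simp add: o_def)
qed

text \<open>Up to factorials, the iterated radial derivatives at a point are the coefficients of a formal power
  series that is multiplicative in the function. Product and chain rules for $R^N$ thereby turn into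
  identities between formal power series.\<close>

lemma has_fps_expansion_exp_slice:
  fixes w :: "complex ^ 'd"
  assumes f: "holomorphic_ball f" and w: "w \<in> ball 0 1"
  obtains F where "(\<lambda>t. f (exp t *s w)) has_fps_expansion F"
    "\<And>N. (radial_deriv ^^ N) f w = fact N * fps_nth F N"
proof
  let ?F = "fps_expansion (\<lambda>t. f (exp t *s w)) 0"
  show "(\<lambda>t. f (exp t *s w)) has_fps_expansion ?F"
    by (intro analytic_at_imp_has_fps_expansion_0 analytic_exp_slice assms)
  show "(radial_deriv ^^ N) f w = fact N * fps_nth ?F N" for N
    using radial_deriv_iter_exp_slice[OF f, of 0 w N] w by (simp add: fps_expansion_def)
qed

section \<open>Homogeneous components\<close>

text \<open>The value at $w$ of the homogeneous polynomial of degree $j$ in the Taylor series of $f$ at the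
  origin.\<close>

definition homogeneous_component :: "(complex ^ 'd \<Rightarrow> complex) \<Rightarrow> nat \<Rightarrow> complex ^ 'd \<Rightarrow> complex" where
  "homogeneous_component f j w = fps_nth (fps_expansion (\<lambda>\<zeta>. f (\<zeta> *s w)) 0) j"

lemma eventually_slice_in_ball: "\<forall>\<^sub>F \<zeta> in nhds 0. \<zeta> *s w \<in> ball (0 :: complex ^ 'd) 1"
  using eventually_nhds_in_open[OF open_slice[of 0 w], of 0] by simp

lemma has_fps_expansion_slice:
  fixes w :: "complex ^ 'd"
  assumes "holomorphic_ball f"
  shows "(\<lambda>\<zeta>. f (\<zeta> *s w)) has_fps_expansion Abs_fps (\<lambda>j. homogeneous_component f j w)"
proof -
  have "(\<lambda>\<zeta>. f (\<zeta> *s w)) analytic_on {0}"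
    by (rule slice_analytic[OF assms]) simp
  from analytic_at_imp_has_fps_expansion_0[OF this] show ?thesis
    by (simp add: homogeneous_component_def fps_nth_inverse)
qed

lemma homogeneous_component_eqI:
  assumes "(\<lambda>\<zeta>. f (\<zeta> *s w)) has_fps_expansion F"
  shows "homogeneous_component f j w = fps_nth F j"
  using assms by (simp add: homogeneous_component_def fps_expansion_eqI)

lemma homogeneous_component_cong:
  assumes "\<And>z. z \<in> ball 0 1 \<Longrightarrow> f z = g z"
  shows "homogeneous_component f j w = homogeneous_component g j w"
  unfolding homogeneous_component_def
  by (intro arg_cong[where f = "\<lambda>F. fps_nth F j"] fps_expansion_cong)
     (use eventually_slice_in_ball[of w] in eventually_elim, rule assms)

lemma homogeneous_component_0 [simp]: "homogeneous_component f 0 w = f 0"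
  by (simp add: homogeneous_component_def fps_expansion_def)

lemma homogeneous_component_lincomb:
  assumes "holomorphic_ball f" "holomorphic_ball g"
  shows "homogeneous_component (\<lambda>z. a * f z + b * g z) j w =
    a * homogeneous_component f j w + b * homogeneous_component g j w"
  using homogeneous_component_eqI[OF has_fps_expansion_add[
      OF has_fps_expansion_cmult_left[OF has_fps_expansion_slice[OF assms(1)], of a]
         has_fps_expansion_cmult_left[OF has_fps_expansion_slice[OF assms(2)], of b]]]
  by simp

lemma homogeneous_component_mult:
  assumes "holomorphic_ball f" "holomorphic_ball g"
  shows "homogeneous_component (\<lambda>z. f z * g z) j w =
    (\<Sum>i=0..j. homogeneous_component f i w * homogeneous_component g (j - i) w)"
  using homogeneous_component_eqI[OF has_fps_expansion_mult[OF has_fps_expansion_slice[OF assms(1)]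
      has_fps_expansion_slice[OF assms(2)]]]
  by (simp add: fps_mult_nth)

lemma homogeneous_component_radial_deriv:
  assumes f: "holomorphic_ball f"
  shows "homogeneous_component (radial_deriv f) j w = of_nat j * homogeneous_component f j w"
proof -
  let ?F = "Abs_fps (\<lambda>j. homogeneous_component f j w)"
  have a: "(\<lambda>\<zeta>. \<zeta> * deriv (\<lambda>\<zeta>. f (\<zeta> *s w)) \<zeta>) has_fps_expansion fps_X * fps_deriv ?F"
    by (intro has_fps_expansion_mult has_fps_expansion_fps_X has_fps_expansion_deriv
        has_fps_expansion_slice f)
  have b: "\<forall>\<^sub>F \<zeta> in nhds 0. \<zeta> * deriv (\<lambda>\<zeta>. f (\<zeta> *s w)) \<zeta> = radial_deriv f (\<zeta> *s w)"
    using eventually_slice_in_ball[of w] by eventually_elim (simp add: radial_deriv_slice[OF f])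
  from homogeneous_component_eqI[OF iffD1[OF has_fps_expansion_cong[OF b refl] a]] show ?thesis
    by (cases j) (simp_all add: algebra_simps del: homogeneous_component_0)
qed

lemma homogeneous_component_radial_deriv_iter:
  "holomorphic_ball f \<Longrightarrow> homogeneous_component ((radial_deriv ^^ N) f) j w =
    of_nat j ^ N * homogeneous_component f j w"
  by (induction N)
     (simp_all add: homogeneous_component_radial_deriv holomorphic_ball_radial_deriv_iter)

lemma homogeneous_component_homogeneous:
  fixes w :: "complex ^ 'd"
  assumes f: "holomorphic_ball f"
  shows "homogeneous_component f j (c *s w) = c ^ j * homogeneous_component f j w"
proof -
  have "(deriv ^^ j) (\<lambda>\<zeta>. (\<lambda>\<zeta>. f (\<zeta> *s w)) (c * \<zeta>)) 0
      = c ^ j * (deriv ^^ j) (\<lambda>\<zeta>. f (\<zeta> *s w)) (c * 0)"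
    using holomorphic_on_slice[OF f, of 0 w] open_slice[of 0 w] open_slice[of 0 "c *s w"]
    by (intro higher_deriv_compose_linear[where T = "{\<zeta>. \<zeta> *s w \<in> ball 0 1}"
          and S = "{\<zeta>. \<zeta> *s (c *s w) \<in> ball 0 1}"]) (simp_all add: vector_smult_assoc mult.commute)
  then show ?thesis
    by (simp add: homogeneous_component_def fps_expansion_def vector_smult_assoc mult.commute)
qed

lemma homogeneous_component_scaleR:
  "holomorphic_ball f \<Longrightarrow> homogeneous_component f j (r *\<^sub>R w) = of_real r ^ j * homogeneous_component f j w"
  by (simp add: scaleR_eq_vector_scalar_mult homogeneous_component_homogeneous)

lemma homogeneous_component_sums:
  fixes z :: "complex ^ 'd"
  assumes f: "holomorphic_ball f" and z: "z \<in> ball 0 1"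
  shows "(\<lambda>j. homogeneous_component f j z) sums f z"
proof -
  define r where "r = (if z = 0 then 2 else 1 / norm z)"
  have r: "1 < r" "r * norm z \<le> 1" using z by (auto simp: r_def)
  have "norm (\<zeta> *s z) < 1" if "cmod \<zeta> < r" for \<zeta>
  proof (cases "z = 0")
    case False
    then have "cmod \<zeta> * norm z < r * norm z"
      using that by (intro mult_strict_right_mono) auto
    then show ?thesis using r by (simp add: norm_vector_scalar_mult)
  qed simp
  then have "(\<lambda>\<zeta>. f (\<zeta> *s z)) holomorphic_on ball 0 r"
    by (intro holomorphic_on_subset[OF holomorphic_on_slice[OF f, of 0 z, simplified]]) auto
  from holomorphic_power_series[OF this, of 1] r show ?thesis
    by (simp add: homogeneous_component_def fps_expansion_def)
qed

lemma homogeneous_component_bound: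
  fixes w :: "complex ^ 'd"
  assumes f: "holomorphic_ball f" and \<rho>: "0 < \<rho>" "\<rho> < 1"
    and K: "\<And>z. norm z \<le> \<rho> \<Longrightarrow> cmod (f z) \<le> K"
  shows "cmod (homogeneous_component f j w) \<le> K * (norm w / \<rho>) ^ j"
proof (cases "w = 0")
  case True
  have "homogeneous_component f j (0 *s w) = 0 ^ j * homogeneous_component f j w"
    by (rule homogeneous_component_homogeneous[OF f])
  then show ?thesis
    using True K[of 0] \<rho> by (cases j) auto
next
  case False
  let ?s = "\<lambda>\<zeta>. f (\<zeta> *s w)" and ?r = "\<rho> / norm w"
  have le: "norm (\<zeta> *s w) \<le> \<rho>" if "cmod \<zeta> \<le> ?r" for \<zeta>
    using that False by (simp add: norm_vector_scalar_mult field_simps)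
  have "?s holomorphic_on cball 0 ?r"
    using le \<rho> by (intro holomorphic_on_subset[OF holomorphic_on_slice[OF f, of 0 w, simplified]]) force
  then have "cmod ((deriv ^^ j) ?s 0) \<le> fact j * K / ?r ^ j"
    using \<rho> False K le
    by (intro Cauchy_inequality) (auto intro: holomorphic_on_subset holomorphic_on_imp_continuous_on)
  then show ?thesis
    by (simp add: homogeneous_component_def fps_expansion_def norm_divide field_simps)
qed

text \<open>A component is the limit of the Taylor remainders divided by $t^j$ as $t \to 0$, and the remainder
  involves only components of smaller degree. The points $t w$ eventually enter the ball, whatever
  $w$ is; outside the ball the values of $f$ are replaced by $0$ because nothing is known there.\<close>

lemma homogeneous_component_measurable:
  fixes f :: "complex ^ 'd \<Rightarrow> complex"
  assumes f: "holomorphic_ball f"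
  shows "homogeneous_component f j \<in> borel_measurable borel"
proof (induction j rule: less_induct)
  case (less j)
  let ?f = "\<lambda>z. indicator (ball 0 1) z *\<^sub>R f z" and ?t = "\<lambda>n. 1 / (real n + 1)"
  have [measurable]: "?f \<in> borel_measurable borel"
    by (rule holomorphic_ball_measurable[OF f])
  have [measurable]: "homogeneous_component f i \<in> borel_measurable borel" if "i \<in> {..<j}" for i
    using less that by simp
  show ?case
  proof (rule borel_measurable_LIMSEQ_metric)
    show "(\<lambda>w. (?f (?t n *\<^sub>R w) - (\<Sum>i<j. of_real (?t n) ^ i * homogeneous_component f i w))
        / of_real (?t n) ^ j) \<in> borel_measurable borel" for n
      by measurable
    fix w :: "complex ^ 'd"
    let ?h = "\<lambda>\<zeta>. (f (\<zeta> *s w) - (\<Sum>i<j. \<zeta> ^ i * homogeneous_component f i w)) / \<zeta> ^ j"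
    obtain s where s: "0 < s" "\<And>\<zeta>. cmod \<zeta> < s \<Longrightarrow> \<zeta> *s w \<in> ball 0 1"
      using eventually_slice_in_ball[of w] by (auto simp: eventually_nhds_metric dist_norm)
    have sums: "(\<lambda>i. homogeneous_component f (i + j) w * \<zeta> ^ i) sums ?h \<zeta>"
      if "\<zeta> \<noteq> 0" "cmod \<zeta> < s" for \<zeta>
    proof -
      have "(\<lambda>i. \<zeta> ^ i * homogeneous_component f i w) sums f (\<zeta> *s w)"
        using homogeneous_component_sums[OF f s(2)[OF that(2)]]
        by (simp add: homogeneous_component_homogeneous[OF f])
      then have "(\<lambda>i. \<zeta> ^ (i + j) * homogeneous_component f (i + j) w) sums
          (f (\<zeta> *s w) - (\<Sum>i<j. \<zeta> ^ i * homogeneous_component f i w))"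
        by (subst sums_iff_shift) simp
      from sums_divide[OF this, of "\<zeta> ^ j"] show ?thesis
        using that by (simp add: power_add mult.commute)
    qed
    have "(?h \<longlongrightarrow> homogeneous_component f (0 + j) w) (at 0)"
      by (rule powser_limit_0_strong[OF s(1) sums])
    moreover have "?t \<longlonglongrightarrow> 0"
      by real_asymp
    from tendsto_of_real[OF this, where 'a = complex]
    have t0: "(\<lambda>n. complex_of_real (?t n)) \<longlonglongrightarrow> 0"
      by (simp only: of_real_0)
    have "?t n \<noteq> 0" for n
      by (simp add: add_nonneg_eq_0_iff)
    then have "complex_of_real (?t n) \<noteq> 0" for n
      by (simp only: of_real_eq_0_iff not_False_eq_True)
    with t0 have "filterlim (\<lambda>n. complex_of_real (?t n)) (at 0) sequentially"
      by (intro filterlim_atI always_eventually allI)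
    ultimately have "(\<lambda>n. ?h (of_real (?t n))) \<longlonglongrightarrow> homogeneous_component f j w"
      using filterlim_compose by force
    moreover have "\<forall>\<^sub>F n in sequentially. ?t n *\<^sub>R w \<in> ball 0 1"
      using eventually_compose_filterlim[OF eventually_slice_in_ball[of w] t0]
      by (simp add: scaleR_eq_vector_scalar_mult)
    then have "\<forall>\<^sub>F n in sequentially. ?h (of_real (?t n)) =
        (?f (?t n *\<^sub>R w) - (\<Sum>i<j. of_real (?t n) ^ i * homogeneous_component f i w)) / of_real (?t n) ^ j"
      by eventually_elim (simp add: scaleR_eq_vector_scalar_mult)
    ultimately show "(\<lambda>n. (?f (?t n *\<^sub>R w) - (\<Sum>i<j. of_real (?t n) ^ i * homogeneous_component f i w))
        / of_real (?t n) ^ j) \<longlonglongrightarrow> homogeneous_component f j w"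
      by (rule Lim_transform_eventually)
  qed
qed

section \<open>Orthogonality of the homogeneous components\<close>

lemma borel_measurable_cnj: "cnj \<in> borel_measurable borel"
  by (intro borel_measurable_continuous_onI continuous_intros)

definition circle_invariant :: "(complex ^ 'd) measure \<Rightarrow> bool" where
  "circle_invariant M \<longleftrightarrow> sets M = sets borel \<and> (\<forall>c. cmod c = 1 \<longrightarrow> distr M borel (\<lambda>w. c *s w) = M)"

lemma borel_measurable_vector_scalar_mult [measurable]:
  "(\<lambda>w :: complex ^ 'd. c *s w) \<in> borel_measurable borel"
  by (intro borel_measurable_continuous_onI linear_continuous_on bounded_linear_vector_scalar_mult_right)

lemma circle_invariant_distr:
  assumes M: "circle_invariant M" and T[measurable]: "T \<in> borel_measurable borel"
    and comm: "\<And>c w. T (c *s w) = c *s T w"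
  shows "circle_invariant (distr M borel T)"
  unfolding circle_invariant_def
proof safe
  fix c :: complex assume c: "cmod c = 1"
  have [measurable_cong]: "sets M = sets borel" and inv: "distr M borel (\<lambda>w. c *s w) = M"
    using M c by (auto simp: circle_invariant_def)
  have "distr (distr M borel T) borel (\<lambda>w. c *s w) = distr M borel (\<lambda>w. T (c *s w))"
    by (simp add: distr_distr o_def comm)
  also have "\<dots> = distr (distr M borel (\<lambda>w. c *s w)) borel T"
    by (subst distr_distr) (simp_all add: o_def)
  finally show "distr (distr M borel T) borel (\<lambda>w. c *s w) = distr M borel T" by (simp add: inv)
qed auto

lemma circle_invariant_orthogonal:
  fixes g h :: "complex ^ 'd \<Rightarrow> complex"
  assumes M: "circle_invariant M" and jk: "j \<noteq> k"
    and [measurable]: "g \<in> borel_measurable borel" "h \<in> borel_measurable borel"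
    and hom: "\<And>c w. g (c *s w) = c ^ j * g w" "\<And>c w. h (c *s w) = c ^ k * h w"
  shows "(LINT w|M. g w * cnj (h w)) = 0"
proof -
  let ?I = "LINT w|M. g w * cnj (h w)"
  \<comment> \<open>chosen such that $c^j \bar c^k = e^{i\pi}$\<close>
  define c where "c = cis (pi / (real j - real k))"
  have c: "cmod c = 1" by (simp add: c_def)
  have [measurable_cong]: "sets M = sets borel" and inv: "distr M borel (\<lambda>w. c *s w) = M"
    using M c by (auto simp: circle_invariant_def)
  have [measurable]: "(\<lambda>w. g w * cnj (h w)) \<in> borel_measurable borel"
    by (intro borel_measurable_times measurable_compose[of h borel borel cnj] borel_measurable_cnj) simp_all
  have "?I = (LINT w|distr M borel (\<lambda>w. c *s w). g w * cnj (h w))"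
    by (simp add: inv)
  also have "\<dots> = (LINT w|M. g (c *s w) * cnj (h (c *s w)))"
    by (rule integral_distr) measurable
  also have "\<dots> = (LINT w|M. (c ^ j * cnj c ^ k) * (g w * cnj (h w)))"
    by (intro Bochner_Integration.integral_cong) (simp_all add: hom mult_ac)
  also have "c ^ j * cnj c ^ k = -1"
  proof -
    have "c ^ j * cnj c ^ k = cis (real j * (pi / (real j - real k)) - real k * (pi / (real j - real k)))"
      unfolding c_def cis_cnj Complex.DeMoivre cis_mult by simp
    also have "real j * (pi / (real j - real k)) - real k * (pi / (real j - real k)) = pi"
      using jk unfolding left_diff_distrib[symmetric] by simp
    finally show ?thesis by simp
  qed
  finally show ?thesis by simp
qed

text \<open>The components are pairwise orthogonal because a suitable rotation changes the sign of the integral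
  of a mixed product. Summing them up is harmless as the expansion converges uniformly on the ball of
  radius $\rho < 1$.\<close>

lemma circle_invariant_Parseval:
  fixes f :: "complex ^ 'd \<Rightarrow> complex"
  assumes f: "holomorphic_ball f" and M: "circle_invariant M" and fin: "finite_measure M"
    and AE: "AE w in M. norm w \<le> \<rho>" and \<rho>: "\<rho> < 1"
  shows "(\<integral>\<^sup>+w. ennreal ((cmod (f w))\<^sup>2) \<partial>M) =
    (\<Sum>j. \<integral>\<^sup>+w. ennreal ((cmod (homogeneous_component f j w))\<^sup>2) \<partial>M)"
proof -
  interpret finite_measure M by fact
  have [measurable_cong]: "sets M = sets borel" using M by (simp add: circle_invariant_def)
  let ?f = "\<lambda>w. indicator (ball 0 1) w *\<^sub>R f w" and ?h = "homogeneous_component f"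
  have [measurable]: "?f \<in> borel_measurable borel" "?h j \<in> borel_measurable borel" for j
    by (rule holomorphic_ball_measurable[OF f] homogeneous_component_measurable[OF f])+
  \<comment> \<open>The Cauchy estimates on the larger radius $\rho'$ bound the components on the radius $\rho$ by a
    geometric series in $q < 1$.\<close>
  define \<rho>1 where "\<rho>1 = max \<rho> (1 / 2)"
  define \<rho>' where "\<rho>' = (1 + \<rho>1) / 2"
  define q where "q = \<rho>1 / \<rho>'"
  have \<rho>': "0 < \<rho>1" "\<rho> \<le> \<rho>1" "\<rho>1 < \<rho>'" "\<rho>' < 1" using \<rho> by (auto simp: \<rho>1_def \<rho>'_def)
  have q: "0 < q" "q < 1" using \<rho>' by (auto simp: q_def)
  obtain K where K: "K > 0" "\<And>z. norm z \<le> \<rho>' \<Longrightarrow> cmod (f z) \<le> K"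
    using holomorphic_ball_bounded[OF f \<rho>'(4)] by blast
  have h_le: "cmod (?h j w) \<le> K * q ^ j" if w: "norm w \<le> \<rho>" for j w
  proof -
    have "cmod (?h j w) \<le> K * (norm w / \<rho>') ^ j"
      using \<rho>' K by (intro homogeneous_component_bound[OF f]) auto
    also have "\<dots> \<le> K * q ^ j"
      using w \<rho>' K by (intro mult_left_mono power_mono) (auto simp: q_def divide_right_mono)
    finally show ?thesis .
  qed
  have h_le': "cmod (?h j w) \<le> K" if w: "norm w \<le> \<rho>" for j w
  proof -
    have "K * q ^ j \<le> K * 1" using q K by (intro mult_left_mono power_le_one) auto
    with h_le[OF w, of j] show ?thesis by simp
  qed
  define S where "S n w = (\<Sum>j<n. ?h j w)" for n w
  have [measurable]: "S n \<in> borel_measurable borel" for n unfolding S_def by measurable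
  have S_le: "cmod (S n w) \<le> K / (1 - q)" if w: "norm w \<le> \<rho>" for n w
  proof -
    have "cmod (S n w) \<le> (\<Sum>j<n. K * q ^ j)"
      unfolding S_def using h_le[OF w] by (intro order_trans[OF norm_sum] sum_mono)
    also have "\<dots> = K * ((1 - q ^ n) / (1 - q))"
      using q by (simp add: sum_distrib_left[symmetric] sum_gp_strict)
    also have "\<dots> \<le> K * (1 / (1 - q))"
      using q K by (intro mult_left_mono divide_right_mono) auto
    finally show ?thesis by simp
  qed
  have hh_int: "integrable M (\<lambda>w. ?h j w * cnj (?h k w))" for j k
  proof (rule integrable_const_bound[where B = "K * K"])
    show "AE w in M. norm (?h j w * cnj (?h k w)) \<le> K * K"
      using AE by eventually_elim (auto simp: norm_mult intro!: mult_mono h_le' less_imp_le[OF K(1)])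
    have "(\<lambda>w. cnj (?h k w)) \<in> borel_measurable borel"
      by (intro measurable_compose[of "?h k" borel borel cnj] borel_measurable_cnj) simp
    then show "(\<lambda>w. ?h j w * cnj (?h k w)) \<in> borel_measurable M" by measurable
  qed
  have sq_int: "integrable M (\<lambda>w. (cmod (?h j w))\<^sup>2)" for j
  proof (rule integrable_const_bound[where B = "K\<^sup>2"])
    show "AE w in M. norm ((cmod (?h j w))\<^sup>2) \<le> K\<^sup>2"
      using AE by eventually_elim (auto intro!: power_mono h_le')
  qed measurable
  have S_sq: "(LINT w|M. (cmod (S n w))\<^sup>2) = (\<Sum>j<n. LINT w|M. (cmod (?h j w))\<^sup>2)" for n
  proof -
    have "complex_of_real (LINT w|M. (cmod (S n w))\<^sup>2) = (LINT w|M. complex_of_real ((cmod (S n w))\<^sup>2))"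
      by (simp only: integral_complex_of_real)
    also have "\<dots> = (LINT w|M. (\<Sum>j<n. \<Sum>k<n. ?h j w * cnj (?h k w)))"
      by (simp only: complex_norm_square S_def cnj_sum sum_product)
    also have "\<dots> = (\<Sum>j<n. \<Sum>k<n. LINT w|M. ?h j w * cnj (?h k w))"
      using hh_int by (simp add: Bochner_Integration.integral_sum)
    also have "\<dots> = (\<Sum>j<n. \<Sum>k<n. if k = j then complex_of_real (LINT w|M. (cmod (?h j w))\<^sup>2) else 0)"
    proof (intro sum.cong refl)
      fix j k
      show "(LINT w|M. ?h j w * cnj (?h k w)) =
          (if k = j then complex_of_real (LINT w|M. (cmod (?h j w))\<^sup>2) else 0)"
      proof (cases "k = j")
        case True
        then show ?thesis by (simp only: complex_norm_square[symmetric] integral_complex_of_real simp_thms if_True)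
      next
        case False
        then have "(LINT w|M. ?h j w * cnj (?h k w)) = 0"
          by (intro circle_invariant_orthogonal[OF M, of j k] homogeneous_component_homogeneous[OF f]) auto
        with False show ?thesis by simp
      qed
    qed
    also have "\<dots> = complex_of_real (\<Sum>j<n. LINT w|M. (cmod (?h j w))\<^sup>2)"
      by simp
    finally show ?thesis by (simp only: of_real_eq_iff)
  qed
  have f_int: "integrable M (\<lambda>w. (cmod (?f w))\<^sup>2)"
  proof (rule integrable_const_bound[where B = "K\<^sup>2"])
    show "AE w in M. norm ((cmod (?f w))\<^sup>2) \<le> K\<^sup>2"
      using AE by eventually_elim (use \<rho>' K in \<open>auto intro!: power_mono simp: indicator_def\<close>)
  qed measurable
  have "(\<lambda>n. LINT w|M. (cmod (S n w))\<^sup>2) \<longlonglongrightarrow> (LINT w|M. (cmod (?f w))\<^sup>2)"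
  proof (rule integral_dominated_convergence)
    show "integrable M (\<lambda>w. (K / (1 - q))\<^sup>2)" by simp
    show "AE w in M. norm ((cmod (S n w))\<^sup>2) \<le> (K / (1 - q))\<^sup>2" for n
      using AE by eventually_elim (auto intro!: power_mono S_le)
    show "AE w in M. (\<lambda>n. (cmod (S n w))\<^sup>2) \<longlonglongrightarrow> (cmod (?f w))\<^sup>2"
      using AE
    proof eventually_elim
      case (elim w)
      then have "w \<in> ball 0 1" using \<rho> by simp
      from homogeneous_component_sums[OF f this] have "(\<lambda>n. S n w) \<longlonglongrightarrow> ?f w"
        using \<open>w \<in> ball 0 1\<close> by (simp add: sums_def S_def)
      then show ?case by (intro tendsto_intros)
    qed
  qed measurable
  then have sums: "(\<lambda>j. LINT w|M. (cmod (?h j w))\<^sup>2) sums (LINT w|M. (cmod (?f w))\<^sup>2)"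
    by (simp add: sums_def S_sq)
  have "(\<integral>\<^sup>+w. ennreal ((cmod (f w))\<^sup>2) \<partial>M) = (\<integral>\<^sup>+w. ennreal ((cmod (?f w))\<^sup>2) \<partial>M)"
    using \<rho> by (intro nn_integral_cong_AE, rule_tac AE_mp[OF AE], intro AE_I2 impI) (auto simp: indicator_def)
  also have "\<dots> = ennreal (LINT w|M. (cmod (?f w))\<^sup>2)"
    using f_int by (intro nn_integral_eq_integral) auto
  also have "\<dots> = (\<Sum>j. ennreal (LINT w|M. (cmod (?h j w))\<^sup>2))"
    using sums by (simp add: suminf_ennreal2 sums_iff)
  also have "\<dots> = (\<Sum>j. \<integral>\<^sup>+w. ennreal ((cmod (?h j w))\<^sup>2) \<partial>M)"
    using sq_int by (subst nn_integral_eq_integral) auto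
  finally show ?thesis .
qed

text \<open>A version for measures on the closed ball, where the components may be read off from the undilated
  measure.\<close>

lemma circle_invariant_Parseval_dilated:
  fixes f :: "complex ^ 'd \<Rightarrow> complex"
  assumes f: "holomorphic_ball f" and M: "circle_invariant M" and fin: "finite_measure M"
    and AE: "AE w in M. norm w \<le> 1" and r: "0 \<le> r" "r < 1"
  shows "(\<integral>\<^sup>+w. ennreal ((cmod (f (r *\<^sub>R w)))\<^sup>2) \<partial>M) =
    (\<Sum>j. ennreal (r ^ (2 * j)) * (\<integral>\<^sup>+w. ennreal ((cmod (homogeneous_component f j w))\<^sup>2) \<partial>M))"
proof -
  interpret finite_measure M by fact
  have [measurable_cong]: "sets M = sets borel" using M by (simp add: circle_invariant_def)
  let ?M = "distr M borel (\<lambda>w. r *\<^sub>R w)" and ?f = "\<lambda>w. indicator (ball 0 1) w *\<^sub>R f w"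
  have [measurable]: "?f \<in> borel_measurable borel" by (rule holomorphic_ball_measurable[OF f])
  have [measurable]: "homogeneous_component f j \<in> borel_measurable borel" for j
    by (rule homogeneous_component_measurable[OF f])
  have less: "r * norm w < 1" if "norm w \<le> 1" for w :: "complex ^ 'd"
    using mult_left_mono[OF that r(1)] r(2) by simp
  have "(\<integral>\<^sup>+w. ennreal ((cmod (f (r *\<^sub>R w)))\<^sup>2) \<partial>M) = (\<integral>\<^sup>+w. ennreal ((cmod (?f (r *\<^sub>R w)))\<^sup>2) \<partial>M)"
    using less r by (intro nn_integral_cong_AE, rule_tac AE_mp[OF AE], intro AE_I2 impI)
      (auto simp: indicator_def)
  also have "\<dots> = (\<integral>\<^sup>+w. ennreal ((cmod (?f w))\<^sup>2) \<partial>?M)"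
    by (rule nn_integral_distr[symmetric]) measurable
  also have "\<dots> = (\<Sum>j. \<integral>\<^sup>+w. ennreal ((cmod (homogeneous_component ?f j w))\<^sup>2) \<partial>?M)"
  proof (rule circle_invariant_Parseval)
    show "holomorphic_ball ?f"
      using f holomorphic_ball_cong[of ?f f] by simp
    show "circle_invariant ?M"
      by (intro circle_invariant_distr M)
         (auto simp: scaleR_eq_vector_scalar_mult vector_smult_assoc mult.commute)
    show "finite_measure ?M" by (intro finite_measure_distr) auto
    have "AE w in M. norm (r *\<^sub>R w) \<le> r"
      using r by (rule_tac AE_mp[OF AE], intro AE_I2 impI) (auto simp: mult_left_le)
    then show "AE w in ?M. norm w \<le> r"
      by (subst AE_distr_iff) auto
  qed fact
  also have "\<dots> = (\<Sum>j. ennreal (r ^ (2 * j)) * (\<integral>\<^sup>+w. ennreal ((cmod (homogeneous_component f j w))\<^sup>2) \<partial>M))"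
  proof (rule suminf_cong)
    fix j
    have hc: "homogeneous_component ?f j = homogeneous_component f j"
      by (intro ext homogeneous_component_cong) auto
    have "(\<integral>\<^sup>+w. ennreal ((cmod (homogeneous_component f j w))\<^sup>2) \<partial>?M) =
        (\<integral>\<^sup>+w. ennreal ((cmod (homogeneous_component f j (r *\<^sub>R w)))\<^sup>2) \<partial>M)"
      by (rule nn_integral_distr) measurable
    also have "\<dots> = (\<integral>\<^sup>+w. ennreal (r ^ (2 * j)) * ennreal ((cmod (homogeneous_component f j w))\<^sup>2) \<partial>M)"
      using r by (intro nn_integral_cong) (simp add: homogeneous_component_scaleR[OF f] norm_mult norm_power
          power_mult_distrib ennreal_mult power_mult[symmetric] mult.commute)
    also have "\<dots> = ennreal (r ^ (2 * j)) * (\<integral>\<^sup>+w. ennreal ((cmod (homogeneous_component f j w))\<^sup>2) \<partial>M)"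
      by (rule nn_integral_cmult) measurable
    finally show "(\<integral>\<^sup>+w. ennreal ((cmod (homogeneous_component ?f j w))\<^sup>2) \<partial>?M) =
        ennreal (r ^ (2 * j)) * (\<integral>\<^sup>+w. ennreal ((cmod (homogeneous_component f j w))\<^sup>2) \<partial>M)"
      by (simp only: hc)
  qed
  finally show ?thesis .
qed

definition component_normsq :: "(complex ^ 'd \<Rightarrow> complex) \<Rightarrow> nat \<Rightarrow> ennreal" where
  "component_normsq f j = (\<integral>\<^sup>+w. ennreal ((cmod (homogeneous_component f j w))\<^sup>2) \<partial>sphere_measure)"

lemma linear_vector_scalar_mult: "linear (\<lambda>w :: complex ^ 'd. c *s w)"
  by (rule bounded_linear.linear[OF bounded_linear_vector_scalar_mult_right])

lemma circle_invariant_sphere_measure: "circle_invariant (sphere_measure :: (complex ^ 'd) measure)"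
  unfolding circle_invariant_def
proof safe
  fix c :: complex assume "cmod c = 1"
  then show "distr sphere_measure borel (\<lambda>w :: complex ^ 'd. c *s w) = sphere_measure"
    by (intro distr_sphere_measure_isometry linear_vector_scalar_mult) (simp add: norm_vector_scalar_mult)
qed simp_all

lemma sphere_mean_eq:
  fixes f :: "complex ^ 'd \<Rightarrow> complex"
  assumes f: "holomorphic_ball f" and r: "0 \<le> r" "r < 1"
  shows "(\<integral>\<^sup>+w. ennreal ((cmod (f (r *\<^sub>R w)))\<^sup>2) \<partial>sphere_measure) =
    (\<Sum>j. ennreal (r ^ (2 * j)) * component_normsq f j)"
  unfolding component_normsq_def
proof (rule circle_invariant_Parseval_dilated[OF f circle_invariant_sphere_measure _ _ r])
  show "finite_measure (sphere_measure :: (complex ^ 'd) measure)"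
    using prob_space_sphere_measure by (rule prob_space.finite_measure)
  show "AE w in (sphere_measure :: (complex ^ 'd) measure). norm w \<le> 1"
    using AE_sphere_measure by eventually_elim simp
qed

section \<open>Point evaluations\<close>

abbreviation ball_measure :: "(complex ^ 'd) measure" where
  "ball_measure \<equiv> uniform_measure lborel (ball 0 1)"

lemma circle_invariant_ball_measure: "circle_invariant (ball_measure :: (complex ^ 'd) measure)"
  unfolding circle_invariant_def
proof safe
  fix c :: complex assume c: "cmod c = 1"
  let ?U = "\<lambda>w :: complex ^ 'd. c *s w" and ?B = "ball (0 :: complex ^ 'd) 1"
  have [measurable]: "?U \<in> measurable ball_measure borel" "?B \<in> sets borel"
    using borel_measurable_vector_scalar_mult by (auto simp: measurable_def)
  show "distr ball_measure borel ?U = ball_measure"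
  proof (rule measure_eqI)
    fix A assume "A \<in> sets (distr ball_measure borel ?U)"
    then have A[measurable]: "A \<in> sets borel" by simp
    have mA: "?U -` A \<in> sets borel"
      using measurable_sets[OF borel_measurable_vector_scalar_mult A] by simp
    have "?B \<inter> ?U -` A = ?U -` (?B \<inter> A)"
      using c by (auto simp: norm_vector_scalar_mult)
    moreover have "emeasure lborel (?U -` (?B \<inter> A)) = emeasure lborel (?B \<inter> A)"
      using c by (intro emeasure_lborel_isometry linear_vector_scalar_mult) (auto simp: norm_vector_scalar_mult)
    ultimately show "emeasure (distr ball_measure borel ?U) A = emeasure ball_measure A"
      using mA by (simp add: emeasure_distr emeasure_uniform_measure)
  qed simp
qed simp_all

lemma finite_measure_ball_measure: "finite_measure (ball_measure :: (complex ^ 'd) measure)"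
  using prob_space_uniform_ball by (rule prob_space.finite_measure)

lemma AE_ball_measure: "AE w in (ball_measure :: (complex ^ 'd) measure). norm w \<le> 1"
  by (rule AE_uniform_measureI) auto

text \<open>On the ball a homogeneous polynomial is dominated by its values on the sphere.\<close>

lemma ball_mean_le:
  fixes f :: "complex ^ 'd \<Rightarrow> complex"
  assumes f: "holomorphic_ball f" and r: "0 \<le> r" "r < 1"
  shows "(\<integral>\<^sup>+w. ennreal ((cmod (f (r *\<^sub>R w)))\<^sup>2) \<partial>ball_measure) \<le>
    (\<Sum>j. ennreal (r ^ (2 * j)) * component_normsq f j)"
  unfolding circle_invariant_Parseval_dilated[OF f circle_invariant_ball_measure
      finite_measure_ball_measure AE_ball_measure r]
proof (intro suminf_le mult_left_mono allI)
  fix j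
  let ?h = "homogeneous_component f j"
  have [measurable]: "?h \<in> borel_measurable borel"
    by (rule homogeneous_component_measurable[OF f])
  have sgn'[measurable]: "sgn \<in> measurable (ball_measure :: (complex ^ 'd) measure) borel"
    by (simp add: uniform_measure_def)
  have "(\<integral>\<^sup>+w. ennreal ((cmod (?h w))\<^sup>2) \<partial>ball_measure) \<le> (\<integral>\<^sup>+w. ennreal ((cmod (?h (sgn w)))\<^sup>2) \<partial>ball_measure)"
  proof (rule nn_integral_mono_AE)
    show "AE w in ball_measure. ennreal ((cmod (?h w))\<^sup>2) \<le> ennreal ((cmod (?h (sgn w)))\<^sup>2)"
      using AE_ball_measure
    proof eventually_elim
      case (elim w)
      have "w = norm w *\<^sub>R sgn w" by (cases "w = 0") (simp_all add: sgn_div_norm)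
      then have "?h w = ?h (norm w *\<^sub>R sgn w)" by (rule arg_cong)
      also have "\<dots> = of_real (norm w) ^ j * ?h (sgn w)" by (rule homogeneous_component_scaleR[OF f])
      finally have "cmod (?h w) = norm w ^ j * cmod (?h (sgn w))" by (simp add: norm_mult norm_power)
      also have "\<dots> \<le> 1 * cmod (?h (sgn w))"
        using elim by (intro mult_right_mono power_le_one) auto
      finally show ?case by (intro ennreal_leI power_mono) auto
    qed
  qed
  also have "\<dots> = component_normsq f j"
    unfolding component_normsq_def sphere_measure_def by (rule nn_integral_distr[symmetric]) measurable
  finally show "(\<integral>\<^sup>+w. ennreal ((cmod (?h w))\<^sup>2) \<partial>ball_measure) \<le> component_normsq f j" .
qed auto

text \<open>In the Parseval identity for $w \mapsto f(z + \delta w)$ the component of degree $0$ alone contributes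
  $|f(z)|^2$.\<close>

lemma sub_mean_value:
  fixes f :: "complex ^ 'd \<Rightarrow> complex"
  assumes f: "holomorphic_ball f" and \<delta>: "0 < \<delta>" "norm z + \<delta> < 1"
  shows "ennreal ((cmod (f z))\<^sup>2) \<le> (\<integral>\<^sup>+w. ennreal ((cmod (f (z + \<delta> *\<^sub>R w)))\<^sup>2) \<partial>ball_measure)"
proof -
  interpret prob_space "ball_measure :: (complex ^ 'd) measure" by (rule prob_space_uniform_ball)
  define \<delta>' where "\<delta>' = 1 - norm z"
  let ?g = "\<lambda>w. f (z + \<delta>' *\<^sub>R w)" and ?r = "\<delta> / \<delta>'"
  have \<delta>': "\<delta> < \<delta>'" "norm z + \<bar>\<delta>'\<bar> \<le> 1" using \<delta> by (auto simp: \<delta>'_def)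
  have g: "holomorphic_ball ?g" using \<delta>' by (intro holomorphic_ball_affine f)
  have "ennreal ((cmod (f z))\<^sup>2) =
      (\<Sum>j\<in>{0}. ennreal (?r ^ (2 * j)) * (\<integral>\<^sup>+w. ennreal ((cmod (homogeneous_component ?g j w))\<^sup>2) \<partial>ball_measure))"
    using emeasure_space_1 by simp
  also have "\<dots> \<le> (\<Sum>j. ennreal (?r ^ (2 * j)) * (\<integral>\<^sup>+w. ennreal ((cmod (homogeneous_component ?g j w))\<^sup>2) \<partial>ball_measure))"
    by (rule sum_le_suminf) auto
  also have "\<dots> = (\<integral>\<^sup>+w. ennreal ((cmod (?g (?r *\<^sub>R w)))\<^sup>2) \<partial>ball_measure)"
    using \<delta> \<delta>' by (intro circle_invariant_Parseval_dilated[symmetric] g circle_invariant_ball_measure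
      finite_measure_ball_measure AE_ball_measure) auto
  finally show ?thesis using \<delta> \<delta>' by simp
qed

lemma nn_integral_lborel_affine:
  fixes g :: "complex ^ 'd \<Rightarrow> ennreal"
  assumes [measurable]: "g \<in> borel_measurable borel" and c: "0 < c"
  shows "ennreal (c ^ DIM(complex ^ 'd)) * (\<integral>\<^sup>+x. g (t + c *\<^sub>R x) \<partial>lborel) = (\<integral>\<^sup>+x. g x \<partial>lborel)"
  using c by (subst (2) lborel_affine[where c = c and t = t])
     (simp_all add: nn_integral_density nn_integral_distr nn_integral_cmult)

text \<open>Both sides are, up to constants, integrals of $|f|^2$ over balls, and the ball of radius $\delta$ about
  $z$ is contained in the ball of radius $\rho$ about the origin.\<close>

lemma shifted_ball_mean_le:
  fixes f :: "complex ^ 'd \<Rightarrow> complex"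
  assumes f: "holomorphic_ball f" and \<delta>: "0 < \<delta>" "norm z + \<delta> \<le> \<rho>" "\<rho> < 1"
  shows "(\<integral>\<^sup>+w. ennreal ((cmod (f (z + \<delta> *\<^sub>R w)))\<^sup>2) \<partial>ball_measure) \<le>
    ennreal ((\<rho> / \<delta>) ^ DIM(complex ^ 'd)) * (\<integral>\<^sup>+w. ennreal ((cmod (f (\<rho> *\<^sub>R w)))\<^sup>2) \<partial>ball_measure)"
proof -
  let ?n = "DIM(complex ^ 'd)" and ?f = "\<lambda>w. indicator (ball 0 1) w *\<^sub>R f w" and ?B = "ball (0 :: complex ^ 'd) 1"
  have [measurable]: "?f \<in> borel_measurable borel" by (rule holomorphic_ball_measurable[OF f])
  have [measurable]: "ball 0 s \<in> sets (borel :: (complex ^ 'd) measure)" for s by simp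
  define G where "G w = ennreal ((cmod (?f w))\<^sup>2) * indicator (ball 0 \<rho>) w" for w
  have [measurable]: "G \<in> borel_measurable borel" unfolding G_def by measurable
  have \<rho>: "0 < \<rho>" using \<delta> norm_ge_zero[of z] by linarith
  have mean: "(\<integral>\<^sup>+w. ennreal ((cmod (f (t + s *\<^sub>R w)))\<^sup>2) \<partial>ball_measure) =
      (\<integral>\<^sup>+w. ennreal ((cmod (?f (t + s *\<^sub>R w)))\<^sup>2) * indicator ?B w \<partial>lborel) / emeasure lborel ?B"
    if "0 < s" "norm t + s \<le> \<rho>" for t s
  proof -
    have "norm (t + s *\<^sub>R w) < 1" if w: "norm w \<le> 1" for w
    proof -
      have "s * norm w \<le> s * 1" using \<open>0 < s\<close> w by (intro mult_left_mono) auto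
      moreover have "norm (s *\<^sub>R w) = s * norm w" using \<open>0 < s\<close> by simp
      ultimately show ?thesis
        using norm_triangle_ineq[of t "s *\<^sub>R w"] \<open>norm t + s \<le> \<rho>\<close> \<delta>(3) by linarith
    qed
    then have "(\<integral>\<^sup>+w. ennreal ((cmod (f (t + s *\<^sub>R w)))\<^sup>2) \<partial>ball_measure) =
        (\<integral>\<^sup>+w. ennreal ((cmod (?f (t + s *\<^sub>R w)))\<^sup>2) \<partial>ball_measure)"
      by (intro nn_integral_cong_AE, rule_tac AE_mp[OF AE_ball_measure], intro AE_I2 impI) auto
    also have "\<dots> = (\<integral>\<^sup>+w. ennreal ((cmod (?f (t + s *\<^sub>R w)))\<^sup>2) * indicator ?B w \<partial>lborel) / emeasure lborel ?B"
      by (rule nn_integral_uniform_measure) measurable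
    finally show ?thesis .
  qed
  have "ennreal (\<rho> ^ ?n) * (\<integral>\<^sup>+w. G (0 + \<rho> *\<^sub>R w) \<partial>lborel) = ennreal (\<delta> ^ ?n) * (\<integral>\<^sup>+w. G (z + \<delta> *\<^sub>R w) \<partial>lborel)"
    using nn_integral_lborel_affine[of G \<rho> 0] nn_integral_lborel_affine[of G \<delta> z] \<rho> \<delta> by simp
  then have "ennreal (1 / \<delta> ^ ?n) * (ennreal (\<rho> ^ ?n) * (\<integral>\<^sup>+w. G (0 + \<rho> *\<^sub>R w) \<partial>lborel)) =
      ennreal (1 / \<delta> ^ ?n) * (ennreal (\<delta> ^ ?n) * (\<integral>\<^sup>+w. G (z + \<delta> *\<^sub>R w) \<partial>lborel))" by (rule arg_cong)
  then have eq: "ennreal ((\<rho> / \<delta>) ^ ?n) * (\<integral>\<^sup>+w. G (\<rho> *\<^sub>R w) \<partial>lborel) = (\<integral>\<^sup>+w. G (z + \<delta> *\<^sub>R w) \<partial>lborel)"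
    using \<delta> \<rho> by (simp add: mult.assoc[symmetric] ennreal_mult[symmetric] power_divide)
  have "(\<integral>\<^sup>+w. ennreal ((cmod (?f (z + \<delta> *\<^sub>R w)))\<^sup>2) * indicator ?B w \<partial>lborel) \<le> (\<integral>\<^sup>+w. G (z + \<delta> *\<^sub>R w) \<partial>lborel)"
  proof (rule nn_integral_mono)
    fix w
    have "norm (z + \<delta> *\<^sub>R w) < \<rho>" if w: "norm w < 1"
    proof -
      have "\<delta> * norm w < \<delta> * 1" using \<delta>(1) w by (intro mult_strict_left_mono)
      moreover have "norm (\<delta> *\<^sub>R w) = \<delta> * norm w" using \<delta> by simp
      ultimately show ?thesis
        using norm_triangle_ineq[of z "\<delta> *\<^sub>R w"] \<delta>(2) by linarith
    qed
    then show "ennreal ((cmod (?f (z + \<delta> *\<^sub>R w)))\<^sup>2) * indicator ?B w \<le> G (z + \<delta> *\<^sub>R w)"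
      by (auto simp: G_def indicator_def)
  qed
  also have "\<dots> = ennreal ((\<rho> / \<delta>) ^ ?n) * (\<integral>\<^sup>+w. ennreal ((cmod (?f (0 + \<rho> *\<^sub>R w)))\<^sup>2) * indicator ?B w \<partial>lborel)"
  proof -
    have "G (\<rho> *\<^sub>R w) = ennreal ((cmod (?f (0 + \<rho> *\<^sub>R w)))\<^sup>2) * indicator ?B w" for w
      using \<rho> by (auto simp: G_def indicator_def)
    then show ?thesis unfolding eq[symmetric] by simp
  qed
  finally have "(\<integral>\<^sup>+w. ennreal ((cmod (f (z + \<delta> *\<^sub>R w)))\<^sup>2) \<partial>ball_measure) \<le>
      ennreal ((\<rho> / \<delta>) ^ ?n) * (\<integral>\<^sup>+w. ennreal ((cmod (f (0 + \<rho> *\<^sub>R w)))\<^sup>2) \<partial>ball_measure)"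
    using mean[of \<delta> z] mean[of \<rho> 0] \<delta> \<rho> by (simp add: divide_right_mono_ennreal ennreal_times_divide)
  then show ?thesis by simp
qed

text \<open>The factors $\rho^{2j}$ are at most a constant times the weights of any Besov norm, so this bounds
  point evaluations by each of these norms.\<close>

lemma evaluation_le_components:
  assumes r: "r < 1"
  obtains \<rho> C where "0 < \<rho>" "\<rho> < 1" "0 \<le> C"
    "\<And>(f :: complex ^ 'd \<Rightarrow> complex) z. holomorphic_ball f \<Longrightarrow> norm z \<le> r \<Longrightarrow>
      ennreal ((cmod (f z))\<^sup>2) \<le> ennreal C * (\<Sum>j. ennreal (\<rho> ^ (2 * j)) * component_normsq f j)"
proof -
  define r' where "r' = max r 0"
  define \<delta> where "\<delta> = (1 - r') / 2"
  define \<rho> where "\<rho> = r' + \<delta>"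
  have "r \<le> r'" "0 \<le> r'" "r' < 1" using r by (auto simp: r'_def)
  then have *: "0 < \<delta>" "0 < \<rho>" "\<rho> < 1" "r \<le> r'" "0 \<le> r'"
    by (simp_all add: \<delta>_def \<rho>_def field_simps)
  show thesis
  proof (rule that[of \<rho> "(\<rho> / \<delta>) ^ DIM(complex ^ 'd)"])
    fix f :: "complex ^ 'd \<Rightarrow> complex" and z :: "complex ^ 'd"
    assume f: "holomorphic_ball f" and z: "norm z \<le> r"
    have "ennreal ((cmod (f z))\<^sup>2) \<le> (\<integral>\<^sup>+w. ennreal ((cmod (f (z + \<delta> *\<^sub>R w)))\<^sup>2) \<partial>ball_measure)"
      using z * by (intro sub_mean_value f) (auto simp: \<rho>_def)
    also have "\<dots> \<le> ennreal ((\<rho> / \<delta>) ^ DIM(complex ^ 'd)) * (\<integral>\<^sup>+w. ennreal ((cmod (f (\<rho> *\<^sub>R w)))\<^sup>2) \<partial>ball_measure)"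
      using z * by (intro shifted_ball_mean_le f) (auto simp: \<rho>_def)
    also have "\<dots> \<le> ennreal ((\<rho> / \<delta>) ^ DIM(complex ^ 'd)) * (\<Sum>j. ennreal (\<rho> ^ (2 * j)) * component_normsq f j)"
      using * by (intro mult_left_mono ball_mean_le f) auto
    finally show "ennreal ((cmod (f z))\<^sup>2) \<le>
        ennreal ((\<rho> / \<delta>) ^ DIM(complex ^ 'd)) * (\<Sum>j. ennreal (\<rho> ^ (2 * j)) * component_normsq f j)" .
  qed (use * in auto)
qed

section \<open>The norm in terms of homogeneous components\<close>

definition radial_moment :: "real measure \<Rightarrow> nat \<Rightarrow> ennreal" where
  "radial_moment \<mu> j = (\<integral>\<^sup>+r. ennreal (r ^ (2 * j)) \<partial>\<mu>)"

lemma admissible_AE: "admissible \<mu> \<Longrightarrow> AE r in \<mu>. r \<in> {0..1}"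
  by (rule AE_I[of _ _ "- {0..1}"]) (auto simp: admissible_def)

text \<open>Every partial sum of the series of means is continuous in $r$ up to $r = 1$.\<close>

lemma hardy_normsq_eq:
  fixes f :: "complex ^ 'd \<Rightarrow> complex"
  assumes f: "holomorphic_ball f"
  shows "hardy_normsq f = (\<Sum>j. component_normsq f j)"
proof (rule antisym)
  have eq: "hardy_normsq f = (SUP r\<in>{0..<1}. \<Sum>j. ennreal (r ^ (2 * j)) * component_normsq f j)"
    unfolding hardy_normsq_def by (intro SUP_cong refl sphere_mean_eq f) auto
  have le1: "ennreal (r ^ (2 * j)) * component_normsq f j \<le> component_normsq f j" if "0 \<le> r" "r < 1" for r j
  proof -
    have "ennreal (r ^ (2 * j)) * component_normsq f j \<le> 1 * component_normsq f j"
      using that by (intro mult_right_mono) (auto simp: ennreal_le_1 intro!: power_le_one)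
    then show ?thesis by simp
  qed
  show "hardy_normsq f \<le> (\<Sum>j. component_normsq f j)"
    unfolding eq by (intro SUP_least suminf_le le1) auto
  have "(\<Sum>j<n. component_normsq f j) \<le> hardy_normsq f" for n
  proof (rule LIMSEQ_le_const2)
    let ?r = "\<lambda>k. 1 - 1 / (real k + 1)"
    have "(\<lambda>k. ennreal (?r k ^ (2 * j)) * component_normsq f j) \<longlonglongrightarrow> ennreal (1 ^ (2 * j)) * component_normsq f j" for j
    proof (intro tendsto_mult_ennreal tendsto_const tendsto_ennrealI tendsto_power)
      show "?r \<longlonglongrightarrow> 1" by real_asymp
    qed auto
    then show "(\<lambda>k. \<Sum>j<n. ennreal (?r k ^ (2 * j)) * component_normsq f j) \<longlonglongrightarrow> (\<Sum>j<n. component_normsq f j)"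
      by (intro tendsto_sum) simp
    have "(\<Sum>j<n. ennreal (?r k ^ (2 * j)) * component_normsq f j) \<le> hardy_normsq f" for k
    proof -
      have "(\<Sum>j<n. ennreal (?r k ^ (2 * j)) * component_normsq f j) \<le>
          (\<Sum>j. ennreal (?r k ^ (2 * j)) * component_normsq f j)"
        by (intro sum_le_suminf) auto
      also have "\<dots> \<le> hardy_normsq f" unfolding eq by (intro SUP_upper) (auto simp: divide_le_eq)
      finally show ?thesis .
    qed
    then show "\<exists>K. \<forall>k\<ge>K. (\<Sum>j<n. ennreal (?r k ^ (2 * j)) * component_normsq f j) \<le> hardy_normsq f"
      by blast
  qed
  then show "(\<Sum>j. component_normsq f j) \<le> hardy_normsq f"
    unfolding suminf_eq_SUP by (intro SUP_least) auto
qed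

text \<open>The integral over the open ball yields the moments of $\mu$ restricted to $[0,1)$, and the Hardy space
  term supplies the missing mass at $1$, where $r^{2j} = 1$ for all $j$.\<close>

lemma L2_normsq_eq:
  fixes f :: "complex ^ 'd \<Rightarrow> complex"
  assumes f: "holomorphic_ball f" and \<mu>: "admissible \<mu>"
  shows "L2_normsq \<mu> f = (\<Sum>j. radial_moment \<mu> j * component_normsq f j)"
proof -
  let ?\<sigma> = "sphere_measure :: (complex ^ 'd) measure" and ?f = "\<lambda>w. indicator (ball 0 1) w *\<^sub>R f w"
  let ?c = "component_normsq f"
  interpret S: prob_space ?\<sigma> by (rule prob_space_sphere_measure)
  have [measurable_cong]: "sets \<mu> = sets borel" using \<mu> by (simp add: admissible_def)
  have [measurable]: "?f \<in> borel_measurable borel" by (rule holomorphic_ball_measurable[OF f])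
  have "(\<integral>\<^sup>+z\<in>ball 0 1. ennreal ((cmod (f z))\<^sup>2) \<partial>radial_measure \<mu>) =
      (\<integral>\<^sup>+z. ennreal ((cmod (?f z))\<^sup>2) \<partial>radial_measure \<mu>)"
    by (intro nn_integral_cong) (auto simp: indicator_def)
  also have "\<dots> = (\<integral>\<^sup>+p. ennreal ((cmod (?f (case p of (r, w) \<Rightarrow> r *\<^sub>R w)))\<^sup>2) \<partial>(\<mu> \<Otimes>\<^sub>M ?\<sigma>))"
    unfolding radial_measure_def by (rule nn_integral_distr) measurable
  also have "\<dots> = (\<integral>\<^sup>+p. (case p of (r, w) \<Rightarrow> ennreal ((cmod (?f (r *\<^sub>R w)))\<^sup>2)) \<partial>(\<mu> \<Otimes>\<^sub>M ?\<sigma>))"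
    by (intro nn_integral_cong) auto
  also have "\<dots> = (\<integral>\<^sup>+r. \<integral>\<^sup>+w. ennreal ((cmod (?f (r *\<^sub>R w)))\<^sup>2) \<partial>?\<sigma> \<partial>\<mu>)"
  proof -
    have "(\<lambda>p. case p of (r, w) \<Rightarrow> ennreal ((cmod (?f (r *\<^sub>R w)))\<^sup>2)) \<in> borel_measurable (\<mu> \<Otimes>\<^sub>M ?\<sigma>)"
      by measurable
    from S.nn_integral_fst[OF this] show ?thesis by simp
  qed
  also have "\<dots> = (\<integral>\<^sup>+r. (\<Sum>j. ennreal (r ^ (2 * j)) * indicator {0..<1} r * ?c j) \<partial>\<mu>)"
  proof (rule nn_integral_cong_AE, rule AE_mp[OF admissible_AE[OF \<mu>]], intro AE_I2 impI)
    fix r :: real assume r: "r \<in> {0..1}"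
    show "(\<integral>\<^sup>+w. ennreal ((cmod (?f (r *\<^sub>R w)))\<^sup>2) \<partial>?\<sigma>) = (\<Sum>j. ennreal (r ^ (2 * j)) * indicator {0..<1} r * ?c j)"
    proof (cases "r < 1")
      case True
      have "(\<integral>\<^sup>+w. ennreal ((cmod (?f (r *\<^sub>R w)))\<^sup>2) \<partial>?\<sigma>) = (\<integral>\<^sup>+w. ennreal ((cmod (f (r *\<^sub>R w)))\<^sup>2) \<partial>?\<sigma>)"
        using r True by (intro nn_integral_cong_AE, rule_tac AE_mp[OF AE_sphere_measure], intro AE_I2 impI) auto
      then show ?thesis using sphere_mean_eq[OF f, of r] r True by simp
    next
      case False
      have "(\<integral>\<^sup>+w. ennreal ((cmod (?f (r *\<^sub>R w)))\<^sup>2) \<partial>?\<sigma>) = (\<integral>\<^sup>+w. 0 \<partial>?\<sigma>)"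
        using r False by (intro nn_integral_cong_AE, rule_tac AE_mp[OF AE_sphere_measure], intro AE_I2 impI) auto
      then show ?thesis using False by simp
    qed
  qed
  also have "\<dots> = (\<Sum>j. (\<integral>\<^sup>+r. ennreal (r ^ (2 * j)) * indicator {0..<1} r \<partial>\<mu>) * ?c j)"
    by (subst nn_integral_suminf) (auto simp: nn_integral_multc)
  finally have ball: "(\<integral>\<^sup>+z\<in>ball 0 1. ennreal ((cmod (f z))\<^sup>2) \<partial>radial_measure \<mu>) =
      (\<Sum>j. (\<integral>\<^sup>+r. ennreal (r ^ (2 * j)) * indicator {0..<1} r \<partial>\<mu>) * ?c j)" .
  have moment: "radial_moment \<mu> j = (\<integral>\<^sup>+r. ennreal (r ^ (2 * j)) * indicator {0..<1} r \<partial>\<mu>) + emeasure \<mu> {1}" for j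
  proof -
    have "radial_moment \<mu> j = (\<integral>\<^sup>+r. ennreal (r ^ (2 * j)) * indicator {0..<1} r + indicator {1} r \<partial>\<mu>)"
      unfolding radial_moment_def
      by (rule nn_integral_cong_AE, rule AE_mp[OF admissible_AE[OF \<mu>]], intro AE_I2 impI) (auto simp: indicator_def)
    also have "\<dots> = (\<integral>\<^sup>+r. ennreal (r ^ (2 * j)) * indicator {0..<1} r \<partial>\<mu>) + emeasure \<mu> {1}"
      by (subst nn_integral_add) auto
    finally show ?thesis .
  qed
  have "L2_normsq \<mu> f = (\<Sum>j. (\<integral>\<^sup>+r. ennreal (r ^ (2 * j)) * indicator {0..<1} r \<partial>\<mu>) * ?c j) + (\<Sum>j. emeasure \<mu> {1} * ?c j)"
    unfolding L2_normsq_def ball hardy_normsq_eq[OF f] by simp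
  also have "\<dots> = (\<Sum>j. radial_moment \<mu> j * ?c j)"
    unfolding moment by (subst suminf_add) (auto simp: distrib_right)
  finally show ?thesis .
qed

text \<open>The factor is $j^{2N}$ except for $j = 0$, where the value $1$ accounts for the term $|f(0)|^2$ of the
  norm if $N > 0$ and for $0^0 = 1$ if $N = 0$.\<close>

definition besov_weight :: "nat \<Rightarrow> real measure \<Rightarrow> nat \<Rightarrow> ennreal" where
  "besov_weight N \<mu> j = ennreal (max 1 (real j) ^ (2 * N)) * radial_moment \<mu> j"

definition besov_normsq :: "nat \<Rightarrow> real measure \<Rightarrow> (complex ^ 'd \<Rightarrow> complex) \<Rightarrow> ennreal" where
  "besov_normsq N \<mu> f = (\<Sum>j. besov_weight N \<mu> j * component_normsq f j)"

lemma radial_moment_finite: "admissible \<mu> \<Longrightarrow> radial_moment \<mu> j < \<infinity>"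
proof -
  assume \<mu>: "admissible \<mu>"
  then interpret finite_measure \<mu> by (simp add: admissible_def)
  have "radial_moment \<mu> j \<le> (\<integral>\<^sup>+r. 1 \<partial>\<mu>)"
    unfolding radial_moment_def
    by (rule nn_integral_mono_AE, rule AE_mp[OF admissible_AE[OF \<mu>]], intro AE_I2 impI)
      (auto simp: ennreal_le_1 power_le_one)
  also have "\<dots> < \<infinity>" by (simp add: emeasure_eq_measure)
  finally show ?thesis .
qed

lemma emeasure_radial_measure_cball:
  assumes \<mu>: "admissible \<mu>"
  shows "emeasure (radial_measure \<mu> :: (complex ^ 'd) measure) (cball 0 1) = radial_moment \<mu> 0"
proof -
  let ?\<sigma> = "sphere_measure :: (complex ^ 'd) measure"
  interpret S: prob_space ?\<sigma> by (rule prob_space_sphere_measure)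
  have [measurable_cong]: "sets \<mu> = sets borel" using \<mu> by (simp add: admissible_def)
  have [measurable]: "cball 0 1 \<in> sets (borel :: (complex ^ 'd) measure)" by (rule borel_closed) simp
  have "emeasure (radial_measure \<mu> :: (complex ^ 'd) measure) (cball 0 1) =
      (\<integral>\<^sup>+z. indicator (cball 0 1) z \<partial>(radial_measure \<mu> :: (complex ^ 'd) measure))"
    by (rule nn_integral_indicator[symmetric]) (simp add: radial_measure_def)
  also have "\<dots> = (\<integral>\<^sup>+p. indicator (cball 0 1) (case p of (r, w) \<Rightarrow> r *\<^sub>R w) \<partial>(\<mu> \<Otimes>\<^sub>M ?\<sigma>))"
    unfolding radial_measure_def by (rule nn_integral_distr) measurable
  also have "\<dots> = (\<integral>\<^sup>+p. (case p of (r, w) \<Rightarrow> indicator (cball 0 1) (r *\<^sub>R w)) \<partial>(\<mu> \<Otimes>\<^sub>M ?\<sigma>))"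
    by (intro nn_integral_cong) auto
  also have "\<dots> = (\<integral>\<^sup>+r. \<integral>\<^sup>+w. indicator (cball 0 1) (r *\<^sub>R w) \<partial>?\<sigma> \<partial>\<mu>)"
    by (subst S.nn_integral_fst[symmetric]) auto
  also have "\<dots> = (\<integral>\<^sup>+r. 1 \<partial>\<mu>)"
  proof (rule nn_integral_cong_AE, rule AE_mp[OF admissible_AE[OF \<mu>]], intro AE_I2 impI)
    fix r :: real assume r: "r \<in> {0..1}"
    have "(\<integral>\<^sup>+w. indicator (cball 0 1) (r *\<^sub>R w) \<partial>?\<sigma>) = (\<integral>\<^sup>+w. 1 \<partial>?\<sigma>)"
      using r by (intro nn_integral_cong_AE, rule_tac AE_mp[OF AE_sphere_measure], intro AE_I2 impI) auto
    then show "(\<integral>\<^sup>+w. indicator (cball 0 1) (r *\<^sub>R w) \<partial>?\<sigma>) = 1"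
      using S.emeasure_space_1 by simp
  qed
  finally show ?thesis by (simp add: radial_moment_def)
qed

lemma component_normsq_0: "component_normsq f 0 = ennreal ((cmod (f 0))\<^sup>2)"
  using prob_space.emeasure_space_1[OF prob_space_sphere_measure[where 'd = 'a]]
  by (simp add: component_normsq_def)

lemma component_normsq_radial_deriv_iter:
  assumes f: "holomorphic_ball f"
  shows "component_normsq ((radial_deriv ^^ N) f) j = ennreal (real j ^ (2 * N)) * component_normsq f j"
proof -
  have [measurable]: "homogeneous_component f j \<in> borel_measurable borel"
    by (rule homogeneous_component_measurable[OF f])
  have "ennreal ((cmod (homogeneous_component ((radial_deriv ^^ N) f) j w))\<^sup>2) =
      ennreal (real j ^ (2 * N)) * ennreal ((cmod (homogeneous_component f j w))\<^sup>2)" for w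
    by (simp add: homogeneous_component_radial_deriv_iter[OF f] norm_mult norm_power power_mult_distrib
        ennreal_mult power_mult[symmetric] mult.commute)
  then show ?thesis
    unfolding component_normsq_def by (simp add: nn_integral_cmult)
qed

lemma besov_normsq_eq:
  fixes f :: "complex ^ 'd \<Rightarrow> complex"
  assumes f: "holomorphic_ball f" and \<mu>: "admissible \<mu>"
  shows "besov_normsq N \<mu> f = (if N = 0 then L2_normsq \<mu> f
      else emeasure (radial_measure \<mu> :: (complex ^ 'd) measure) (cball 0 1) * ennreal ((cmod (f 0))\<^sup>2)
        + L2_normsq \<mu> ((radial_deriv ^^ N) f))"
proof (cases "N = 0")
  case True
  then show ?thesis by (simp add: besov_normsq_def besov_weight_def L2_normsq_eq[OF f \<mu>])
next
  case False
  let ?a = "\<lambda>j::nat. if j = 0 then radial_moment \<mu> 0 * component_normsq f 0 else 0"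
  let ?b = "\<lambda>j. radial_moment \<mu> j * component_normsq ((radial_deriv ^^ N) f) j"
  have "besov_weight N \<mu> j * component_normsq f j = ?a j + ?b j" for j
    using False by (cases "j = 0")
      (auto simp: besov_weight_def component_normsq_radial_deriv_iter[OF f] max_def mult_ac)
  then have "besov_normsq N \<mu> f = (\<Sum>j. ?a j + ?b j)" by (simp add: besov_normsq_def)
  also have "\<dots> = (\<Sum>j. ?a j) + (\<Sum>j. ?b j)" by (rule suminf_add[symmetric]) auto
  also have "(\<Sum>j. ?a j) = radial_moment \<mu> 0 * component_normsq f 0"
    using sums_unique[OF sums_single[of 0 "\<lambda>_. radial_moment \<mu> 0 * component_normsq f 0"]] by simp
  finally show ?thesis
    using False by (simp add: L2_normsq_eq[OF holomorphic_ball_radial_deriv_iter[OF f] \<mu>]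
        emeasure_radial_measure_cball[OF \<mu>] component_normsq_0)
qed

lemma besov_iff:
  assumes \<mu>: "admissible \<mu>"
  shows "f \<in> besov N \<mu> \<longleftrightarrow> holomorphic_ball f \<and> besov_normsq N \<mu> f < \<infinity>"
proof (cases "holomorphic_ball f")
  case True
  then show ?thesis
    using radial_moment_finite[OF \<mu>, of 0]
    by (auto simp: besov_def besov_normsq_eq[OF _ \<mu>] emeasure_radial_measure_cball[OF \<mu>]
        ennreal_mult_less_top)
qed (simp add: besov_def)

lemma besov_norm_eq:
  assumes "admissible \<mu>" "holomorphic_ball f"
  shows "besov_norm N \<mu> f = sqrt (enn2real (besov_normsq N \<mu> f))"
  using assms by (simp add: besov_norm_def besov_normsq_eq)

lemma besov_normsq_norm:
  assumes "admissible \<mu>" "f \<in> besov N \<mu>"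
  shows "besov_normsq N \<mu> f = ennreal ((besov_norm N \<mu> f)\<^sup>2)"
  using assms by (simp add: besov_iff besov_norm_eq)

text \<open>As $\mu$ charges $(\rho,1]$, the weight of degree $j$ is at least a constant times $\rho^{2j}$.\<close>

lemma besov_evaluation_bound:
  fixes \<mu> :: "real measure"
  assumes \<mu>: "admissible \<mu>" and r: "r < 1"
  obtains C where "0 \<le> C"
    "\<And>(f :: complex ^ 'd \<Rightarrow> complex) z. f \<in> besov N \<mu> \<Longrightarrow> norm z \<le> r \<Longrightarrow> cmod (f z) \<le> C * besov_norm N \<mu> f"
proof -
  interpret finite_measure \<mu> using \<mu> by (simp add: admissible_def)
  have [measurable_cong]: "sets \<mu> = sets borel" using \<mu> by (simp add: admissible_def)
  obtain \<rho> C where \<rho>: "0 < \<rho>" "\<rho> < 1" "0 \<le> C" and C: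
    "\<And>(f :: complex ^ 'd \<Rightarrow> complex) z. holomorphic_ball f \<Longrightarrow> norm z \<le> r \<Longrightarrow>
      ennreal ((cmod (f z))\<^sup>2) \<le> ennreal C * (\<Sum>j. ennreal (\<rho> ^ (2 * j)) * component_normsq f j)"
    using evaluation_le_components[OF r] by blast
  define \<kappa> where "\<kappa> = measure \<mu> {\<rho><..1}"
  have \<kappa>: "0 < \<kappa>"
    using \<mu> \<rho> unfolding admissible_def \<kappa>_def by (auto simp: emeasure_eq_measure)
  have W: "ennreal (\<kappa> * \<rho> ^ (2 * j)) \<le> besov_weight N \<mu> j" for j
  proof -
    have "ennreal (\<kappa> * \<rho> ^ (2 * j)) = (\<integral>\<^sup>+r. ennreal (\<rho> ^ (2 * j)) * indicator {\<rho><..1} r \<partial>\<mu>)"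
      using \<rho> \<kappa> by (subst nn_integral_cmult_indicator) (simp_all add: emeasure_eq_measure \<kappa>_def ennreal_mult mult.commute)
    also have "\<dots> \<le> radial_moment \<mu> j"
      unfolding radial_moment_def using \<rho> by (intro nn_integral_mono) (auto simp: indicator_def intro!: ennreal_leI power_mono)
    also have "\<dots> = 1 * radial_moment \<mu> j" by simp
    also have "\<dots> \<le> besov_weight N \<mu> j"
      unfolding besov_weight_def by (intro mult_right_mono) (auto simp: one_le_power)
    finally show ?thesis .
  qed
  show thesis
  proof (rule that[of "sqrt (C / \<kappa>)"])
    fix f :: "complex ^ 'd \<Rightarrow> complex" and z :: "complex ^ 'd"
    assume f: "f \<in> besov N \<mu>" and z: "norm z \<le> r"
    have hol: "holomorphic_ball f" using f by (simp add: besov_def)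
    have "ennreal ((cmod (f z))\<^sup>2) \<le> ennreal C * (\<Sum>j. ennreal (\<rho> ^ (2 * j)) * component_normsq f j)"
      by (rule C[OF hol z])
    also have "(\<Sum>j. ennreal (\<rho> ^ (2 * j)) * component_normsq f j) =
        (\<Sum>j. ennreal (1 / \<kappa>) * (ennreal (\<kappa> * \<rho> ^ (2 * j)) * component_normsq f j))"
      using \<kappa> \<rho> by (simp add: mult.assoc[symmetric] ennreal_mult[symmetric])
    also have "\<dots> \<le> (\<Sum>j. ennreal (1 / \<kappa>) * (besov_weight N \<mu> j * component_normsq f j))"
      by (intro suminf_le mult_left_mono mult_right_mono W) auto
    also have "\<dots> = ennreal (1 / \<kappa>) * besov_normsq N \<mu> f"
      by (simp add: besov_normsq_def)
    finally have "ennreal ((cmod (f z))\<^sup>2) \<le> ennreal C * (ennreal (1 / \<kappa>) * ennreal ((besov_norm N \<mu> f)\<^sup>2))"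
      by (simp add: mult_left_mono besov_normsq_norm[OF \<mu> f])
    also have "\<dots> = ennreal (C / \<kappa> * (besov_norm N \<mu> f)\<^sup>2)"
      using \<rho> \<kappa> by (simp add: ennreal_mult[symmetric])
    finally have "(cmod (f z))\<^sup>2 \<le> C / \<kappa> * (besov_norm N \<mu> f)\<^sup>2"
      using \<rho> \<kappa> by (subst (asm) ennreal_le_iff) auto
    then have "sqrt ((cmod (f z))\<^sup>2) \<le> sqrt (C / \<kappa> * (besov_norm N \<mu> f)\<^sup>2)"
      by (rule real_sqrt_le_mono)
    moreover have "0 \<le> besov_norm N \<mu> f" by (simp add: besov_norm_def)
    ultimately show "cmod (f z) \<le> sqrt (C / \<kappa>) * besov_norm N \<mu> f"
      by (simp only: real_sqrt_mult real_sqrt_abs abs_norm_cancel abs_of_nonneg)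
  qed (use \<rho> \<kappa> in auto)
qed

section \<open>Square-integrable functions\<close>

text \<open>The optimal choice is $t = \sqrt{B/A}$; if $A$ or $B$ vanishes, then $t$ tends to infinity or to $0$.\<close>

lemma le_sqrt_mult_of_scaled:
  assumes "0 \<le> A" "0 \<le> B" and le: "\<And>t. 0 < t \<Longrightarrow> 2 * x \<le> t * A + B / t"
  shows "x \<le> sqrt A * sqrt (B :: real)"
proof -
  consider "A = 0" | "B = 0" | "0 < A" "0 < B" using assms by fastforce
  then show ?thesis
  proof cases
    case 1
    have "x \<le> 0"
    proof (rule ccontr)
      assume "\<not> x \<le> 0"
      then have "B / ((B + 1) / x) \<le> x" "0 < (B + 1) / x"
        using assms by (auto simp: divide_simps algebra_simps)
      then show False
        using le[of "(B + 1) / x"] 1 \<open>\<not> x \<le> 0\<close> by simp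
    qed
    then show ?thesis using 1 by simp
  next
    case 2
    have "x \<le> 0"
    proof (rule ccontr)
      assume "\<not> x \<le> 0"
      then have "x / (A + 1) * A \<le> x" "0 < x / (A + 1)"
        using assms by (simp_all add: pos_divide_le_eq distrib_left)
      then show False
        using le[of "x / (A + 1)"] 2 \<open>\<not> x \<le> 0\<close> by simp
    qed
    then show ?thesis using 2 by simp
  next
    case 3
    have "sqrt B / sqrt A * A = sqrt B * (A / sqrt A)" "B / (sqrt B / sqrt A) = (B / sqrt B) * sqrt A"
      by simp_all
    then have "sqrt B / sqrt A * A = sqrt A * sqrt B" "B / (sqrt B / sqrt A) = sqrt A * sqrt B"
      using 3 by (simp_all add: real_div_sqrt)
    with le[of "sqrt B / sqrt A"] 3 show ?thesis by simp
  qed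
qed

lemma square_integrable_mult:
  fixes f g :: "'b \<Rightarrow> complex"
  assumes [measurable]: "f \<in> borel_measurable M" "g \<in> borel_measurable M"
    and f: "integrable M (\<lambda>x. (cmod (f x))\<^sup>2)" and g: "integrable M (\<lambda>x. (cmod (g x))\<^sup>2)"
  shows "integrable M (\<lambda>x. cmod (f x) * cmod (g x))"
    and "(LINT x|M. cmod (f x) * cmod (g x)) \<le>
      sqrt (LINT x|M. (cmod (f x))\<^sup>2) * sqrt (LINT x|M. (cmod (g x))\<^sup>2)"
proof -
  have am: "2 * (a * b) \<le> t * a\<^sup>2 + b\<^sup>2 / t" if "0 < t" for a b t :: real
    using zero_le_power2[of "t * a - b"] that by (simp add: field_simps power2_eq_square)
  show int: "integrable M (\<lambda>x. cmod (f x) * cmod (g x))"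
  proof (rule Bochner_Integration.integrable_bound)
    show "integrable M (\<lambda>x. (cmod (f x))\<^sup>2 + (cmod (g x))\<^sup>2)"
      using f g by (rule Bochner_Integration.integrable_add)
    have "cmod (f x) * cmod (g x) \<le> (cmod (f x))\<^sup>2 + (cmod (g x))\<^sup>2" for x
      using am[of 1 "cmod (f x)" "cmod (g x)"] mult_nonneg_nonneg[of "cmod (f x)" "cmod (g x)"]
      by (simp del: mult_nonneg_nonneg)
    then show "AE x in M. norm (cmod (f x) * cmod (g x)) \<le> norm ((cmod (f x))\<^sup>2 + (cmod (g x))\<^sup>2)"
      by (simp add: abs_of_nonneg)
  qed measurable
  show "(LINT x|M. cmod (f x) * cmod (g x)) \<le>
      sqrt (LINT x|M. (cmod (f x))\<^sup>2) * sqrt (LINT x|M. (cmod (g x))\<^sup>2)"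
  proof (rule le_sqrt_mult_of_scaled)
    fix t :: real assume t: "0 < t"
    have "(LINT x|M. 2 * (cmod (f x) * cmod (g x))) \<le> (LINT x|M. t * (cmod (f x))\<^sup>2 + (cmod (g x))\<^sup>2 / t)"
      using f g int am[OF t] by (intro integral_mono) auto
    then show "2 * (LINT x|M. cmod (f x) * cmod (g x)) \<le>
        t * (LINT x|M. (cmod (f x))\<^sup>2) + (LINT x|M. (cmod (g x))\<^sup>2) / t"
      using f g by simp
  qed simp_all
qed

text \<open>On the set where all $|u_n|$ are at most $m |g|$, dominated convergence applies. By the Cauchy-Schwarz
  inequality the complement contributes at most $B$ times the norm of $g$ on it, which vanishes for
  large $m$ since a convergent sequence is bounded.\<close>

lemma bounded_tendsto_0_imp_weakly_tendsto_0:
  fixes u :: "nat \<Rightarrow> 'b \<Rightarrow> complex" and g :: "'b \<Rightarrow> complex"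
  assumes um[measurable]: "\<And>n. u n \<in> borel_measurable M" and gm[measurable]: "g \<in> borel_measurable M"
    and u: "\<And>n. integrable M (\<lambda>x. (cmod (u n x))\<^sup>2)" and g: "integrable M (\<lambda>x. (cmod (g x))\<^sup>2)"
    and B: "\<And>n. (LINT x|M. (cmod (u n x))\<^sup>2) \<le> B\<^sup>2" "0 \<le> B"
    and lim: "AE x in M. (\<lambda>n. u n x) \<longlonglongrightarrow> 0"
  shows "(\<lambda>n. LINT x|M. u n x * g x) \<longlonglongrightarrow> 0"
proof -
  define A where "A m = {x \<in> space M. \<forall>n. cmod (u n x) \<le> real m * cmod (g x)}" for m :: nat
  have [measurable]: "A m \<in> sets M" for m unfolding A_def by measurable
  have gA: "(\<lambda>m. LINT x|M. (cmod (indicator (- A m) x * g x))\<^sup>2) \<longlonglongrightarrow> (LINT x|M. 0)"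
  proof (rule integral_dominated_convergence)
    show "integrable M (\<lambda>x. (cmod (g x))\<^sup>2)" by (rule g)
    show "AE x in M. norm ((cmod (indicator (- A m) x * g x))\<^sup>2) \<le> (cmod (g x))\<^sup>2" for m
      by (auto simp: indicator_def norm_mult)
    show "AE x in M. (\<lambda>m. (cmod (indicator (- A m) x * g x))\<^sup>2) \<longlonglongrightarrow> 0"
      using lim AE_space
    proof eventually_elim
      case (elim x)
      show ?case
      proof (cases "g x = 0")
        case False
        from elim have "Bseq (\<lambda>n. u n x)" by (intro convergent_imp_Bseq) (auto simp: convergent_def)
        then obtain K where K: "\<And>n. cmod (u n x) \<le> K" by (auto simp: Bseq_def)
        have "\<forall>\<^sub>F m in sequentially. x \<in> A m"
        proof -
          obtain m0 where m0: "K / cmod (g x) \<le> real m0" using real_arch_simple by blast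
          have "x \<in> A m" if "m \<ge> m0" for m
          proof -
            have "K \<le> real m0 * cmod (g x)" using m0 False by (simp add: field_simps)
            also have "\<dots> \<le> real m * cmod (g x)" using that by (intro mult_right_mono) auto
            finally show ?thesis using K elim by (auto simp: A_def intro: order_trans)
          qed
          then show ?thesis unfolding eventually_sequentially by blast
        qed
        then have "\<forall>\<^sub>F m in sequentially. (cmod (indicator (- A m) x * g x))\<^sup>2 = 0"
          by eventually_elim simp
        then show ?thesis by (rule tendsto_eventually)
      qed simp
    qed
  qed measurable
  show ?thesis
  proof (rule LIMSEQ_I)
    fix e :: real assume e: "e > 0"
    have "(\<lambda>m. B * sqrt (LINT x|M. (cmod (indicator (- A m) x * g x))\<^sup>2)) \<longlonglongrightarrow> B * sqrt 0"
      using gA by (intro tendsto_intros) simp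
    then have "\<forall>\<^sub>F m in sequentially. B * sqrt (LINT x|M. (cmod (indicator (- A m) x * g x))\<^sup>2) < e / 2"
      using e by (intro order_tendstoD(2)[where a = "e/2"]) auto
    then obtain m where m: "B * sqrt (LINT x|M. (cmod (indicator (- A m) x * g x))\<^sup>2) < e / 2"
      by (auto simp: eventually_sequentially)
    have ug: "integrable M (\<lambda>x. cmod (u n x) * cmod (g x))" for n
      by (rule square_integrable_mult(1)) (use u g in auto)
    have gi: "integrable M (\<lambda>x. (cmod (indicator (- A m) x * g x))\<^sup>2)"
      by (rule Bochner_Integration.integrable_bound[OF g]) (auto simp: indicator_def norm_mult)
    have "(\<lambda>n. LINT x|M. indicator (A m) x * (cmod (u n x) * cmod (g x))) \<longlonglongrightarrow> (LINT x|M. 0)"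
    proof (rule integral_dominated_convergence)
      show "integrable M (\<lambda>x. real m * (cmod (g x))\<^sup>2)" using g by simp
      show "AE x in M. norm (indicator (A m) x * (cmod (u n x) * cmod (g x))) \<le> real m * (cmod (g x))\<^sup>2" for n
      proof (rule AE_I2)
        fix x
        show "norm (indicator (A m) x * (cmod (u n x) * cmod (g x))) \<le> real m * (cmod (g x))\<^sup>2"
        proof (cases "x \<in> A m")
          case True
          then have "cmod (u n x) * cmod (g x) \<le> real m * cmod (g x) * cmod (g x)"
            by (intro mult_right_mono) (auto simp: A_def)
          then show ?thesis using True by (simp add: power2_eq_square mult.assoc)
        qed simp
      qed
      show "AE x in M. (\<lambda>n. indicator (A m) x * (cmod (u n x) * cmod (g x))) \<longlonglongrightarrow> 0"
        using lim
      proof eventually_elim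
        case (elim x)
        have "(\<lambda>n. indicator (A m) x * (cmod (u n x) * cmod (g x))) \<longlonglongrightarrow> indicator (A m) x * (cmod 0 * cmod (g x))"
          by (intro tendsto_intros elim)
        then show ?case by simp
      qed
    qed measurable
    then have "\<forall>\<^sub>F n in sequentially. (LINT x|M. indicator (A m) x * (cmod (u n x) * cmod (g x))) < e / 2"
      using e by (intro order_tendstoD(2)[where a = "e/2"]) auto
    then obtain n0 where n0: "\<And>n. n \<ge> n0 \<Longrightarrow> (LINT x|M. indicator (A m) x * (cmod (u n x) * cmod (g x))) < e / 2"
      by (auto simp: eventually_sequentially)
    have "cmod (LINT x|M. u n x * g x) < e" if "n \<ge> n0" for n
    proof -
      have i1: "integrable M (\<lambda>x. indicator (A m) x * (cmod (u n x) * cmod (g x)))"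
        by (rule Bochner_Integration.integrable_bound[OF ug[of n]]) (auto simp: indicator_def)
      have i2: "integrable M (\<lambda>x. cmod (u n x) * cmod (indicator (- A m) x * g x))"
        by (rule square_integrable_mult(1)) (use u gi in auto)
      have "cmod (LINT x|M. u n x * g x) \<le> (LINT x|M. cmod (u n x) * cmod (g x))"
        using integral_norm_bound[of M "\<lambda>x. u n x * g x"] by (simp add: norm_mult)
      also have "\<dots> = (LINT x|M. indicator (A m) x * (cmod (u n x) * cmod (g x))
          + cmod (u n x) * cmod (indicator (- A m) x * g x))"
        by (intro Bochner_Integration.integral_cong) (auto simp: indicator_def norm_mult)
      also have "\<dots> = (LINT x|M. indicator (A m) x * (cmod (u n x) * cmod (g x)))
          + (LINT x|M. cmod (u n x) * cmod (indicator (- A m) x * g x))"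
        by (rule Bochner_Integration.integral_add[OF i1 i2])
      also have "(LINT x|M. cmod (u n x) * cmod (indicator (- A m) x * g x)) \<le>
          sqrt (LINT x|M. (cmod (u n x))\<^sup>2) * sqrt (LINT x|M. (cmod (indicator (- A m) x * g x))\<^sup>2)"
        by (rule square_integrable_mult(2)) (use u gi in auto)
      also have "\<dots> \<le> B * sqrt (LINT x|M. (cmod (indicator (- A m) x * g x))\<^sup>2)"
        using real_sqrt_le_mono[OF B(1)[of n]] B(2) by (intro mult_right_mono) auto
      finally show ?thesis using m n0[OF that] by linarith
    qed
    then show "\<exists>n0. \<forall>n\<ge>n0. norm ((LINT x|M. u n x * g x) - 0) < e" by auto
  qed
qed

section \<open>Function spaces that embed into $L^2$\<close>

text \<open>An abstract Hilbert function space, given through an isometry $J$ into some $L^2(\nu)$. All values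
  $Jf(x)$ with $x$ in a set $X$ of full measure depend continuously on $f$, and convergence of these
  values is compatible with products. For a Besov space, $Jf$ is the sequence of homogeneous
  components, and $J$ identifies functions that agree on the ball.\<close>

locale L2_function_space =
  fixes H :: "('a \<Rightarrow> complex) set" and nrm :: "('a \<Rightarrow> complex) \<Rightarrow> real"
    and \<nu> :: "'b measure" and J :: "('a \<Rightarrow> complex) \<Rightarrow> 'b \<Rightarrow> complex" and X :: "'b set"
  assumes lincomb: "f \<in> H \<Longrightarrow> g \<in> H \<Longrightarrow> (\<lambda>z. a * f z + b * g z) \<in> H"
    and one: "(\<lambda>z. 1) \<in> H"
    and J_lincomb: "f \<in> H \<Longrightarrow> g \<in> H \<Longrightarrow> J (\<lambda>z. a * f z + b * g z) x = a * J f x + b * J g x"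
    and J_measurable [measurable]: "f \<in> H \<Longrightarrow> J f \<in> borel_measurable \<nu>"
    and J_integrable: "f \<in> H \<Longrightarrow> integrable \<nu> (\<lambda>x. (cmod (J f x))\<^sup>2)"
    and nrm_eq: "f \<in> H \<Longrightarrow> nrm f = sqrt (LINT x|\<nu>. (cmod (J f x))\<^sup>2)"
    and AE_X: "AE x in \<nu>. x \<in> X"
    and J_bounded: "x \<in> X \<Longrightarrow> \<exists>C. \<forall>f\<in>H. cmod (J f x) \<le> C * nrm f"
    and complete: "\<lbrakk>\<And>n. F n \<in> H;
        \<And>e. 0 < e \<Longrightarrow> \<exists>M. \<forall>m\<ge>M. \<forall>n\<ge>M. nrm (\<lambda>z. F m z - F n z) < e\<rbrakk>
      \<Longrightarrow> \<exists>f\<in>H. (\<lambda>n. nrm (\<lambda>z. F n z - f z)) \<longlonglongrightarrow> 0"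
    and J_tendsto_mult: "\<lbrakk>\<And>n. F n \<in> H; f \<in> H; \<And>n. G n \<in> H; g \<in> H;
        \<And>x. x \<in> X \<Longrightarrow> (\<lambda>n. J (F n) x) \<longlonglongrightarrow> J f x; \<And>x. x \<in> X \<Longrightarrow> (\<lambda>n. J (G n) x) \<longlonglongrightarrow> J g x; x \<in> X\<rbrakk>
      \<Longrightarrow> (\<lambda>n. J (\<lambda>z. F n z * G n z) x) \<longlonglongrightarrow> J (\<lambda>z. f z * g z) x"
begin

definition ip :: "('a \<Rightarrow> complex) \<Rightarrow> ('a \<Rightarrow> complex) \<Rightarrow> complex" where
  "ip f g = (LINT x|\<nu>. J f x * cnj (J g x))"

lemma zero: "(\<lambda>z. 0) \<in> H"
  using lincomb[OF one one, of 0 0] by simp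

lemma add: "f \<in> H \<Longrightarrow> g \<in> H \<Longrightarrow> (\<lambda>z. f z + g z) \<in> H"
  using lincomb[of f g 1 1] by simp

lemma diff: "f \<in> H \<Longrightarrow> g \<in> H \<Longrightarrow> (\<lambda>z. f z - g z) \<in> H"
  using lincomb[of f g 1 "-1"] by simp

lemma cmult: "f \<in> H \<Longrightarrow> (\<lambda>z. c * f z) \<in> H"
  using lincomb[of f f c 0] by simp

lemma J_add: "f \<in> H \<Longrightarrow> g \<in> H \<Longrightarrow> J (\<lambda>z. f z + g z) x = J f x + J g x"
  using J_lincomb[of f g 1 1] by simp

lemma J_diff: "f \<in> H \<Longrightarrow> g \<in> H \<Longrightarrow> J (\<lambda>z. f z - g z) x = J f x - J g x"
  using J_lincomb[of f g 1 "-1"] by simp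

lemma J_cmult: "f \<in> H \<Longrightarrow> J (\<lambda>z. c * f z) x = c * J f x"
  using J_lincomb[of f f c 0] by simp

lemma J_zero [simp]: "J (\<lambda>z. 0) x = 0"
  using J_cmult[OF one, of 0] by simp

lemma nrm_nonneg: "f \<in> H \<Longrightarrow> 0 \<le> nrm f"
  by (simp add: nrm_eq)

lemma nrm_sq: "f \<in> H \<Longrightarrow> (nrm f)\<^sup>2 = (LINT x|\<nu>. (cmod (J f x))\<^sup>2)"
  by (simp add: nrm_eq)

lemma nrm_zero [simp]: "nrm (\<lambda>z. 0) = 0"
  by (simp add: nrm_eq zero)

lemma nrm_cmult: "f \<in> H \<Longrightarrow> nrm (\<lambda>z. c * f z) = cmod c * nrm f"
  by (simp add: nrm_eq cmult J_cmult norm_mult power_mult_distrib real_sqrt_mult)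

lemma nrm_minus_commute: "f \<in> H \<Longrightarrow> g \<in> H \<Longrightarrow> nrm (\<lambda>z. f z - g z) = nrm (\<lambda>z. g z - f z)"
  using nrm_cmult[OF diff, of f g "-1"] by simp

lemma ip_integrable:
  assumes "f \<in> H" "g \<in> H"
  shows "integrable \<nu> (\<lambda>x. J f x * cnj (J g x))"
proof (rule Bochner_Integration.integrable_bound)
  show "integrable \<nu> (\<lambda>x. cmod (J f x) * cmod (J g x))"
    using assms by (intro square_integrable_mult(1) J_measurable J_integrable)
  show "(\<lambda>x. J f x * cnj (J g x)) \<in> borel_measurable \<nu>"
    using J_measurable[OF assms(1)] measurable_compose[OF J_measurable[OF assms(2)] borel_measurable_cnj]
    by (rule borel_measurable_times)
qed (simp add: norm_mult)

lemma ip_Cauchy_Schwarz: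
  assumes "f \<in> H" "g \<in> H"
  shows "cmod (ip f g) \<le> nrm f * nrm g"
proof -
  have "cmod (ip f g) \<le> (LINT x|\<nu>. cmod (J f x) * cmod (J g x))"
    using integral_norm_bound[of \<nu> "\<lambda>x. J f x * cnj (J g x)"] by (simp add: ip_def norm_mult)
  also have "\<dots> \<le> nrm f * nrm g"
    using square_integrable_mult(2)[of "J f" \<nu> "J g"] assms by (simp add: nrm_eq J_integrable)
  finally show ?thesis .
qed

lemma ip_lincomb_left:
  assumes "f \<in> H" "g \<in> H" "h \<in> H"
  shows "ip (\<lambda>z. a * f z + b * g z) h = a * ip f h + b * ip g h"
proof -
  have "ip (\<lambda>z. a * f z + b * g z) h =
      (LINT x|\<nu>. a * (J f x * cnj (J h x)) + b * (J g x * cnj (J h x)))"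
    unfolding ip_def using assms by (intro Bochner_Integration.integral_cong) (auto simp: J_lincomb algebra_simps)
  also have "\<dots> = a * ip f h + b * ip g h"
    unfolding ip_def using ip_integrable[OF assms(1,3)] ip_integrable[OF assms(2,3)] by simp
  finally show ?thesis .
qed

lemma ip_diff_left: "f \<in> H \<Longrightarrow> g \<in> H \<Longrightarrow> h \<in> H \<Longrightarrow> ip (\<lambda>z. f z - g z) h = ip f h - ip g h"
  using ip_lincomb_left[of f g h 1 "-1"] by simp

lemma ip_commute: "ip g f = cnj (ip f g)"
  unfolding ip_def by (simp add: mult.commute flip: Bochner_Integration.integral_cnj)

lemma ip_self: "f \<in> H \<Longrightarrow> ip f f = of_real ((nrm f)\<^sup>2)"
  unfolding ip_def by (simp only: nrm_sq complex_norm_square[symmetric] integral_complex_of_real)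

lemma nrm_sq_add:
  assumes "f \<in> H" "g \<in> H"
  shows "(nrm (\<lambda>z. f z + g z))\<^sup>2 = (nrm f)\<^sup>2 + (nrm g)\<^sup>2 + 2 * Re (ip f g)"
proof -
  have "complex_of_real ((nrm (\<lambda>z. f z + g z))\<^sup>2) = ip (\<lambda>z. f z + g z) (\<lambda>z. f z + g z)"
    using assms by (simp add: ip_self add)
  also have "\<dots> = ip f (\<lambda>z. f z + g z) + ip g (\<lambda>z. f z + g z)"
    using ip_lincomb_left[OF assms add[OF assms], of 1 1] by simp
  also have "\<dots> = cnj (ip f f + ip g f) + cnj (ip f g + ip g g)"
    using ip_lincomb_left[OF assms assms(1), of 1 1] ip_lincomb_left[OF assms assms(2), of 1 1]
      ip_commute[of f "\<lambda>z. f z + g z"] ip_commute[of g "\<lambda>z. f z + g z"] by simp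
  finally have "complex_of_real ((nrm (\<lambda>z. f z + g z))\<^sup>2) = cnj (ip f f + ip g f) + cnj (ip f g + ip g g)" .
  from arg_cong[OF this, of Re] show ?thesis
    using assms by (simp add: ip_self ip_commute[of g f])
qed

lemma nrm_triangle:
  assumes "f \<in> H" "g \<in> H"
  shows "nrm (\<lambda>z. f z + g z) \<le> nrm f + nrm g"
proof (rule power2_le_imp_le)
  have "Re (ip f g) \<le> nrm f * nrm g"
    using complex_Re_le_cmod ip_Cauchy_Schwarz[OF assms] by (rule order_trans)
  then show "(nrm (\<lambda>z. f z + g z))\<^sup>2 \<le> (nrm f + nrm g)\<^sup>2"
    by (simp add: nrm_sq_add[OF assms] power2_sum)
qed (use assms in \<open>simp add: nrm_nonneg\<close>)

lemma nrm_triangle_diff: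
  assumes "f \<in> H" "g \<in> H"
  shows "nrm (\<lambda>z. f z - g z) \<le> nrm f + nrm g"
  using nrm_triangle[OF assms(1) cmult[OF assms(2), of "-1"]] nrm_cmult[OF assms(2), of "-1"] by simp

lemma nrm_triangle3:
  assumes "f \<in> H" "g \<in> H" "h \<in> H"
  shows "nrm (\<lambda>z. f z - h z) \<le> nrm (\<lambda>z. f z - g z) + nrm (\<lambda>z. g z - h z)"
  using nrm_triangle[OF diff[OF assms(1,2)] diff[OF assms(2,3)]] by simp

lemma parallelogram:
  assumes "f \<in> H" "g \<in> H"
  shows "(nrm (\<lambda>z. f z - g z))\<^sup>2 = 2 * (nrm f)\<^sup>2 + 2 * (nrm g)\<^sup>2 - (nrm (\<lambda>z. f z + g z))\<^sup>2"
proof -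
  have "ip f (\<lambda>z. (-1) * g z) = - ip f g"
    using ip_lincomb_left[OF assms(2,2,1), of "-1" 0] ip_commute[of f "\<lambda>z. (-1) * g z"] ip_commute[of f g]
    by simp
  then show ?thesis
    using nrm_sq_add[OF assms] nrm_sq_add[OF assms(1) cmult[OF assms(2), of "-1"]] nrm_cmult[OF assms(2), of "-1"]
    by simp
qed

text \<open>Polarization of $|J f|^2$ under the integral.\<close>

lemma norm_inner_eq:
  assumes "f \<in> H" "g \<in> H"
  shows "norm_inner nrm f g = ip f g"
proof -
  have mem: "(\<lambda>z. f z + c * g z) \<in> H"
    and J_eq: "J (\<lambda>z. f z + c * g z) x = J f x + c * J g x" for c x
    using lincomb[OF assms, of 1 c] J_lincomb[OF assms, of 1 c] by simp_all
  have sq: "complex_of_real ((nrm (\<lambda>z. f z + c * g z))\<^sup>2) =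
      (LINT x|\<nu>. complex_of_real ((cmod (J f x + c * J g x))\<^sup>2))" for c
    by (simp only: nrm_sq[OF mem] J_eq integral_complex_of_real)
  have int: "integrable \<nu> (\<lambda>x. complex_of_real ((cmod (J f x + c * J g x))\<^sup>2))" for c
    using J_integrable[OF mem, of c] by (simp only: J_eq complex_of_real_integrable_eq)
  have pol: "(\<Sum>k<4. \<i> ^ k * complex_of_real ((cmod (a + \<i> ^ k * b))\<^sup>2)) = 4 * (a * cnj b)" for a b
  proof -
    have "{..<4::nat} = {0, 1, 2, 3}" by auto
    then show ?thesis
      unfolding complex_norm_square by (simp add: power3_eq_cube algebra_simps)
  qed
  have "(\<Sum>k<4. \<i> ^ k * complex_of_real ((nrm (\<lambda>z. f z + \<i> ^ k * g z))\<^sup>2)) =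
      (LINT x|\<nu>. (\<Sum>k<4. \<i> ^ k * complex_of_real ((cmod (J f x + \<i> ^ k * J g x))\<^sup>2)))"
    unfolding sq using int
    by (subst Bochner_Integration.integral_sum) (auto simp del: of_real_power)
  also have "\<dots> = 4 * ip f g"
    unfolding pol ip_def using ip_integrable[OF assms] by simp
  finally show ?thesis by (simp add: norm_inner_def)
qed

lemma J_tendsto:
  assumes F: "\<And>n. F n \<in> H" and f: "f \<in> H" and lim: "(\<lambda>n. nrm (\<lambda>z. F n z - f z)) \<longlonglongrightarrow> 0" and x: "x \<in> X"
  shows "(\<lambda>n. J (F n) x) \<longlonglongrightarrow> J f x"
proof -
  obtain C where C: "\<And>f. f \<in> H \<Longrightarrow> cmod (J f x) \<le> C * nrm f" using J_bounded[OF x] by blast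
  have "(\<lambda>n. J (F n) x - J f x) \<longlonglongrightarrow> 0"
  proof (rule Lim_null_comparison)
    show "\<forall>\<^sub>F n in sequentially. cmod (J (F n) x - J f x) \<le> C * nrm (\<lambda>z. F n z - f z)"
      using C[OF diff[OF F f]] by (simp add: J_diff F f)
    show "(\<lambda>n. C * nrm (\<lambda>z. F n z - f z)) \<longlonglongrightarrow> 0"
      using tendsto_mult_right_zero[OF lim] .
  qed
  then show ?thesis by (simp add: LIM_zero_iff)
qed

text \<open>Fatou's lemma in $L^2(\nu)$.\<close>

lemma nrm_le_of_J_tendsto:
  assumes F: "\<And>n. F n \<in> H" and f: "f \<in> H" and lim: "\<And>x. x \<in> X \<Longrightarrow> (\<lambda>n. J (F n) x) \<longlonglongrightarrow> J f x"
    and le: "\<And>n. nrm (F n) \<le> c"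
  shows "nrm f \<le> c"
proof -
  have c: "0 \<le> c" using le[of 0] nrm_nonneg[OF F[of 0]] by simp
  note [measurable] = J_measurable[OF F] J_measurable[OF f]
  have nn: "(\<integral>\<^sup>+x. ennreal ((cmod (J g x))\<^sup>2) \<partial>\<nu>) = ennreal ((nrm g)\<^sup>2)" if "g \<in> H" for g
    using nn_integral_eq_integral[OF J_integrable[OF that]] by (simp add: nrm_sq that)
  have "(\<integral>\<^sup>+x. ennreal ((cmod (J f x))\<^sup>2) \<partial>\<nu>) = (\<integral>\<^sup>+x. liminf (\<lambda>n. ennreal ((cmod (J (F n) x))\<^sup>2)) \<partial>\<nu>)"
  proof (rule nn_integral_cong_AE)
    show "AE x in \<nu>. ennreal ((cmod (J f x))\<^sup>2) = liminf (\<lambda>n. ennreal ((cmod (J (F n) x))\<^sup>2))"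
      using AE_X
    proof eventually_elim
      case (elim x)
      have "(\<lambda>n. ennreal ((cmod (J (F n) x))\<^sup>2)) \<longlonglongrightarrow> ennreal ((cmod (J f x))\<^sup>2)"
        by (intro tendsto_intros lim elim)
      from lim_imp_Liminf[OF _ this] show ?case by simp
    qed
  qed
  also have "\<dots> \<le> liminf (\<lambda>n. \<integral>\<^sup>+x. ennreal ((cmod (J (F n) x))\<^sup>2) \<partial>\<nu>)"
    by (rule nn_integral_liminf) measurable
  also have "\<dots> \<le> liminf (\<lambda>n. ennreal (c\<^sup>2))"
    using le nrm_nonneg[OF F] by (intro Liminf_mono always_eventually allI)
      (auto simp: nn[OF F] intro!: ennreal_leI power_mono)
  finally have "ennreal ((nrm f)\<^sup>2) \<le> ennreal (c\<^sup>2)"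
    by (simp add: nn[OF f] Liminf_const)
  then have "(nrm f)\<^sup>2 \<le> c\<^sup>2" by (simp add: ennreal_le_iff)
  then show ?thesis using c by (rule power2_le_imp_le)
qed

section \<open>Uniform boundedness and multipliers\<close>

text \<open>If no bound held, then closed balls on which ever larger values are attained could be nested; they
  would shrink to a point at which the family is unbounded. Lower semicontinuity ensures that a large
  value at a point persists on a small ball. For a single $q$ this plays the part of the closed graph
  theorem.\<close>

lemma uniform_boundedness:
  fixes q :: "'i \<Rightarrow> ('a \<Rightarrow> complex) \<Rightarrow> real"
  assumes q_diff: "\<And>i f g. i \<in> I \<Longrightarrow> f \<in> H \<Longrightarrow> g \<in> H \<Longrightarrow> q i (\<lambda>z. f z - g z) \<le> q i f + q i g"
    and q_scale: "\<And>i f t. i \<in> I \<Longrightarrow> f \<in> H \<Longrightarrow> 0 < t \<Longrightarrow> q i (\<lambda>z. of_real t * f z) = t * q i f"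
    and q_lsc: "\<And>i F f c. \<lbrakk>i \<in> I; \<And>n. F n \<in> H; f \<in> H; (\<lambda>n. nrm (\<lambda>z. F n z - f z)) \<longlonglongrightarrow> 0;
        \<And>n. q i (F n) \<le> c\<rbrakk> \<Longrightarrow> q i f \<le> c"
    and pointwise: "\<And>f. f \<in> H \<Longrightarrow> \<exists>B. \<forall>i\<in>I. q i f \<le> B"
  shows "\<exists>C. \<forall>i\<in>I. \<forall>f\<in>H. q i f \<le> C * nrm f"
proof (rule ccontr)
  assume unbdd: "\<not> ?thesis"
  define cb where "cb p = {v\<in>H. nrm (\<lambda>z. v z - fst p z) \<le> snd p}" for p :: "('a \<Rightarrow> complex) \<times> real"
  define P where "P p \<longleftrightarrow> fst p \<in> H \<and> 0 < snd p" for p :: "('a \<Rightarrow> complex) \<times> real"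
  have large: "\<exists>i\<in>I. \<exists>y\<in>cb (x, r). K < q i y" if x: "x \<in> H" and r: "0 < r" for x r K
  proof (rule ccontr)
    assume "\<not> (\<exists>i\<in>I. \<exists>y\<in>cb (x, r). K < q i y)"
    then have le: "q i y \<le> K" if "i \<in> I" "y \<in> cb (x, r)" for i y using that by force
    have x_in: "x \<in> cb (x, r)" using x r by (simp add: cb_def)
    have "q i h \<le> 2 * K / r * nrm h" if i: "i \<in> I" and h: "h \<in> H" for i h
    proof (rule field_le_epsilon)
      fix e :: real assume e: "0 < e"
      \<comment> \<open>$h$ is rescaled to norm at most $r$; the summand $e'$ covers the case that its norm is $0$.\<close>
      define e' where "e' = e / (2 * \<bar>K\<bar> / r + 1)"
      have e': "0 < e'" "2 * K / r * e' \<le> e"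
      proof -
        have p: "0 < 2 * \<bar>K\<bar> / r + 1" using r by (simp add: add_nonneg_pos)
        then show "0 < e'" using e by (simp add: e'_def)
        have "2 * K / r * e' \<le> (2 * \<bar>K\<bar> / r + 1) * e'"
          using \<open>0 < e'\<close> r by (intro mult_right_mono) (auto simp: divide_right_mono add_increasing2)
        then show "2 * K / r * e' \<le> e" using p by (simp add: e'_def)
      qed
      define t where "t = r / (nrm h + e')"
      have t: "0 < t" using r e' nrm_nonneg[OF h] by (simp add: t_def add_nonneg_pos)
      have th: "(\<lambda>z. of_real t * h z) \<in> H" by (rule cmult[OF h])
      have "t * nrm h \<le> r"
        using r e' nrm_nonneg[OF h] by (simp add: t_def pos_divide_le_eq add_nonneg_pos mult_left_mono)
      then have "(\<lambda>z. of_real t * h z + x z) \<in> cb (x, r)"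
        using t nrm_cmult[OF h, of "of_real t"] add[OF th x] by (simp add: cb_def)
      then have "q i (\<lambda>z. (of_real t * h z + x z) - x z) \<le> K + K"
        using le[OF i] x_in x q_diff[OF i add[OF th x] x] by (meson add_mono order_trans)
      then have "t * q i h \<le> 2 * K"
        using q_scale[OF i h t] by simp
      then have "q i h \<le> 2 * K / t" using t by (simp add: field_simps)
      also have "\<dots> = 2 * K / r * nrm h + 2 * K / r * e'"
        by (simp add: t_def algebra_simps add_divide_distrib)
      finally show "q i h \<le> 2 * K / r * nrm h + e" using e' by simp
    qed
    with unbdd show False by blast
  qed
  have open': "\<exists>s>0. s \<le> r \<and> (\<forall>v\<in>cb (y, s). K < q i v)"
    if i: "i \<in> I" and y: "y \<in> H" "K < q i y" and r: "0 < r" for i y K r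
  proof (rule ccontr)
    assume "\<not> ?thesis"
    then have neg: "\<And>s. 0 < s \<Longrightarrow> s \<le> r \<Longrightarrow> \<exists>v\<in>cb (y, s). q i v \<le> K" by (meson not_le)
    have "\<exists>v\<in>cb (y, r / (real n + 1)). q i v \<le> K" for n
      using r by (intro neg) (auto simp: divide_le_eq add_nonneg_pos mult_le_cancel_left1)
    then obtain F where F: "\<And>n. F n \<in> cb (y, r / (real n + 1))" "\<And>n. q i (F n) \<le> K"
      by metis
    have FH: "F n \<in> H" for n using F(1)[of n] by (simp add: cb_def)
    have "(\<lambda>n. nrm (\<lambda>z. F n z - y z)) \<longlonglongrightarrow> 0"
    proof (rule Lim_null_comparison)
      show "\<forall>\<^sub>F n in sequentially. norm (nrm (\<lambda>z. F n z - y z)) \<le> r / (real n + 1)"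
        using F(1) nrm_nonneg[OF diff[OF FH y(1)]] by (simp add: cb_def)
      show "(\<lambda>n. r / (real n + 1)) \<longlonglongrightarrow> 0" by real_asymp
    qed
    from q_lsc[OF i FH y(1) this F(2)] y(2) show False by simp
  qed
  have step: "\<exists>p'. P p' \<and> cb p' \<subseteq> cb p \<and> snd p' \<le> snd p / 2 \<and> (\<exists>i\<in>I. \<forall>v\<in>cb p'. real n < q i v)"
    if "P p" for p n
  proof -
    obtain x r where p: "p = (x, r)" "x \<in> H" "0 < r" using \<open>P p\<close> by (cases p) (auto simp: P_def)
    obtain i y where iy: "i \<in> I" "y \<in> cb (x, r / 2)" "real n < q i y"
      using large[of x "r / 2" "real n"] p by auto
    then have y: "y \<in> H" "nrm (\<lambda>z. y z - x z) \<le> r / 2" by (auto simp: cb_def)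
    obtain s where s: "0 < s" "s \<le> r / 2" "\<forall>v\<in>cb (y, s). real n < q i v"
      using open'[OF iy(1) y(1) iy(3), of "r / 2"] p by auto
    have "cb (y, s) \<subseteq> cb (x, r)"
    proof
      fix v assume "v \<in> cb (y, s)"
      then show "v \<in> cb (x, r)"
        using nrm_triangle3[of v y x] y p s by (simp add: cb_def)
    qed
    then show ?thesis
      using s y p iy(1) by (intro exI[of _ "(y, s)"]) (auto simp: P_def)
  qed
  obtain b where b: "\<And>n. P (b n)"
    "\<And>n. cb (b (Suc n)) \<subseteq> cb (b n) \<and> snd (b (Suc n)) \<le> snd (b n) / 2 \<and> (\<exists>i\<in>I. \<forall>v\<in>cb (b (Suc n)). real n < q i v)"
  proof -
    have "P (\<lambda>z. 0, 1)" by (simp add: P_def zero)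
    then have "\<exists>p. P p" ..
    from dependent_nat_choice[where P = "\<lambda>_. P" and Q = "\<lambda>n p p'. cb p' \<subseteq> cb p \<and> snd p' \<le> snd p / 2 \<and>
        (\<exists>i\<in>I. \<forall>v\<in>cb p'. real n < q i v)", OF this step]
    show thesis using that by blast
  qed
  define x where "x n = fst (b n)" for n
  define r where "r n = snd (b n)" for n
  have xH: "x n \<in> H" and r_pos: "0 < r n" for n using b(1)[of n] by (simp_all add: P_def x_def r_def)
  have anti: "cb (b m) \<subseteq> cb (b n)" if "n \<le> m" for n m
    using that b(2) by (rule_tac lift_Suc_antimono_le[of "\<lambda>n. cb (b n)"]) auto
  have x_in: "x m \<in> cb (b n)" if "n \<le> m" for n m
  proof -
    have "x m \<in> cb (b m)" using xH[of m] r_pos[of m] by (simp add: cb_def x_def r_def)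
    then show ?thesis using anti[OF that] by blast
  qed
  have r0: "r \<longlonglongrightarrow> 0"
  proof (rule Lim_null_comparison)
    have "r n \<le> r 0 * (1 / 2) ^ n" for n
    proof (induction n)
      case (Suc n)
      then show ?case using b(2)[of n] by (simp add: r_def)
    qed simp
    then show "\<forall>\<^sub>F n in sequentially. norm (r n) \<le> r 0 * (1 / 2) ^ n"
      using r_pos by (simp add: less_imp_le)
    show "(\<lambda>n. r 0 * (1 / 2) ^ n) \<longlonglongrightarrow> 0"
      by (intro tendsto_mult_right_zero LIMSEQ_power_zero) auto
  qed
  have x_near: "nrm (\<lambda>z. x m z - x n z) \<le> r n" if "n \<le> m" for n m
    using x_in[OF that] by (simp add: cb_def x_def r_def)
  have "\<exists>f\<in>H. (\<lambda>n. nrm (\<lambda>z. x n z - f z)) \<longlonglongrightarrow> 0"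
  proof (rule complete)
    fix e :: real assume "0 < e"
    then obtain M where M: "\<And>n. n \<ge> M \<Longrightarrow> r n < e / 2"
      using order_tendstoD(2)[OF r0, of "e / 2"] by (auto simp: eventually_sequentially)
    have "nrm (\<lambda>z. x m z - x n z) < e" if "m \<ge> M" "n \<ge> M" for m n
      using nrm_triangle3[OF xH xH[of M] xH, of m n] x_near[of M m] x_near[of M n] M[of M] that
        nrm_minus_commute[OF xH xH, of M n] by simp
    then show "\<exists>M. \<forall>m\<ge>M. \<forall>n\<ge>M. nrm (\<lambda>z. x m z - x n z) < e" by blast
  qed (rule xH)
  then obtain f where f: "f \<in> H" and lim: "(\<lambda>n. nrm (\<lambda>z. x n z - f z)) \<longlonglongrightarrow> 0" by blast
  have f_in: "f \<in> cb (b n)" for n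
  proof -
    have "nrm (\<lambda>z. f z - x n z) \<le> r n"
    proof (rule field_le_epsilon)
      fix e :: real assume "0 < e"
      then obtain M where M: "\<And>m. m \<ge> M \<Longrightarrow> nrm (\<lambda>z. x m z - f z) < e"
        using order_tendstoD(2)[OF lim, of e] by (auto simp: eventually_sequentially)
      let ?m = "max M n"
      have "nrm (\<lambda>z. f z - x n z) \<le> nrm (\<lambda>z. f z - x ?m z) + nrm (\<lambda>z. x ?m z - x n z)"
        by (rule nrm_triangle3[OF f xH xH])
      also have "nrm (\<lambda>z. f z - x ?m z) = nrm (\<lambda>z. x ?m z - f z)"
        by (rule nrm_minus_commute[OF f xH])
      finally show "nrm (\<lambda>z. f z - x n z) \<le> r n + e"
        using M[of ?m] x_near[of n ?m] by simp
    qed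
    then show ?thesis using f by (simp add: cb_def x_def r_def)
  qed
  obtain B where B: "\<And>i. i \<in> I \<Longrightarrow> q i f \<le> B" using pointwise[OF f] by blast
  obtain n where n: "B < real n" using reals_Archimedean2 by blast
  obtain i where "i \<in> I" "real n < q i f" using b(2)[of n] f_in[of "Suc n"] by blast
  with B n show False by fastforce
qed

lemma Mult_imp_mem: "v \<in> Mult H \<Longrightarrow> v \<in> H"
  using one by (force simp: Mult_def)

lemma Mult_mult: "v \<in> Mult H \<Longrightarrow> f \<in> H \<Longrightarrow> (\<lambda>z. v z * f z) \<in> H"
  by (simp add: Mult_def)

lemma Mult_power: "v \<in> Mult H \<Longrightarrow> (\<lambda>z. v z ^ n) \<in> Mult H"
  by (induction n) (auto simp: Mult_def mult.assoc)

lemma Mult_times: "u \<in> Mult H \<Longrightarrow> v \<in> Mult H \<Longrightarrow> (\<lambda>z. u z * v z) \<in> Mult H"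
  by (auto simp: Mult_def mult.assoc)

text \<open>For a fixed multiplier $v$ the map $f \mapsto |v f|$ is lower semicontinuous because $J(vf)(x)$ depends
  continuously on $f$.\<close>

lemma multipliers_uniformly_bounded:
  assumes v: "\<And>i. i \<in> I \<Longrightarrow> v i \<in> Mult H"
    and pointwise: "\<And>f. f \<in> H \<Longrightarrow> \<exists>B. \<forall>i\<in>I. nrm (\<lambda>z. v i z * f z) \<le> B"
  shows "\<exists>C. \<forall>i\<in>I. \<forall>f\<in>H. nrm (\<lambda>z. v i z * f z) \<le> C * nrm f"
proof (rule uniform_boundedness[where q = "\<lambda>i f. nrm (\<lambda>z. v i z * f z)"])
  note vm = Mult_mult[OF v]
  show "nrm (\<lambda>z. v i z * (f z - g z)) \<le> nrm (\<lambda>z. v i z * f z) + nrm (\<lambda>z. v i z * g z)"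
    if "i \<in> I" "f \<in> H" "g \<in> H" for i f g
    using nrm_triangle_diff[OF vm[OF that(1,2)] vm[OF that(1,3)]] by (simp add: right_diff_distrib)
  show "nrm (\<lambda>z. v i z * (of_real t * f z)) = t * nrm (\<lambda>z. v i z * f z)"
    if "i \<in> I" "f \<in> H" "0 < t" for i f t
    using nrm_cmult[OF vm[OF that(1,2)], of "of_real t"] that(3) by (simp add: mult.left_commute)
  show "nrm (\<lambda>z. v i z * f z) \<le> c"
    if i: "i \<in> I" and F: "\<And>n. F n \<in> H" and f: "f \<in> H" and lim: "(\<lambda>n. nrm (\<lambda>z. F n z - f z)) \<longlonglongrightarrow> 0"
      and le: "\<And>n. nrm (\<lambda>z. v i z * F n z) \<le> c" for i F f c
  proof (rule nrm_le_of_J_tendsto[OF vm[OF i F] vm[OF i f] _ le])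
    fix x assume "x \<in> X"
    then show "(\<lambda>n. J (\<lambda>z. v i z * F n z) x) \<longlonglongrightarrow> J (\<lambda>z. v i z * f z) x"
      using Mult_imp_mem[OF v[OF i]] by (intro J_tendsto_mult J_tendsto F f lim tendsto_const)
  qed
qed (rule pointwise)

lemma multiplier_bounded:
  assumes "v \<in> Mult H"
  obtains C where "0 \<le> C" "\<And>f. f \<in> H \<Longrightarrow> nrm (\<lambda>z. v z * f z) \<le> C * nrm f"
proof -
  obtain C where C: "\<And>f. f \<in> H \<Longrightarrow> nrm (\<lambda>z. v z * f z) \<le> C * nrm f"
    using multipliers_uniformly_bounded[of "{()}" "\<lambda>_. v"] assms by auto
  show thesis
  proof (rule that[of "max C 0"])
    fix f assume f: "f \<in> H"
    have "C * nrm f \<le> max C 0 * nrm f" using nrm_nonneg[OF f] by (intro mult_right_mono) auto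
    with C[OF f] show "nrm (\<lambda>z. v z * f z) \<le> max C 0 * nrm f" by simp
  qed simp
qed

text \<open>The representing function is, up to a factor, the element of smallest norm at which the
  functional takes the value $1$.\<close>

lemma Riesz_representation_J:
  assumes x: "x \<in> X"
  shows "\<exists>k\<in>H. \<exists>c. \<forall>f\<in>H. J f x = c * ip f k"
proof (cases "\<exists>f\<in>H. J f x \<noteq> 0")
  case True
  then obtain f0 where f0: "f0 \<in> H" "J f0 x \<noteq> 0" by blast
  define S where "S = {f\<in>H. J f x = 1}"
  define c where "c = 1 / J f0 x"
  have "(\<lambda>z. c * f0 z) \<in> S"
    using f0 cmult[OF f0(1), of c] J_cmult[OF f0(1), of c] by (simp add: S_def) (simp add: c_def)
  then have ne: "S \<noteq> {}" by blast
  define d where "d = Inf (nrm ` S)"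
  have bb: "bdd_below (nrm ` S)" using nrm_nonneg by (intro bdd_belowI[of _ 0]) (auto simp: S_def)
  have d_le: "d \<le> nrm f" if "f \<in> S" for f
    unfolding d_def using that bb by (intro cInf_lower) auto
  have d0: "0 \<le> d" unfolding d_def using ne nrm_nonneg by (intro cInf_greatest) (auto simp: S_def)
  have "\<exists>f\<in>S. nrm f < d + 1 / (real n + 1)" for n
    using cInf_lessD[of "nrm ` S" "d + 1 / (real n + 1)"] ne by (auto simp: d_def add_nonneg_pos)
  then obtain F where F: "\<And>n. F n \<in> S" "\<And>n. nrm (F n) < d + 1 / (real n + 1)" by metis
  have FH: "F n \<in> H" and FJ: "J (F n) x = 1" for n using F(1)[of n] by (auto simp: S_def)
  have near: "(nrm (\<lambda>z. F m z - F n z))\<^sup>2 \<le> 2 * (nrm (F m))\<^sup>2 + 2 * (nrm (F n))\<^sup>2 - 4 * d\<^sup>2" for m n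
  proof -
    have "(\<lambda>z. (1 / 2) * (F m z + F n z)) \<in> S"
      using cmult[OF add[OF FH FH], of "1 / 2" m n] J_cmult[OF add[OF FH FH], of "1 / 2" m n x]
      by (simp add: S_def J_add[OF FH FH] FJ)
    from d_le[OF this] have "2 * d \<le> nrm (\<lambda>z. F m z + F n z)"
      using nrm_cmult[OF add[OF FH FH], of "1 / 2" m n] by simp
    then have "(2 * d)\<^sup>2 \<le> (nrm (\<lambda>z. F m z + F n z))\<^sup>2"
      using d0 by (intro power_mono) auto
    then show ?thesis using parallelogram[OF FH FH, of m n] by simp
  qed
  have nF: "(\<lambda>n. nrm (F n)) \<longlonglongrightarrow> d"
  proof (rule tendsto_sandwich)
    show "\<forall>\<^sub>F n in sequentially. d \<le> nrm (F n)" using d_le[OF F(1)] by simp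
    show "\<forall>\<^sub>F n in sequentially. nrm (F n) \<le> d + 1 / (real n + 1)" using F(2) by (simp add: less_imp_le)
    show "(\<lambda>n. d + 1 / (real n + 1)) \<longlonglongrightarrow> d" by real_asymp
  qed simp
  have "\<exists>k\<in>H. (\<lambda>n. nrm (\<lambda>z. F n z - k z)) \<longlonglongrightarrow> 0"
  proof (rule complete)
    fix e :: real assume e: "0 < e"
    have "(\<lambda>n. (nrm (F n))\<^sup>2) \<longlonglongrightarrow> d\<^sup>2" by (intro tendsto_intros nF)
    then have "\<forall>\<^sub>F n in sequentially. (nrm (F n))\<^sup>2 < d\<^sup>2 + e\<^sup>2 / 4"
      by (rule order_tendstoD) (use e in simp)
    then obtain M where M: "\<And>n. n \<ge> M \<Longrightarrow> (nrm (F n))\<^sup>2 < d\<^sup>2 + e\<^sup>2 / 4"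
      by (auto simp: eventually_sequentially)
    have "nrm (\<lambda>z. F m z - F n z) < e" if "m \<ge> M" "n \<ge> M" for m n
    proof (rule power2_less_imp_less)
      show "(nrm (\<lambda>z. F m z - F n z))\<^sup>2 < e\<^sup>2"
        using near[of m n] M[OF that(1)] M[OF that(2)] by simp
    qed (use e in simp)
    then show "\<exists>M. \<forall>m\<ge>M. \<forall>n\<ge>M. nrm (\<lambda>z. F m z - F n z) < e" by blast
  qed (rule FH)
  then obtain k where k: "k \<in> H" and lim: "(\<lambda>n. nrm (\<lambda>z. F n z - k z)) \<longlonglongrightarrow> 0" by blast
  have kJ: "J k x = 1"
    using J_tendsto[OF FH k lim x] by (simp add: FJ LIMSEQ_const_iff)
  have "nrm k \<le> d"
  proof (rule LIMSEQ_le_const)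
    have "(\<lambda>n. nrm (F n) + nrm (\<lambda>z. F n z - k z)) \<longlonglongrightarrow> d + 0" by (intro tendsto_intros nF lim)
    then show "(\<lambda>n. nrm (F n) + nrm (\<lambda>z. F n z - k z)) \<longlonglongrightarrow> d" by simp
    have "nrm k \<le> nrm (F n) + nrm (\<lambda>z. F n z - k z)" for n
      using nrm_triangle_diff[OF FH[of n] diff[OF FH[of n] k]] by simp
    then show "\<exists>N. \<forall>n\<ge>N. nrm k \<le> nrm (F n) + nrm (\<lambda>z. F n z - k z)" by blast
  qed
  moreover have kS: "k \<in> S" using k kJ by (simp add: S_def)
  ultimately have nk: "nrm k = d" using d_le by (meson antisym)
  have "d \<noteq> 0"
  proof
    assume "d = 0"
    obtain C where "\<forall>f\<in>H. cmod (J f x) \<le> C * nrm f" using J_bounded[OF x] by blast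
    then show False using k kJ nk \<open>d = 0\<close> by force
  qed
  have orth: "ip h k = 0" if h: "h \<in> H" "J h x = 0" for h
  proof (rule ccontr)
    assume p: "ip h k \<noteq> 0"
    define \<epsilon> where "\<epsilon> = 1 / ((nrm h)\<^sup>2 + 1)"
    have \<epsilon>: "0 < \<epsilon>" "\<epsilon> * (nrm h)\<^sup>2 < 1" by (auto simp: \<epsilon>_def add_nonneg_pos)
    \<comment> \<open>Moving from $k$ in this direction would decrease the norm to first order in $\epsilon$.\<close>
    let ?t = "- of_real \<epsilon> * cnj (ip h k)"
    have th: "(\<lambda>z. ?t * h z) \<in> H" by (rule cmult[OF h(1)])
    have "J (\<lambda>z. ?t * h z + k z) x = 1"
      by (simp only: J_add[OF th k] J_cmult[OF h(1)] h(2) kJ mult_zero_right add_0)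
    then have "(\<lambda>z. ?t * h z + k z) \<in> S"
      unfolding S_def using add[OF th k] by blast
    from d_le[OF this] have "d\<^sup>2 \<le> (nrm (\<lambda>z. ?t * h z + k z))\<^sup>2"
      using d0 by (intro power_mono)
    also have "\<dots> = (nrm (\<lambda>z. ?t * h z))\<^sup>2 + (nrm k)\<^sup>2 + 2 * Re (ip (\<lambda>z. ?t * h z) k)"
      by (rule nrm_sq_add[OF th k])
    also have "ip (\<lambda>z. ?t * h z) k = ?t * ip h k"
      using ip_lincomb_left[OF h(1) h(1) k, of ?t 0] by simp
    also have "\<dots> = - of_real (\<epsilon> * (cmod (ip h k))\<^sup>2)"
      by (simp add: complex_norm_square mult.commute del: of_real_power)
    also have "nrm (\<lambda>z. ?t * h z) = cmod ?t * nrm h" by (rule nrm_cmult[OF h(1)])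
    finally have "2 * (\<epsilon> * (cmod (ip h k))\<^sup>2) \<le> (\<epsilon> * cmod (ip h k) * nrm h)\<^sup>2"
      using \<epsilon> by (simp add: nk norm_mult)
    also have "\<dots> = (\<epsilon> * (cmod (ip h k))\<^sup>2) * (\<epsilon> * (nrm h)\<^sup>2)"
      by (simp add: power2_eq_square algebra_simps)
    finally have "2 * (\<epsilon> * (cmod (ip h k))\<^sup>2) \<le> (\<epsilon> * (cmod (ip h k))\<^sup>2) * (\<epsilon> * (nrm h)\<^sup>2)" .
    moreover have pos: "0 < \<epsilon> * (cmod (ip h k))\<^sup>2" using \<epsilon> p by simp
    moreover have "(\<epsilon> * (cmod (ip h k))\<^sup>2) * (\<epsilon> * (nrm h)\<^sup>2) \<le> (\<epsilon> * (cmod (ip h k))\<^sup>2) * 1"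
      using \<epsilon> pos by (intro mult_left_mono) auto
    ultimately show False by linarith
  qed
  have "J f x = of_real (1 / d\<^sup>2) * ip f k" if f: "f \<in> H" for f
  proof -
    have "ip (\<lambda>z. 1 * f z + (- J f x) * k z) k = 0"
      using lincomb[OF f k, of 1 "- J f x"] J_lincomb[OF f k, of 1 "- J f x" x] kJ by (intro orth) auto
    then have "ip f k = J f x * of_real (d\<^sup>2)"
      using ip_lincomb_left[OF f k k, of 1 "- J f x"] by (simp add: ip_self[OF k] nk)
    then show ?thesis using \<open>d \<noteq> 0\<close> by simp
  qed
  then show ?thesis using k by blast
next
  case False
  then show ?thesis using one by (intro bexI[of _ "\<lambda>z. 1"] exI[of _ 0]) auto
qed

section \<open>Weak* convergence of multipliers\<close>

text \<open>Operators of rank one are of trace class.\<close>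

lemma weak_star_imp_ip_tendsto:
  assumes v: "\<And>n. v n \<in> Mult H" and w: "weak_star_tendsto H nrm v (\<lambda>z. 1)"
    and f: "f \<in> H" and g: "g \<in> H"
  shows "(\<lambda>n. ip (\<lambda>z. v n z * f z) g) \<longlonglongrightarrow> ip f g"
proof -
  define F where "F k = (if k = 0 then f else (\<lambda>z. 0))" for k :: nat
  define G where "G k = (if k = 0 then g else (\<lambda>z. 0))" for k :: nat
  have FG: "F k \<in> H" "G k \<in> H" for k using f g zero by (auto simp: F_def G_def)
  have "summable (\<lambda>k. (nrm (F k))\<^sup>2)" "summable (\<lambda>k. (nrm (G k))\<^sup>2)"
    by (rule summable_finite[of "{0}"]; simp add: F_def G_def)+
  then have "(\<lambda>n. \<Sum>k. norm_inner nrm (\<lambda>z. v n z * F k z) (G k)) \<longlonglongrightarrow> (\<Sum>k. norm_inner nrm (\<lambda>z. 1 * F k z) (G k))"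
    using w FG unfolding weak_star_tendsto_def by blast
  moreover have sum_eq: "(\<Sum>k. norm_inner nrm (\<lambda>z. u z * F k z) (G k)) = ip (\<lambda>z. u z * f z) g"
    if u: "u \<in> Mult H" for u
  proof -
    have "norm_inner nrm (\<lambda>z. u z * F k z) (G k) = (if k = 0 then ip (\<lambda>z. u z * f z) g else 0)" for k
      using Mult_mult[OF u f] g zero
      by (auto simp: F_def G_def norm_inner_eq ip_def)
    then show ?thesis using sums_unique[OF sums_single[of 0 "\<lambda>_. ip (\<lambda>z. u z * f z) g"]] by simp
  qed
  moreover have "(\<lambda>z. 1) \<in> Mult H" by (simp add: Mult_def)
  ultimately show ?thesis using v sum_eq[of "\<lambda>z. 1"] by simp
qed

text \<open>The uniform boundedness principle is applied twice: to the functionals $g \mapsto \langle g, v_n f\rangle$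
  for fixed $f$, and then to the seminorms $f \mapsto |v_n f|$.\<close>

lemma weak_star_imp_bounded:
  assumes v: "\<And>n. v n \<in> Mult H" and w: "weak_star_tendsto H nrm v (\<lambda>z. 1)"
  obtains C where "0 \<le> C" "\<And>n f. f \<in> H \<Longrightarrow> nrm (\<lambda>z. v n z * f z) \<le> C * nrm f"
proof -
  have "\<exists>C. \<forall>n\<in>UNIV. \<forall>f\<in>H. nrm (\<lambda>z. v n z * f z) \<le> C * nrm f"
  proof (rule multipliers_uniformly_bounded)
    fix f assume f: "f \<in> H"
    note vf = Mult_mult[OF v f]
    have "\<exists>C. \<forall>n\<in>UNIV. \<forall>g\<in>H. cmod (ip g (\<lambda>z. v n z * f z)) \<le> C * nrm g"
    proof (rule uniform_boundedness)
      show "cmod (ip (\<lambda>z. g z - h z) (\<lambda>z. v n z * f z)) \<le>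
          cmod (ip g (\<lambda>z. v n z * f z)) + cmod (ip h (\<lambda>z. v n z * f z))" if "g \<in> H" "h \<in> H" for n g h
        using norm_triangle_ineq4 by (simp add: ip_diff_left[OF that vf])
      show "cmod (ip (\<lambda>z. of_real t * g z) (\<lambda>z. v n z * f z)) = t * cmod (ip g (\<lambda>z. v n z * f z))"
        if "g \<in> H" "0 < t" for n g t
        using ip_lincomb_left[OF that(1,1) vf, of "of_real t" 0] that(2) by (simp add: norm_mult)
      show "cmod (ip g (\<lambda>z. v n z * f z)) \<le> c"
        if G: "\<And>m. G m \<in> H" and g: "g \<in> H" and lim: "(\<lambda>m. nrm (\<lambda>z. G m z - g z)) \<longlonglongrightarrow> 0"
          and le: "\<And>m. cmod (ip (G m) (\<lambda>z. v n z * f z)) \<le> c" for n G g c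
      proof (rule LIMSEQ_le_const)
        have "(\<lambda>m. c + nrm (\<lambda>z. G m z - g z) * nrm (\<lambda>z. v n z * f z)) \<longlonglongrightarrow> c + 0 * nrm (\<lambda>z. v n z * f z)"
          by (intro tendsto_intros lim)
        then show "(\<lambda>m. c + nrm (\<lambda>z. G m z - g z) * nrm (\<lambda>z. v n z * f z)) \<longlonglongrightarrow> c" by simp
        have "cmod (ip g (\<lambda>z. v n z * f z)) \<le> c + nrm (\<lambda>z. G m z - g z) * nrm (\<lambda>z. v n z * f z)" for m
          using norm_triangle_ineq4[of "ip (G m) (\<lambda>z. v n z * f z)" "ip (\<lambda>z. G m z - g z) (\<lambda>z. v n z * f z)"]
            ip_Cauchy_Schwarz[OF diff[OF G g] vf, of m n] le[of m] by (simp add: ip_diff_left[OF G g vf])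
        then show "\<exists>N. \<forall>m\<ge>N. cmod (ip g (\<lambda>z. v n z * f z)) \<le> c + nrm (\<lambda>z. G m z - g z) * nrm (\<lambda>z. v n z * f z)"
          by blast
      qed
      show "\<exists>B. \<forall>n\<in>UNIV. cmod (ip g (\<lambda>z. v n z * f z)) \<le> B" if g: "g \<in> H" for g
      proof -
        have "Bseq (\<lambda>n. ip (\<lambda>z. v n z * f z) g)"
          using weak_star_imp_ip_tendsto[OF v w f g] by (intro convergent_imp_Bseq) (auto simp: convergent_def)
        then obtain B where "\<And>n. cmod (ip (\<lambda>z. v n z * f z) g) \<le> B" by (auto simp: Bseq_def)
        then show ?thesis using ip_commute[of g] by (metis complex_mod_cnj)
      qed
    qed
    then obtain C where C: "\<And>n g. g \<in> H \<Longrightarrow> cmod (ip g (\<lambda>z. v n z * f z)) \<le> C * nrm g" by blast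
    have "nrm (\<lambda>z. v n z * f z) \<le> max C 0" for n
    proof (cases "nrm (\<lambda>z. v n z * f z) = 0")
      case False
      with nrm_nonneg[OF vf, of n] C[OF vf, of n n] show ?thesis
        by (simp add: ip_self[OF vf] power2_eq_square norm_mult)
    qed simp
    then show "\<exists>B. \<forall>n\<in>UNIV. nrm (\<lambda>z. v n z * f z) \<le> B" by blast
  qed (rule v)
  then obtain C where C: "\<And>n f. f \<in> H \<Longrightarrow> nrm (\<lambda>z. v n z * f z) \<le> C * nrm f" by blast
  show thesis
  proof (rule that[of "max C 0"])
    fix f n assume f: "f \<in> H"
    have "C * nrm f \<le> max C 0 * nrm f" using nrm_nonneg[OF f] by (intro mult_right_mono) auto
    with C[OF f, of n] show "nrm (\<lambda>z. v n z * f z) \<le> max C 0 * nrm f" by simp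
  qed simp
qed

text \<open>The functional $f \mapsto Jf(x)$ is an inner product, and $v_n = v_n \cdot 1$ converges weakly.\<close>

lemma weak_star_imp_J_tendsto:
  assumes v: "\<And>n. v n \<in> Mult H" and w: "weak_star_tendsto H nrm v (\<lambda>z. 1)" and x: "x \<in> X"
  shows "(\<lambda>n. J (v n) x) \<longlonglongrightarrow> J (\<lambda>z. 1) x"
proof -
  obtain k c where k: "k \<in> H" "\<And>f. f \<in> H \<Longrightarrow> J f x = c * ip f k"
    using Riesz_representation_J[OF x] by blast
  have "(\<lambda>n. c * ip (v n) k) \<longlonglongrightarrow> c * ip (\<lambda>z. 1) k"
    using weak_star_imp_ip_tendsto[OF v w one k(1)] by (intro tendsto_mult_left) simp
  then show ?thesis using k(2)[OF one] k(2)[OF Mult_imp_mem[OF v]] by simp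
qed

text \<open>A bounded sequence in $L^2(\nu)$ that converges almost everywhere converges weakly, and Tannery's
  theorem sums the resulting limits over the trace class expansion.\<close>

lemma bounded_J_tendsto_imp_weak_star:
  assumes v: "\<And>n. v n \<in> Mult H" and C: "0 \<le> C" "\<And>n f. f \<in> H \<Longrightarrow> nrm (\<lambda>z. v n z * f z) \<le> C * nrm f"
    and lim: "\<And>x. x \<in> X \<Longrightarrow> (\<lambda>n. J (v n) x) \<longlonglongrightarrow> J (\<lambda>z. 1) x"
  shows "weak_star_tendsto H nrm v (\<lambda>z. 1)"
  unfolding weak_star_tendsto_def
proof safe
  fix F G :: "nat \<Rightarrow> 'a \<Rightarrow> complex"
  assume FG: "\<forall>k. F k \<in> H \<and> G k \<in> H"
    and sums: "summable (\<lambda>k. (nrm (F k))\<^sup>2)" "summable (\<lambda>k. (nrm (G k))\<^sup>2)"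
  have F: "F k \<in> H" and G: "G k \<in> H" for k using FG by auto
  note vF = Mult_mult[OF v F]
  have weak: "(\<lambda>n. ip (\<lambda>z. v n z * f z) g) \<longlonglongrightarrow> ip f g" if f: "f \<in> H" and g: "g \<in> H" for f g
  proof -
    note vf = Mult_mult[OF v f]
    let ?u = "\<lambda>n z. v n z * f z - f z"
    note u = diff[OF vf f]
    have "(\<lambda>n. LINT x|\<nu>. J (?u n) x * cnj (J g x)) \<longlonglongrightarrow> 0"
    proof (rule bounded_tendsto_0_imp_weakly_tendsto_0)
      show "J (?u n) \<in> borel_measurable \<nu>" for n by (rule J_measurable[OF u])
      show "(\<lambda>x. cnj (J g x)) \<in> borel_measurable \<nu>"
        using J_measurable[OF g] borel_measurable_cnj by (rule measurable_compose)
      show "integrable \<nu> (\<lambda>x. (cmod (J (?u n) x))\<^sup>2)" for n by (rule J_integrable[OF u])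
      show "integrable \<nu> (\<lambda>x. (cmod (cnj (J g x)))\<^sup>2)" using J_integrable[OF g] by simp
      show "0 \<le> C * nrm f + nrm f" using C(1) nrm_nonneg[OF f] by simp
      have "nrm (?u n) \<le> C * nrm f + nrm f" for n
        using nrm_triangle_diff[OF vf f, of n] C(2)[OF f, of n] by simp
      then show "(LINT x|\<nu>. (cmod (J (?u n) x))\<^sup>2) \<le> (C * nrm f + nrm f)\<^sup>2" for n
        unfolding nrm_sq[OF u, symmetric] using nrm_nonneg[OF u] by (intro power_mono)
      show "AE x in \<nu>. (\<lambda>n. J (?u n) x) \<longlonglongrightarrow> 0"
        using AE_X
      proof eventually_elim
        case (elim x)
        have "(\<lambda>n. J (\<lambda>z. v n z * f z) x) \<longlonglongrightarrow> J (\<lambda>z. 1 * f z) x"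
          using elim by (intro J_tendsto_mult Mult_imp_mem v f one lim tendsto_const)
        then show ?case by (simp add: J_diff[OF vf f] LIM_zero)
      qed
    qed
    then have "(\<lambda>n. ip (\<lambda>z. v n z * f z) g - ip f g) \<longlonglongrightarrow> 0"
      by (simp add: ip_def[symmetric] ip_diff_left[OF vf f g])
    then show ?thesis by (simp add: LIM_zero_iff)
  qed
  have "(\<lambda>n. \<Sum>k. ip (\<lambda>z. v n z * F k z) (G k)) \<longlonglongrightarrow> (\<Sum>k. ip (F k) (G k))"
  proof (rule tannerys_theorem[THEN conjunct2, THEN conjunct2])
    show "summable (\<lambda>k. C * ((nrm (F k))\<^sup>2 + (nrm (G k))\<^sup>2))" by (intro summable_mult summable_add sums)
    show "(\<lambda>n. ip (\<lambda>z. v n z * F k z) (G k)) \<longlonglongrightarrow> ip (F k) (G k)" for k by (rule weak[OF F G])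
    have "cmod (ip (\<lambda>z. v n z * F k z) (G k)) \<le> C * ((nrm (F k))\<^sup>2 + (nrm (G k))\<^sup>2)" for n k
    proof -
      have "cmod (ip (\<lambda>z. v n z * F k z) (G k)) \<le> nrm (\<lambda>z. v n z * F k z) * nrm (G k)"
        by (rule ip_Cauchy_Schwarz[OF vF G])
      also have "\<dots> \<le> (C * nrm (F k)) * nrm (G k)"
        by (intro mult_right_mono C(2) F nrm_nonneg G)
      also have "nrm (F k) * nrm (G k) \<le> (nrm (F k))\<^sup>2 + (nrm (G k))\<^sup>2"
        using sum_squares_bound[of "nrm (F k)" "nrm (G k)"] mult_nonneg_nonneg[OF nrm_nonneg[OF F] nrm_nonneg[OF G], of k k]
        by linarith
      then have "(C * nrm (F k)) * nrm (G k) \<le> C * ((nrm (F k))\<^sup>2 + (nrm (G k))\<^sup>2)"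
        using C(1) by (simp add: mult.assoc mult_left_mono)
      finally show ?thesis .
    qed
    then show "\<forall>\<^sub>F (k, n) in sequentially \<times>\<^sub>F sequentially.
        cmod (ip (\<lambda>z. v n z * F k z) (G k)) \<le> C * ((nrm (F k))\<^sup>2 + (nrm (G k))\<^sup>2)"
      by (intro always_eventually) auto
  qed simp
  then show "(\<lambda>n. \<Sum>k. norm_inner nrm (\<lambda>z. v n z * F k z) (G k)) \<longlonglongrightarrow>
      (\<Sum>k. norm_inner nrm (\<lambda>z. 1 * F k z) (G k))"
    by (simp add: norm_inner_eq vF F G)
qed

text \<open>Weak convergence is not compatible with products of operators. Bounds and convergence of the values
  of $J$ are, and for multipliers they amount to weak* convergence.\<close>

lemma weak_star_tendsto_power:
  assumes v: "\<And>n. v n \<in> Mult H" and w: "weak_star_tendsto H nrm v (\<lambda>z. 1)"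
  shows "weak_star_tendsto H nrm (\<lambda>n z. v n z ^ m) (\<lambda>z. 1)"
proof -
  obtain C where C: "0 \<le> C" "\<And>n f. f \<in> H \<Longrightarrow> nrm (\<lambda>z. v n z * f z) \<le> C * nrm f"
    using weak_star_imp_bounded[OF v w] by blast
  note vm = Mult_power[OF v]
  show ?thesis
  proof (rule bounded_J_tendsto_imp_weak_star[OF vm])
    show "0 \<le> C ^ m" using C(1) by simp
    show "nrm (\<lambda>z. v n z ^ m * f z) \<le> C ^ m * nrm f" if f: "f \<in> H" for n f
    proof (induction m)
      case (Suc m)
      have "nrm (\<lambda>z. v n z * (v n z ^ m * f z)) \<le> C * nrm (\<lambda>z. v n z ^ m * f z)"
        by (rule C(2)[OF Mult_mult[OF vm f]])
      also have "\<dots> \<le> C * (C ^ m * nrm f)"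
        using Suc C(1) by (rule mult_left_mono)
      finally show ?case by (simp add: mult.assoc)
    qed simp
    show "(\<lambda>n. J (\<lambda>z. v n z ^ m) x) \<longlonglongrightarrow> J (\<lambda>z. 1) x" if "x \<in> X" for x
      using that
    proof (induction m arbitrary: x)
      case (Suc m)
      have "(\<lambda>n. J (\<lambda>z. v n z * v n z ^ m) x) \<longlonglongrightarrow> J (\<lambda>z. 1 * 1) x"
        by (rule J_tendsto_mult[OF Mult_imp_mem[OF v] one Mult_imp_mem[OF vm] one
            weak_star_imp_J_tendsto[OF v w] Suc.IH Suc.prems])
      then show ?case by simp
    qed simp
  qed
qed

lemma weak_star_seq_cyclic_power:
  assumes "weak_star_seq_cyclic H nrm \<phi>"
  shows "weak_star_seq_cyclic H nrm (\<lambda>z. \<phi> z ^ m)"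
proof -
  obtain u where \<phi>: "\<phi> \<in> Mult H" and u: "\<And>n. u n \<in> Mult H"
    and w: "weak_star_tendsto H nrm (\<lambda>n z. u n z * \<phi> z) (\<lambda>z. 1)"
    using assms unfolding weak_star_seq_cyclic_def by blast
  have "weak_star_tendsto H nrm (\<lambda>n z. (u n z * \<phi> z) ^ m) (\<lambda>z. 1)"
    by (rule weak_star_tendsto_power[OF Mult_times[OF u \<phi>] w])
  then have "weak_star_tendsto H nrm (\<lambda>n z. u n z ^ m * \<phi> z ^ m) (\<lambda>z. 1)"
    by (simp add: power_mult_distrib)
  with Mult_power[OF u] Mult_power[OF \<phi>] show ?thesis
    unfolding weak_star_seq_cyclic_def by (intro conjI exI[of _ "\<lambda>n z. u n z ^ m"]) auto
qed

end

section \<open>Besov spaces as function spaces in $L^2$\<close>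

text \<open>The measure on pairs of a degree and a point of the sphere for which $f \mapsto (f_j)_j$ is an isometry
  into $L^2$.\<close>

definition component_measure :: "nat \<Rightarrow> real measure \<Rightarrow> (nat \<times> (complex ^ 'd)) measure" where
  "component_measure N \<mu> = density (count_space UNIV \<Otimes>\<^sub>M sphere_measure) (\<lambda>(j, w). besov_weight N \<mu> j)"

definition component_map :: "(complex ^ 'd \<Rightarrow> complex) \<Rightarrow> nat \<times> (complex ^ 'd) \<Rightarrow> complex" where
  "component_map f = (\<lambda>(j, w). homogeneous_component f j w)"

lemma component_map_measurable:
  assumes "holomorphic_ball f"
  shows "component_map f \<in> borel_measurable (count_space UNIV \<Otimes>\<^sub>M sphere_measure)"
proof (rule measurable_pair_measure_countable1)
  show "(\<lambda>w. component_map f (j, w)) \<in> borel_measurable sphere_measure" for j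
    using homogeneous_component_measurable[OF assms] by (simp add: component_map_def cong: measurable_cong_sets)
qed simp

lemma besov_weight_measurable [measurable]:
  "(\<lambda>(j, w). besov_weight N \<mu> j) \<in> borel_measurable (count_space UNIV \<Otimes>\<^sub>M (sphere_measure :: (complex ^ 'd) measure))"
  by (rule measurable_pair_measure_countable1) auto

lemma nn_integral_component_map:
  fixes f :: "complex ^ 'd \<Rightarrow> complex"
  assumes f: "holomorphic_ball f"
  shows "(\<integral>\<^sup>+x. ennreal ((cmod (component_map f x))\<^sup>2) \<partial>component_measure N \<mu>) = besov_normsq N \<mu> f"
proof -
  let ?\<sigma> = "sphere_measure :: (complex ^ 'd) measure"
  interpret S: prob_space ?\<sigma> by (rule prob_space_sphere_measure)
  note [measurable] = component_map_measurable[OF f]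
  have [measurable]: "homogeneous_component f j \<in> borel_measurable borel" for j
    by (rule homogeneous_component_measurable[OF f])
  have "(\<integral>\<^sup>+x. ennreal ((cmod (component_map f x))\<^sup>2) \<partial>component_measure N \<mu>) =
      (\<integral>\<^sup>+x. (case x of (j, w) \<Rightarrow> besov_weight N \<mu> j) * ennreal ((cmod (component_map f x))\<^sup>2) \<partial>(count_space UNIV \<Otimes>\<^sub>M ?\<sigma>))"
    unfolding component_measure_def by (rule nn_integral_density) measurable
  also have "\<dots> = (\<integral>\<^sup>+j. \<integral>\<^sup>+w. besov_weight N \<mu> j * ennreal ((cmod (homogeneous_component f j w))\<^sup>2) \<partial>?\<sigma> \<partial>count_space UNIV)"
    by (subst S.nn_integral_fst[symmetric]) (auto simp: component_map_def)
  also have "\<dots> = besov_normsq N \<mu> f"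
    by (simp add: nn_integral_count_space_nat nn_integral_cmult besov_normsq_def component_normsq_def)
  finally show ?thesis .
qed

lemma AE_component_measure: "AE x in (component_measure N \<mu> :: (nat \<times> (complex ^ 'd)) measure). norm (snd x) = 1"
proof -
  let ?\<sigma> = "sphere_measure :: (complex ^ 'd) measure"
  interpret S: prob_space ?\<sigma> by (rule prob_space_sphere_measure)
  interpret C: sigma_finite_measure "count_space UNIV :: nat measure"
    by (rule sigma_finite_measure_count_space)
  interpret P: pair_sigma_finite "count_space UNIV :: nat measure" ?\<sigma> ..
  have "AE x in (count_space UNIV :: nat measure) \<Otimes>\<^sub>M ?\<sigma>. norm (snd x) = 1"
  proof (rule P.AE_pair_measure)
    show "AE j in count_space UNIV. AE w in ?\<sigma>. norm (snd (j :: nat, w)) = 1"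
      using AE_sphere_measure by (simp add: AE_count_space)
  qed measurable
  then show ?thesis
    unfolding component_measure_def by (subst AE_density) auto
qed

lemma component_map_lincomb:
  assumes "holomorphic_ball f" "holomorphic_ball g"
  shows "component_map (\<lambda>z. a * f z + b * g z) x = a * component_map f x + b * component_map g x"
  using assms by (cases x) (simp add: component_map_def homogeneous_component_lincomb)

lemma besov_holomorphic: "f \<in> besov N \<mu> \<Longrightarrow> holomorphic_ball f"
  by (simp add: besov_def)

lemma component_map_measurable':
  "holomorphic_ball f \<Longrightarrow> component_map f \<in> borel_measurable (component_measure N \<mu>)"
  by (simp add: component_measure_def component_map_measurable)

lemma besov_lincomb:
  fixes f g :: "complex ^ 'd \<Rightarrow> complex"
  assumes \<mu>: "admissible \<mu>" and f: "f \<in> besov N \<mu>" and g: "g \<in> besov N \<mu>"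
  shows "(\<lambda>z. a * f z + b * g z) \<in> besov N \<mu>"
proof -
  note hol = f[THEN besov_holomorphic] g[THEN besov_holomorphic]
  have hol': "holomorphic_ball (\<lambda>z. a * f z + b * g z)"
    using hol by (intro holomorphic_ball_add holomorphic_ball_cmult)
  note [measurable] = component_map_measurable'[OF hol(1)] component_map_measurable'[OF hol(2)]
  have le: "(cmod (a * x + b * y))\<^sup>2 \<le> 2 * (cmod a)\<^sup>2 * (cmod x)\<^sup>2 + 2 * (cmod b)\<^sup>2 * (cmod y)\<^sup>2" for x y
  proof -
    have "(cmod (a * x + b * y))\<^sup>2 \<le> (cmod (a * x) + cmod (b * y))\<^sup>2"
      by (intro power_mono norm_triangle_ineq) auto
    also have "\<dots> \<le> 2 * (cmod (a * x))\<^sup>2 + 2 * (cmod (b * y))\<^sup>2"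
      using sum_squares_bound[of "cmod (a * x)" "cmod (b * y)"] by (simp add: power2_sum)
    finally show ?thesis by (simp add: norm_mult power_mult_distrib)
  qed
  have "besov_normsq N \<mu> (\<lambda>z. a * f z + b * g z) =
      (\<integral>\<^sup>+x. ennreal ((cmod (a * component_map f x + b * component_map g x))\<^sup>2) \<partial>component_measure N \<mu>)"
    by (simp only: nn_integral_component_map[OF hol', symmetric] component_map_lincomb[OF hol])
  also have "\<dots> \<le> (\<integral>\<^sup>+x. ennreal (2 * (cmod a)\<^sup>2) * ennreal ((cmod (component_map f x))\<^sup>2) +
      ennreal (2 * (cmod b)\<^sup>2) * ennreal ((cmod (component_map g x))\<^sup>2) \<partial>component_measure N \<mu>)"
    by (intro nn_integral_mono) (simp add: ennreal_mult[symmetric] ennreal_plus[symmetric] le del: ennreal_plus)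
  also have "\<dots> = ennreal (2 * (cmod a)\<^sup>2) * besov_normsq N \<mu> f + ennreal (2 * (cmod b)\<^sup>2) * besov_normsq N \<mu> g"
    by (simp add: nn_integral_add nn_integral_cmult nn_integral_component_map[OF hol(1)]
        nn_integral_component_map[OF hol(2)])
  also have "\<dots> < \<infinity>"
    using f g by (simp add: besov_iff[OF \<mu>] ennreal_mult_less_top)
  finally show ?thesis using hol' by (simp add: besov_iff[OF \<mu>])
qed

lemma besov_diff:
  "admissible \<mu> \<Longrightarrow> f \<in> besov N \<mu> \<Longrightarrow> g \<in> besov N \<mu> \<Longrightarrow> (\<lambda>z. f z - g z) \<in> besov N \<mu>"
  using besov_lincomb[of \<mu> f N g 1 "-1"] by simp

lemma besov_one:
  assumes \<mu>: "admissible \<mu>"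
  shows "(\<lambda>z. 1) \<in> besov N \<mu>"
proof -
  have "homogeneous_component (\<lambda>z. 1) j w = (if j = 0 then 1 else 0)" for j and w :: "complex ^ 'a"
    using homogeneous_component_eqI[of "\<lambda>z. 1" w "fps_const 1" j] has_fps_expansion_const[of "1 :: complex"]
    by simp
  then have "component_normsq (\<lambda>z :: complex ^ 'a. 1) j = 0" if "j \<noteq> 0" for j
    using that by (simp add: component_normsq_def)
  then have "besov_weight N \<mu> j * component_normsq (\<lambda>z :: complex ^ 'a. 1) j =
      (if j = 0 then radial_moment \<mu> 0 else 0)" for j
    by (cases "j = 0") (simp_all add: besov_weight_def component_normsq_0)
  then have "besov_normsq N \<mu> (\<lambda>z :: complex ^ 'a. 1) = radial_moment \<mu> 0"
    using sums_unique[OF sums_single[of 0 "\<lambda>_. radial_moment \<mu> 0"]] by (simp add: besov_normsq_def)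
  then show ?thesis using radial_moment_finite[OF \<mu>, of 0] by (simp add: besov_iff[OF \<mu>])
qed

lemma component_evaluation_bound:
  fixes w :: "complex ^ 'd"
  assumes \<mu>: "admissible \<mu>"
  obtains C where "0 \<le> C" "\<And>f. f \<in> besov N \<mu> \<Longrightarrow> cmod (homogeneous_component f j w) \<le> C * besov_norm N \<mu> f"
proof -
  obtain C where C: "0 \<le> C" "\<And>(f :: complex ^ 'd \<Rightarrow> complex) z. f \<in> besov N \<mu> \<Longrightarrow> norm z \<le> 1 / 2 \<Longrightarrow>
      cmod (f z) \<le> C * besov_norm N \<mu> f"
    using besov_evaluation_bound[OF \<mu>, of "1 / 2"] by auto
  show thesis
  proof (rule that[of "C * (norm w / (1 / 2)) ^ j"])
    fix f :: "complex ^ 'd \<Rightarrow> complex" assume f: "f \<in> besov N \<mu>"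
    have "cmod (homogeneous_component f j w) \<le> C * besov_norm N \<mu> f * (norm w / (1 / 2)) ^ j"
      using C(2)[OF f] by (intro homogeneous_component_bound besov_holomorphic[OF f]) auto
    then show "cmod (homogeneous_component f j w) \<le> C * (norm w / (1 / 2)) ^ j * besov_norm N \<mu> f"
      by (simp add: mult_ac)
  qed (use C in simp)
qed

text \<open>A Cauchy sequence converges locally uniformly because point evaluations are locally uniformly
  bounded; by Fatou's lemma for the components, the limit is also a limit in norm.\<close>

lemma besov_complete:
  fixes F :: "nat \<Rightarrow> complex ^ 'd \<Rightarrow> complex"
  assumes \<mu>: "admissible \<mu>" and F: "\<And>n. F n \<in> besov N \<mu>"
    and Cau: "\<And>e. 0 < e \<Longrightarrow> \<exists>M. \<forall>m\<ge>M. \<forall>n\<ge>M. besov_norm N \<mu> (\<lambda>z. F m z - F n z) < e"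
  shows "\<exists>f\<in>besov N \<mu>. (\<lambda>n. besov_norm N \<mu> (\<lambda>z. F n z - f z)) \<longlonglongrightarrow> 0"
proof -
  note Fhol = besov_holomorphic[OF F]
  note FD = besov_diff[OF \<mu> F F]
  have norm_nonneg: "0 \<le> besov_norm N \<mu> h" for h :: "complex ^ 'd \<Rightarrow> complex" by (simp add: besov_norm_def)
  have unif_Cau: "\<exists>M. \<forall>m\<ge>M. \<forall>n\<ge>M. \<forall>z\<in>cball 0 r. cmod (F m z - F n z) \<le> e" if r: "r < 1" and e: "0 < e" for r e
  proof -
    obtain C where C: "0 \<le> C" "\<And>(f :: complex ^ 'd \<Rightarrow> complex) z. f \<in> besov N \<mu> \<Longrightarrow> norm z \<le> r \<Longrightarrow>
        cmod (f z) \<le> C * besov_norm N \<mu> f"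
      using besov_evaluation_bound[OF \<mu> r] by blast
    have "0 < e / (C + 1)" using C e by simp
    from Cau[OF this] obtain M where M: "\<And>m n. m \<ge> M \<Longrightarrow> n \<ge> M \<Longrightarrow> besov_norm N \<mu> (\<lambda>z. F m z - F n z) < e / (C + 1)"
      by blast
    have "cmod (F m z - F n z) \<le> e" if "m \<ge> M" "n \<ge> M" "norm z \<le> r" for m n z
    proof -
      have "cmod (F m z - F n z) \<le> C * besov_norm N \<mu> (\<lambda>z. F m z - F n z)"
        using C(2)[OF FD that(3)] .
      also have "\<dots> \<le> (C + 1) * (e / (C + 1))"
        using C M[OF that(1,2)] norm_nonneg by (intro mult_mono) auto
      finally show ?thesis using C by simp
    qed
    then show ?thesis by force
  qed
  define f where "f z = lim (\<lambda>n. F n z)" for z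
  have lim: "(\<lambda>n. F n z) \<longlonglongrightarrow> f z" if z: "z \<in> ball 0 1" for z
  proof -
    have "Cauchy (\<lambda>n. F n z)"
    proof (rule metric_CauchyI)
      fix e :: real assume "0 < e"
      then obtain M where "\<forall>m\<ge>M. \<forall>n\<ge>M. \<forall>z'\<in>cball 0 (norm z). cmod (F m z' - F n z') \<le> e / 2"
        using unif_Cau[of "norm z" "e / 2"] z by auto
      then have "\<forall>m\<ge>M. \<forall>n\<ge>M. dist (F m z) (F n z) < e"
        using \<open>0 < e\<close> by (force simp: dist_norm)
      then show "\<exists>M. \<forall>m\<ge>M. \<forall>n\<ge>M. dist (F m z) (F n z) < e" ..
    qed
    then show ?thesis unfolding f_def by (simp add: Cauchy_convergent convergent_LIMSEQ_iff[symmetric])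
  qed
  have unif: "\<exists>M. \<forall>n\<ge>M. \<forall>z\<in>cball 0 r. cmod (F n z - f z) \<le> e" if r: "r < 1" and e: "0 < e" for r e
  proof -
    obtain M where M: "\<And>m n z. m \<ge> M \<Longrightarrow> n \<ge> M \<Longrightarrow> z \<in> cball 0 r \<Longrightarrow> cmod (F m z - F n z) \<le> e"
      using unif_Cau[OF r e] by blast
    have "cmod (F n z - f z) \<le> e" if n: "n \<ge> M" and z: "z \<in> cball 0 r" for n z
    proof (rule LIMSEQ_le_const2)
      show "(\<lambda>m. cmod (F n z - F m z)) \<longlonglongrightarrow> cmod (F n z - f z)"
        using z r by (intro tendsto_intros lim) auto
      show "\<exists>K. \<forall>m\<ge>K. cmod (F n z - F m z) \<le> e" using M n z by blast
    qed
    then show ?thesis by blast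
  qed
  have hol: "holomorphic_ball f"
  proof (rule holomorphic_ball_uniform_limit[OF Fhol])
    fix r :: real assume r: "0 < r" "r < 1"
    show "uniform_limit (cball 0 r) F f sequentially"
    proof (rule uniform_limitI)
      fix e :: real assume "0 < e"
      then obtain M where "\<forall>n\<ge>M. \<forall>z\<in>cball 0 r. cmod (F n z - f z) \<le> e / 2"
        using unif[OF r(2), of "e / 2"] by auto
      then have "\<forall>n\<ge>M. \<forall>z\<in>cball 0 r. dist (F n z) (f z) < e"
        using \<open>0 < e\<close> by (force simp: dist_norm)
      then show "\<forall>\<^sub>F n in sequentially. \<forall>z\<in>cball 0 r. dist (F n z) (f z) < e"
        by (auto simp: eventually_sequentially)
    qed
  qed
  have hc_diff: "homogeneous_component (\<lambda>z. g z - h z) j w = homogeneous_component g j w - homogeneous_component h j w"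
    if "holomorphic_ball g" "holomorphic_ball h" for g h j and w :: "complex ^ 'd"
    using homogeneous_component_lincomb[OF that, of 1 "-1"] by simp
  have comp_lim: "(\<lambda>n. homogeneous_component (F n) j w) \<longlonglongrightarrow> homogeneous_component f j w" for j w
  proof (rule LIMSEQ_I)
    fix e :: real assume e: "0 < e"
    define K where "K = (norm w / (1 / 2)) ^ j"
    have K: "0 \<le> K" by (simp add: K_def)
    then have "0 < e / (K + 1)" using e by simp
    from unif[OF _ this, of "1 / 2"] obtain M where
      M0: "\<forall>n\<ge>M. \<forall>z\<in>cball 0 (1 / 2). cmod (F n z - f z) \<le> e / (K + 1)"
      by auto
    then have M: "cmod (F n z - f z) \<le> e / (K + 1)" if "n \<ge> M" "norm z \<le> 1 / 2" for n z
      using that by simp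
    have "cmod (homogeneous_component (F n) j w - homogeneous_component f j w) < e" if "n \<ge> M" for n
    proof -
      have "cmod (homogeneous_component (\<lambda>z. F n z - f z) j w) \<le> e / (K + 1) * K"
        using M[OF that] unfolding K_def by (intro homogeneous_component_bound holomorphic_ball_diff Fhol hol) auto
      also have "\<dots> < e / (K + 1) * (K + 1)"
        using \<open>0 < e / (K + 1)\<close> by (intro mult_strict_left_mono) auto
      also have "\<dots> = e" using K by simp
      finally show ?thesis by (simp add: hc_diff Fhol hol)
    qed
    then show "\<exists>M. \<forall>n\<ge>M. norm (homogeneous_component (F n) j w - homogeneous_component f j w) < e" by blast
  qed
  have small: "besov_normsq N \<mu> (\<lambda>z. F n z - f z) \<le> ennreal (e\<^sup>2)"
    if M: "\<And>m. m \<ge> M \<Longrightarrow> besov_norm N \<mu> (\<lambda>z. F n z - F m z) < e" for M n e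
  proof -
    let ?J = "\<lambda>h x. ennreal ((cmod (component_map h x))\<^sup>2)"
    have h1: "holomorphic_ball (\<lambda>z. F n z - f z)" and h2: "holomorphic_ball (\<lambda>z. F n z - F m z)" for m
      by (intro holomorphic_ball_diff Fhol hol)+
    have "besov_normsq N \<mu> (\<lambda>z. F n z - f z) = (\<integral>\<^sup>+x. ?J (\<lambda>z. F n z - f z) x \<partial>component_measure N \<mu>)"
      by (rule nn_integral_component_map[OF h1, symmetric])
    also have "\<dots> = (\<integral>\<^sup>+x. liminf (\<lambda>m. ?J (\<lambda>z. F n z - F m z) x) \<partial>component_measure N \<mu>)"
    proof (rule nn_integral_cong)
      fix x :: "nat \<times> (complex ^ 'd)"
      obtain j w where x: "x = (j, w)" by (cases x)
      have "(\<lambda>m. component_map (\<lambda>z. F n z - F m z) x) \<longlonglongrightarrow> component_map (\<lambda>z. F n z - f z) x"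
        unfolding component_map_def x prod.case hc_diff[OF Fhol hol] hc_diff[OF Fhol Fhol]
        by (intro tendsto_intros comp_lim)
      then have "(\<lambda>m. ?J (\<lambda>z. F n z - F m z) x) \<longlonglongrightarrow> ?J (\<lambda>z. F n z - f z) x"
        by (intro tendsto_intros)
      from lim_imp_Liminf[OF _ this] show "?J (\<lambda>z. F n z - f z) x = liminf (\<lambda>m. ?J (\<lambda>z. F n z - F m z) x)"
        by simp
    qed
    also have "\<dots> \<le> liminf (\<lambda>m. \<integral>\<^sup>+x. ?J (\<lambda>z. F n z - F m z) x \<partial>component_measure N \<mu>)"
      using component_map_measurable'[OF h2] by (intro nn_integral_liminf) measurable
    also have "\<dots> \<le> liminf (\<lambda>m. ennreal (e\<^sup>2))"
    proof (rule Liminf_mono)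
      have "(\<integral>\<^sup>+x. ?J (\<lambda>z. F n z - F m z) x \<partial>component_measure N \<mu>) \<le> ennreal (e\<^sup>2)" if "m \<ge> M" for m
        unfolding nn_integral_component_map[OF h2] besov_normsq_norm[OF \<mu> FD]
        using M[OF that] norm_nonneg by (intro ennreal_leI power_mono) auto
      then show "\<forall>\<^sub>F m in sequentially. (\<integral>\<^sup>+x. ?J (\<lambda>z. F n z - F m z) x \<partial>component_measure N \<mu>) \<le> ennreal (e\<^sup>2)"
        unfolding eventually_sequentially by blast
    qed
    finally show ?thesis by (simp add: Liminf_const)
  qed
  have diff_mem: "\<exists>M. \<forall>n\<ge>M. (\<lambda>z. F n z - f z) \<in> besov N \<mu> \<and> besov_norm N \<mu> (\<lambda>z. F n z - f z) \<le> e" if e: "0 < e" for e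
  proof -
    obtain M where M: "\<And>m n. m \<ge> M \<Longrightarrow> n \<ge> M \<Longrightarrow> besov_norm N \<mu> (\<lambda>z. F m z - F n z) < e"
      using Cau[OF e] by blast
    have "(\<lambda>z. F n z - f z) \<in> besov N \<mu> \<and> besov_norm N \<mu> (\<lambda>z. F n z - f z) \<le> e" if n: "n \<ge> M" for n
    proof -
      have s: "besov_normsq N \<mu> (\<lambda>z. F n z - f z) \<le> ennreal (e\<^sup>2)" by (rule small[OF M[OF n]])
      also have "\<dots> < \<infinity>" by simp
      finally have mem: "(\<lambda>z. F n z - f z) \<in> besov N \<mu>"
        by (simp add: besov_iff[OF \<mu>] holomorphic_ball_diff Fhol hol)
      have "(besov_norm N \<mu> (\<lambda>z. F n z - f z))\<^sup>2 \<le> e\<^sup>2"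
        using s unfolding besov_normsq_norm[OF \<mu> mem] by (simp add: ennreal_le_iff)
      then show ?thesis using mem e by (auto intro: power2_le_imp_le)
    qed
    then show ?thesis by blast
  qed
  obtain n0 where n0: "(\<lambda>z. F n0 z - f z) \<in> besov N \<mu>" using diff_mem[of 1] by auto
  have "(\<lambda>z. F n0 z - (F n0 z - f z)) \<in> besov N \<mu>" by (rule besov_diff[OF \<mu> F n0])
  then have "f \<in> besov N \<mu>" by simp
  moreover have "(\<lambda>n. besov_norm N \<mu> (\<lambda>z. F n z - f z)) \<longlonglongrightarrow> 0"
  proof (rule LIMSEQ_I)
    fix e :: real assume "0 < e"
    then obtain M where "\<forall>n\<ge>M. besov_norm N \<mu> (\<lambda>z. F n z - f z) \<le> e / 2"
      using diff_mem[of "e / 2"] by auto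
    then show "\<exists>M. \<forall>n\<ge>M. norm (besov_norm N \<mu> (\<lambda>z. F n z - f z) - 0) < e"
      using \<open>0 < e\<close> norm_nonneg by (intro exI[of _ M]) force
  qed
  ultimately show ?thesis by blast
qed

text \<open>Compatibility with products holds because the components of a product are finite sums of products of
  components.\<close>

lemma besov_L2_function_space:
  assumes \<mu>: "admissible \<mu>"
  shows "L2_function_space (besov N \<mu>) (besov_norm N \<mu>) (component_measure N \<mu>) component_map
    {x :: nat \<times> (complex ^ 'd). norm (snd x) = 1}"
proof
  fix f g :: "complex ^ 'd \<Rightarrow> complex" and a b x
  assume f: "f \<in> besov N \<mu>" and g: "g \<in> besov N \<mu>"
  show "(\<lambda>z. a * f z + b * g z) \<in> besov N \<mu>"
    by (rule besov_lincomb[OF \<mu> f g])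
  show "component_map (\<lambda>z. a * f z + b * g z) x = a * component_map f x + b * component_map g x"
    using f g by (intro component_map_lincomb besov_holomorphic)
next
  show "(\<lambda>z. 1) \<in> besov N \<mu>" by (rule besov_one[OF \<mu>])
next
  fix f :: "complex ^ 'd \<Rightarrow> complex" assume f: "f \<in> besov N \<mu>"
  note [measurable] = component_map_measurable'[OF besov_holomorphic[OF f]]
  have nn: "(\<integral>\<^sup>+x. ennreal ((cmod (component_map f x))\<^sup>2) \<partial>component_measure N \<mu>) = ennreal ((besov_norm N \<mu> f)\<^sup>2)"
    unfolding nn_integral_component_map[OF besov_holomorphic[OF f]] by (rule besov_normsq_norm[OF \<mu> f])
  show "component_map f \<in> borel_measurable (component_measure N \<mu>)" by measurable
  show int: "integrable (component_measure N \<mu>) (\<lambda>x. (cmod (component_map f x))\<^sup>2)"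
    using nn by (intro integrableI_nonneg) auto
  have "(LINT x|component_measure N \<mu>. (cmod (component_map f x))\<^sup>2) = (besov_norm N \<mu> f)\<^sup>2"
    using nn by (subst integral_eq_nn_integral) auto
  then show "besov_norm N \<mu> f = sqrt (LINT x|component_measure N \<mu>. (cmod (component_map f x))\<^sup>2)"
    by (simp add: besov_norm_def)
next
  show "AE x in component_measure N \<mu>. x \<in> {x :: nat \<times> (complex ^ 'd). norm (snd x) = 1}"
    using AE_component_measure by simp
next
  fix x :: "nat \<times> (complex ^ 'd)"
  obtain C where "\<And>f. f \<in> besov N \<mu> \<Longrightarrow> cmod (homogeneous_component f (fst x) (snd x)) \<le> C * besov_norm N \<mu> f"
    using component_evaluation_bound[OF \<mu>, of N "fst x" "snd x"] by blast
  then show "\<exists>C. \<forall>f\<in>besov N \<mu>. cmod (component_map f x) \<le> C * besov_norm N \<mu> f"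
    by (auto simp: component_map_def case_prod_beta)
next
  fix F :: "nat \<Rightarrow> complex ^ 'd \<Rightarrow> complex"
  assume "\<And>n. F n \<in> besov N \<mu>"
    "\<And>e. 0 < e \<Longrightarrow> \<exists>M. \<forall>m\<ge>M. \<forall>n\<ge>M. besov_norm N \<mu> (\<lambda>z. F m z - F n z) < e"
  then show "\<exists>f\<in>besov N \<mu>. (\<lambda>n. besov_norm N \<mu> (\<lambda>z. F n z - f z)) \<longlonglongrightarrow> 0"
    by (rule besov_complete[OF \<mu>])
next
  fix F G :: "nat \<Rightarrow> complex ^ 'd \<Rightarrow> complex" and f g and x :: "nat \<times> (complex ^ 'd)"
  assume mem: "\<And>n. F n \<in> besov N \<mu>" "f \<in> besov N \<mu>" "\<And>n. G n \<in> besov N \<mu>" "g \<in> besov N \<mu>"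
    and F: "\<And>x. x \<in> {x. norm (snd x) = 1} \<Longrightarrow> (\<lambda>n. component_map (F n) x) \<longlonglongrightarrow> component_map f x"
    and G: "\<And>x. x \<in> {x. norm (snd x) = 1} \<Longrightarrow> (\<lambda>n. component_map (G n) x) \<longlonglongrightarrow> component_map g x"
    and x: "x \<in> {x. norm (snd x) = 1}"
  obtain j w where jw: "x = (j, w)" by (cases x)
  with x have w: "norm w = 1" by simp
  have "(\<lambda>n. \<Sum>i=0..j. homogeneous_component (F n) i w * homogeneous_component (G n) (j - i) w)
      \<longlonglongrightarrow> (\<Sum>i=0..j. homogeneous_component f i w * homogeneous_component g (j - i) w)"
    using F[of "(_, w)"] G[of "(_, w)"] w by (intro tendsto_intros) (simp_all add: component_map_def)
  then show "(\<lambda>n. component_map (\<lambda>z. F n z * G n z) x) \<longlonglongrightarrow> component_map (\<lambda>z. f z * g z) x"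
    by (simp add: component_map_def jw homogeneous_component_mult mem[THEN besov_holomorphic])
qed

section \<open>The logarithm times a power\<close>

lemma radial_deriv_iter_lincomb:
  fixes f g :: "complex ^ 'd \<Rightarrow> complex"
  assumes "holomorphic_ball f" "holomorphic_ball g" and w: "w \<in> ball 0 1"
  shows "(radial_deriv ^^ N) (\<lambda>z. a * f z + b * g z) w =
    a * (radial_deriv ^^ N) f w + b * (radial_deriv ^^ N) g w"
proof -
  have hol: "holomorphic_ball (\<lambda>z. a * f z + b * g z)"
    using assms by (intro holomorphic_ball_add holomorphic_ball_cmult)
  obtain F where F: "(\<lambda>t. f (exp t *s w)) has_fps_expansion F" "\<And>N. (radial_deriv ^^ N) f w = fact N * fps_nth F N"
    using has_fps_expansion_exp_slice[OF assms(1) w] by blast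
  obtain G where G: "(\<lambda>t. g (exp t *s w)) has_fps_expansion G" "\<And>N. (radial_deriv ^^ N) g w = fact N * fps_nth G N"
    using has_fps_expansion_exp_slice[OF assms(2) w] by blast
  obtain K where K: "(\<lambda>t. a * f (exp t *s w) + b * g (exp t *s w)) has_fps_expansion K"
      "\<And>N. (radial_deriv ^^ N) (\<lambda>z. a * f z + b * g z) w = fact N * fps_nth K N"
    using has_fps_expansion_exp_slice[OF hol w] by blast
  have "K = fps_const a * F + fps_const b * G"
    using K(1) by (rule fps_expansion_unique_complex)
      (intro has_fps_expansion_add has_fps_expansion_cmult_left F(1) G(1))
  then show ?thesis by (simp add: F(2) G(2) K(2) algebra_simps)
qed

text \<open>With $a = \phi(w)$ and $y = \phi/a$ one has $\phi^m L = a^m (L(w) y^m + y^m \log y)$ near $w$, and $y^m$ and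
  $y^m \log y$ are power series in $y - 1$ with universal coefficients. The powers $(y-1)^i$ with
  $i > N$ vanish at $w$ to an order that $R^N$ does not see. This is a form of Faa di Bruno's formula.\<close>

lemma radial_deriv_iter_power_log:
  obtains p q :: "nat \<Rightarrow> complex"
  where "\<And>\<phi> L f w. \<lbrakk>holomorphic_ball \<phi>; holomorphic_ball L; holomorphic_ball f;
      \<And>z. z \<in> ball 0 1 \<Longrightarrow> exp (L z) = \<phi> z; w \<in> ball (0 :: complex ^ 'd) 1\<rbrakk> \<Longrightarrow>
    (radial_deriv ^^ N) (\<lambda>z. \<phi> z ^ m * L z * f z) w = \<phi> w ^ m * (\<Sum>i\<le>N. (p i * L w + q i) *
      (radial_deriv ^^ N) (\<lambda>z. (\<phi> z / \<phi> w - 1) ^ i * f z) w)"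
proof -
  let ?u = "\<lambda>x :: complex. (1 + x) ^ m" and ?v = "\<lambda>x :: complex. (1 + x) ^ m * Ln (1 + x)"
  have "?u analytic_on {0}" "?v analytic_on {0}"
    by (intro analytic_intros; simp)+
  then obtain P Q where P: "?u has_fps_expansion P" and Q: "?v has_fps_expansion Q"
    using analytic_at_imp_has_fps_expansion_0 by blast
  show thesis
  proof (rule that[of "fps_nth P" "fps_nth Q"])
    fix \<phi> L f :: "complex ^ 'd \<Rightarrow> complex" and w
    assume hol: "holomorphic_ball \<phi>" "holomorphic_ball L" "holomorphic_ball f"
      and log: "\<And>z. z \<in> ball 0 1 \<Longrightarrow> exp (L z) = \<phi> z" and w: "w \<in> ball (0 :: complex ^ 'd) 1"
    define a where "a = \<phi> w"
    have a: "a \<noteq> 0" unfolding a_def using log[OF w] by (metis exp_not_eq_zero)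
    let ?s = "\<lambda>h t. h (exp t *s w)"
    let ?y = "\<lambda>z. \<phi> z / a - 1"
    have y_hol: "holomorphic_ball ?y"
      using holomorphic_ball_diff[OF holomorphic_ball_cmult[OF hol(1), of "1 / a"] holomorphic_ball_const[of 1]] by simp
    obtain Y where Y: "?s ?y has_fps_expansion Y" "\<And>N. (radial_deriv ^^ N) ?y w = fact N * fps_nth Y N"
      using has_fps_expansion_exp_slice[OF y_hol w] by blast
    obtain F where F: "?s f has_fps_expansion F" "\<And>N. (radial_deriv ^^ N) f w = fact N * fps_nth F N"
      using has_fps_expansion_exp_slice[OF hol(3) w] by blast
    have Y0: "fps_nth Y 0 = 0"
      using Y(2)[of 0] a by (simp add: a_def)
    have "holomorphic_ball (\<lambda>z. \<phi> z ^ m * L z * f z)"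
      by (intro holomorphic_ball_mult holomorphic_ball_power hol)
    from has_fps_expansion_exp_slice[OF this w] obtain K where
      K: "?s (\<lambda>z. \<phi> z ^ m * L z * f z) has_fps_expansion K"
        "\<And>N. (radial_deriv ^^ N) (\<lambda>z. \<phi> z ^ m * L z * f z) w = fact N * fps_nth K N"
      by blast
    let ?R = "fps_const (a ^ m) * ((fps_const (L w) * fps_compose P Y + fps_compose Q Y) * F)"
    have comp: "(\<lambda>t. a ^ m * ((L w * (?u \<circ> ?s ?y) t + (?v \<circ> ?s ?y) t) * ?s f t)) has_fps_expansion ?R"
      by (intro has_fps_expansion_mult has_fps_expansion_add has_fps_expansion_cmult_left
          has_fps_expansion_compose P Q Y(1) Y0 F(1))
    have cont: "((\<lambda>t. L (exp t *s w)) \<longlongrightarrow> L w) (nhds 0)" "((\<lambda>t. exp t *s w) \<longlongrightarrow> w) (nhds 0)"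
    proof -
      have "isCont (\<lambda>t. L (exp t *s w)) 0"
        by (intro analytic_at_imp_isCont analytic_exp_slice hol w)
      then show "((\<lambda>t. L (exp t *s w)) \<longlongrightarrow> L w) (nhds 0)"
        using tendsto_at_iff_tendsto_nhds[of "\<lambda>t. L (exp t *s w)" 0] by (simp add: isCont_def)
      have "((\<lambda>t. exp t *s w) \<longlongrightarrow> exp 0 *s w) (nhds 0)"
        by (intro bounded_linear.tendsto[OF bounded_linear_vector_scalar_mult_left] tendsto_exp filterlim_ident)
      then show "((\<lambda>t. exp t *s w) \<longlongrightarrow> w) (nhds 0)" by simp
    qed
    have ev: "\<forall>\<^sub>F t in nhds 0. ?s (\<lambda>z. \<phi> z ^ m * L z * f z) t =
        a ^ m * ((L w * (?u \<circ> ?s ?y) t + (?v \<circ> ?s ?y) t) * ?s f t)"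
    proof -
      have "\<forall>\<^sub>F t in nhds 0. dist (L (exp t *s w)) (L w) < pi"
        using tendstoD[OF cont(1) pi_gt_zero] .
      moreover have "\<forall>\<^sub>F t in nhds 0. exp t *s w \<in> ball 0 1"
        using topological_tendstoD[OF cont(2) open_ball w] .
      ultimately show ?thesis
      proof eventually_elim
        case (elim t)
        let ?d = "L (exp t *s w) - L w"
        have "\<bar>Im ?d\<bar> < pi" using elim(1) abs_Im_le_cmod[of ?d] by (simp add: dist_norm)
        then have ln: "Ln (exp ?d) = ?d" by (intro Ln_exp) auto
        have "1 + ?s ?y t = \<phi> (exp t *s w) / \<phi> w" by (simp add: a_def)
        also have "\<dots> = exp ?d" using log[OF w] log[OF elim(2)] by (simp add: exp_diff)
        finally have y: "1 + ?s ?y t = exp ?d" .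
        have "a ^ m * exp ?d ^ m = \<phi> (exp t *s w) ^ m"
          using log[OF w] log[OF elim(2)] a by (simp add: a_def exp_diff power_divide)
        then show ?case by (simp add: y ln) (simp add: algebra_simps)
      qed
    qed
    have "?s (\<lambda>z. \<phi> z ^ m * L z * f z) has_fps_expansion ?R"
      by (rule iffD2[OF has_fps_expansion_cong[OF ev refl] comp])
    with K(1) have "K = ?R" by (rule fps_expansion_unique_complex)
    have compose_nth: "fps_nth (fps_compose A Y * F) N = (\<Sum>i\<le>N. fps_nth A i * fps_nth (Y ^ i * F) N)" for A
    proof -
      have "fps_nth (fps_compose A Y * F) N = (\<Sum>k=0..N. \<Sum>i=0..k. fps_nth A i * fps_nth (Y ^ i) k * fps_nth F (N - k))"
        by (simp add: fps_mult_nth fps_compose_nth sum_distrib_right)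
      also have "\<dots> = (\<Sum>k=0..N. \<Sum>i=0..N. fps_nth A i * fps_nth (Y ^ i) k * fps_nth F (N - k))"
        using startsby_zero_power_prefix[OF Y0] by (intro sum.cong refl sum.mono_neutral_left) auto
      also have "\<dots> = (\<Sum>i=0..N. \<Sum>k=0..N. fps_nth A i * fps_nth (Y ^ i) k * fps_nth F (N - k))"
        by (rule sum.swap)
      also have "\<dots> = (\<Sum>i\<le>N. fps_nth A i * fps_nth (Y ^ i * F) N)"
        by (simp add: fps_mult_nth sum_distrib_left mult.assoc atMost_atLeast0)
      finally show ?thesis .
    qed
    have power_nth: "(radial_deriv ^^ N) (\<lambda>z. (\<phi> z / a - 1) ^ i * f z) w = fact N * fps_nth (Y ^ i * F) N" for i
    proof -
      have "holomorphic_ball (\<lambda>z. ?y z ^ i * f z)"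
        by (intro holomorphic_ball_mult holomorphic_ball_power y_hol hol)
      from has_fps_expansion_exp_slice[OF this w] obtain B where
        B: "?s (\<lambda>z. ?y z ^ i * f z) has_fps_expansion B"
          "\<And>N. (radial_deriv ^^ N) (\<lambda>z. ?y z ^ i * f z) w = fact N * fps_nth B N" by blast
      have "B = Y ^ i * F"
        using B(1) by (rule fps_expansion_unique_complex)
          (intro has_fps_expansion_mult has_fps_expansion_power Y(1) F(1))
      then show ?thesis by (simp add: B(2))
    qed
    have "(radial_deriv ^^ N) (\<lambda>z. \<phi> z ^ m * L z * f z) w =
        fact N * (a ^ m * (L w * fps_nth (fps_compose P Y * F) N + fps_nth (fps_compose Q Y * F) N))"
      unfolding K(2) \<open>K = ?R\<close> by (simp add: distrib_right mult.assoc)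
    also have "\<dots> = a ^ m * (\<Sum>i\<le>N. (fps_nth P i * L w + fps_nth Q i) * (fact N * fps_nth (Y ^ i * F) N))"
      unfolding compose_nth by (simp add: sum_distrib_left sum.distrib[symmetric] algebra_simps)
    finally show "(radial_deriv ^^ N) (\<lambda>z. \<phi> z ^ m * L z * f z) w = \<phi> w ^ m * (\<Sum>i\<le>N. (fps_nth P i * L w + fps_nth Q i) *
        (radial_deriv ^^ N) (\<lambda>z. (\<phi> z / \<phi> w - 1) ^ i * f z) w)"
      unfolding power_nth[symmetric] by (simp add: a_def)
  qed
qed

text \<open>The constant $a$ will be the value of $\phi$ at the point $w$ itself, so the right-hand side is a
  combination of the functions $R^N(\phi^k f)$ whose coefficients are bounded functions of $w$, but not
  holomorphic ones.\<close>

lemma radial_deriv_iter_binomial: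
  fixes \<phi> f :: "complex ^ 'd \<Rightarrow> complex"
  assumes hol: "holomorphic_ball \<phi>" "holomorphic_ball f" and w: "w \<in> ball 0 1" and a: "a \<noteq> 0"
  shows "a ^ i * (radial_deriv ^^ N) (\<lambda>z. (\<phi> z / a - 1) ^ i * f z) w =
    (\<Sum>k\<le>i. of_nat (i choose k) * (- a) ^ (i - k) * (radial_deriv ^^ N) (\<lambda>z. \<phi> z ^ k * f z) w)"
proof -
  have sum: "(radial_deriv ^^ N) (\<lambda>z. \<Sum>k\<in>S. c k * h k z) w = (\<Sum>k\<in>S. c k * (radial_deriv ^^ N) (h k) w)
      \<and> holomorphic_ball (\<lambda>z. \<Sum>k\<in>S. c k * h k z)"
    if "finite S" "\<And>k. holomorphic_ball (h k)" for S :: "nat set" and c and h :: "nat \<Rightarrow> complex ^ 'd \<Rightarrow> complex"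
    using that(1)
  proof induction
    case empty
    then show ?case
      using radial_deriv_iter_lincomb[OF hol(2) hol(2) w, of N 0 0] by simp
  next
    case (insert k S)
    then have "(radial_deriv ^^ N) (\<lambda>z. c k * h k z + 1 * (\<Sum>k\<in>S. c k * h k z)) w =
        c k * (radial_deriv ^^ N) (h k) w + 1 * (radial_deriv ^^ N) (\<lambda>z. \<Sum>k\<in>S. c k * h k z) w"
      by (intro radial_deriv_iter_lincomb that(2) w) auto
    moreover have "holomorphic_ball (\<lambda>z. c k * h k z + (\<Sum>k\<in>S. c k * h k z))"
      using insert by (intro holomorphic_ball_add holomorphic_ball_cmult that(2)) auto
    ultimately show ?case using insert by simp
  qed
  have y_hol: "holomorphic_ball (\<lambda>z. (\<phi> z / a - 1) ^ i * f z)"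
    using holomorphic_ball_diff[OF holomorphic_ball_cmult[OF hol(1), of "1 / a"] holomorphic_ball_const[of 1]]
    by (intro holomorphic_ball_mult holomorphic_ball_power hol) simp
  have expand: "a ^ i * ((\<phi> z / a - 1) ^ i * f z) =
      (\<Sum>k\<le>i. (of_nat (i choose k) * (- a) ^ (i - k)) * (\<phi> z ^ k * f z))" for z
  proof -
    have "a ^ i * (\<phi> z / a - 1) ^ i = (a * (\<phi> z / a - 1)) ^ i" by (simp add: power_mult_distrib)
    also have "\<dots> = (\<phi> z + - a) ^ i" using a by (simp add: algebra_simps)
    also have "\<dots> = (\<Sum>k\<le>i. of_nat (i choose k) * \<phi> z ^ k * (- a) ^ (i - k))"
      by (rule binomial_ring)
    finally have eq: "a ^ i * (\<phi> z / a - 1) ^ i = (\<Sum>k\<le>i. of_nat (i choose k) * \<phi> z ^ k * (- a) ^ (i - k))" .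
    have "a ^ i * ((\<phi> z / a - 1) ^ i * f z) = a ^ i * (\<phi> z / a - 1) ^ i * f z" by (simp only: mult.assoc)
    also have "\<dots> = (\<Sum>k\<le>i. of_nat (i choose k) * \<phi> z ^ k * (- a) ^ (i - k)) * f z" by (simp only: eq)
    also have "\<dots> = (\<Sum>k\<le>i. (of_nat (i choose k) * (- a) ^ (i - k)) * (\<phi> z ^ k * f z))"
      unfolding sum_distrib_right by (intro sum.cong refl) (simp only: mult_ac)
    finally show ?thesis .
  qed
  have "a ^ i * (radial_deriv ^^ N) (\<lambda>z. (\<phi> z / a - 1) ^ i * f z) w =
      (radial_deriv ^^ N) (\<lambda>z. a ^ i * ((\<phi> z / a - 1) ^ i * f z)) w"
    using radial_deriv_iter_lincomb[OF y_hol y_hol w, of N "a ^ i" 0] by simp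
  also have "\<dots> = (\<Sum>k\<le>i. of_nat (i choose k) * (- a) ^ (i - k) * (radial_deriv ^^ N) (\<lambda>z. \<phi> z ^ k * f z) w)"
    unfolding expand by (intro sum[THEN conjunct1] finite_atMost holomorphic_ball_mult holomorphic_ball_power hol)
  finally show ?thesis .
qed

text \<open>For $\zeta = \log\phi$: the function $x e^x$ is bounded on every half-line $x \le \log M$.\<close>

lemma exp_mult_log_bounded:
  assumes "\<bar>Im \<zeta>\<bar> \<le> B" "cmod (exp \<zeta>) \<le> M"
  shows "cmod (exp \<zeta> * \<zeta>) \<le> 1 + M * (M + B)"
proof -
  have M: "exp (Re \<zeta>) \<le> M" using assms(2) by simp
  then have M0: "0 < M" using exp_gt_zero less_le_trans by blast
  have "cmod (exp \<zeta> * \<zeta>) \<le> exp (Re \<zeta>) * (\<bar>Re \<zeta>\<bar> + \<bar>Im \<zeta>\<bar>)"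
    by (simp add: norm_mult cmod_le)
  also have "\<dots> = exp (Re \<zeta>) * \<bar>Re \<zeta>\<bar> + exp (Re \<zeta>) * \<bar>Im \<zeta>\<bar>" by (simp add: distrib_left)
  also have "exp (Re \<zeta>) * \<bar>Im \<zeta>\<bar> \<le> M * B"
    using assms(1) M M0 by (intro mult_mono) auto
  also have "exp (Re \<zeta>) * \<bar>Re \<zeta>\<bar> \<le> 1 + M * M"
  proof (cases "0 \<le> Re \<zeta>")
    case True
    have "Re \<zeta> \<le> exp (Re \<zeta>)" using exp_ge_add_one_self[of "Re \<zeta>"] by linarith
    then have "exp (Re \<zeta>) * \<bar>Re \<zeta>\<bar> \<le> M * M" using True M M0 by (intro mult_mono) auto
    then show ?thesis by simp
  next
    case False
    have "- Re \<zeta> \<le> exp (- Re \<zeta>)" using exp_ge_add_one_self[of "- Re \<zeta>"] by linarith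
    then have "exp (Re \<zeta>) * (- Re \<zeta>) \<le> exp (Re \<zeta>) * exp (- Re \<zeta>)" by (intro mult_left_mono) auto
    also have "\<dots> = 1" by (simp flip: exp_add)
    finally show ?thesis using False M0 by (simp add: add_nonneg_nonneg) (smt (verit) mult_nonneg_nonneg)
  qed
  finally show ?thesis by (simp add: algebra_simps)
qed

text \<open>The surplus of one factor $\phi(w)$ in $\phi(w)^{N+1}$ over $\phi(w)^i$ with $i \le N$ absorbs the
  unbounded factor $L(w)$.\<close>

lemma radial_deriv_iter_power_log_bound:
  fixes \<phi> L :: "complex ^ 'd \<Rightarrow> complex"
  assumes hol: "holomorphic_ball \<phi>" "holomorphic_ball L"
    and log: "\<And>z. z \<in> ball 0 1 \<Longrightarrow> exp (L z) = \<phi> z"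
    and M: "\<And>z. z \<in> ball 0 1 \<Longrightarrow> cmod (\<phi> z) \<le> M" and B: "\<And>z. z \<in> ball 0 1 \<Longrightarrow> \<bar>Im (L z)\<bar> \<le> B"
  obtains C where "0 \<le> C"
    "\<And>f w. holomorphic_ball f \<Longrightarrow> w \<in> ball 0 1 \<Longrightarrow>
      cmod ((radial_deriv ^^ N) (\<lambda>z. \<phi> z ^ Suc N * L z * f z) w) \<le>
        C * (\<Sum>k\<le>N. cmod ((radial_deriv ^^ N) (\<lambda>z. \<phi> z ^ k * f z) w))"
proof -
  obtain p q where pq: "\<And>\<phi> L f w. \<lbrakk>holomorphic_ball \<phi>; holomorphic_ball L; holomorphic_ball f;
      \<And>z. z \<in> ball 0 1 \<Longrightarrow> exp (L z) = \<phi> z; w \<in> ball (0 :: complex ^ 'd) 1\<rbrakk> \<Longrightarrow>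
    (radial_deriv ^^ N) (\<lambda>z. \<phi> z ^ Suc N * L z * f z) w = \<phi> w ^ Suc N * (\<Sum>i\<le>N. (p i * L w + q i) *
      (radial_deriv ^^ N) (\<lambda>z. (\<phi> z / \<phi> w - 1) ^ i * f z) w)"
    using radial_deriv_iter_power_log[of N "Suc N"] by blast
  have M0: "0 \<le> M" using M[of 0] norm_ge_zero order_trans by (metis centre_in_ball zero_less_one)
  define D where "D = 1 + M * (M + B)"
  define C where "C = (\<Sum>i\<le>N. \<Sum>k\<le>i. (cmod (p i) * D + cmod (q i) * M) * M ^ (N - i) * (real (i choose k) * M ^ (i - k)))"
  have D0: "0 \<le> D" unfolding D_def using M0 B[of 0] by (simp add: add_nonneg_nonneg)
  show thesis
  proof (rule that[of C])
    show "0 \<le> C" unfolding C_def using M0 D0 by (intro sum_nonneg mult_nonneg_nonneg add_nonneg_nonneg) auto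
    fix f :: "complex ^ 'd \<Rightarrow> complex" and w :: "complex ^ 'd"
    assume f: "holomorphic_ball f" and w: "w \<in> ball 0 1"
    define a where "a = \<phi> w"
    have a: "a \<noteq> 0" unfolding a_def using log[OF w] by (metis exp_not_eq_zero)
    have aM: "cmod a \<le> M" unfolding a_def by (rule M[OF w])
    have aL: "cmod (a * L w) \<le> D"
      using exp_mult_log_bounded[of "L w" B M] log[OF w] M[OF w] B[OF w] by (simp add: a_def D_def)
    let ?r = "\<lambda>k. (radial_deriv ^^ N) (\<lambda>z. \<phi> z ^ k * f z) w"
    let ?T = "\<Sum>k\<le>N. cmod (?r k)"
    have term_eq: "a ^ Suc N * ((p i * L w + q i) * (radial_deriv ^^ N) (\<lambda>z. (\<phi> z / a - 1) ^ i * f z) w) =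
        (p i * (a * L w) + q i * a) * a ^ (N - i) * (\<Sum>k\<le>i. of_nat (i choose k) * (- a) ^ (i - k) * ?r k)"
      if "i \<le> N" for i
    proof -
      have eq: "a ^ Suc N = a * a ^ (N - i) * a ^ i" using that by (simp flip: power_add)
      show ?thesis
        unfolding radial_deriv_iter_binomial[OF hol(1) f w a, symmetric] eq
        by (simp only: algebra_simps)
    qed
    have "(radial_deriv ^^ N) (\<lambda>z. \<phi> z ^ Suc N * L z * f z) w =
        (\<Sum>i\<le>N. a ^ Suc N * ((p i * L w + q i) * (radial_deriv ^^ N) (\<lambda>z. (\<phi> z / a - 1) ^ i * f z) w))"
      by (simp only: pq[OF hol f log w] a_def sum_distrib_left)
    also have "\<dots> = (\<Sum>i\<le>N. (p i * (a * L w) + q i * a) * a ^ (N - i) *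
        (\<Sum>k\<le>i. of_nat (i choose k) * (- a) ^ (i - k) * ?r k))"
      by (intro sum.cong refl term_eq) simp
    finally have "cmod ((radial_deriv ^^ N) (\<lambda>z. \<phi> z ^ Suc N * L z * f z) w) =
        cmod (\<Sum>i\<le>N. (p i * (a * L w) + q i * a) * a ^ (N - i) * (\<Sum>k\<le>i. of_nat (i choose k) * (- a) ^ (i - k) * ?r k))"
      by (rule arg_cong)
    also have "\<dots> \<le> (\<Sum>i\<le>N. \<Sum>k\<le>i. ((cmod (p i) * D + cmod (q i) * M) * M ^ (N - i) * (real (i choose k) * M ^ (i - k))) * ?T)"
    proof (intro order_trans[OF norm_sum] sum_mono)
      fix i assume i: "i \<in> {..N}"
      have "cmod (p i * (a * L w) + q i * a) \<le> cmod (p i) * D + cmod (q i) * M"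
      proof (intro order_trans[OF norm_triangle_ineq] add_mono)
        show "cmod (p i * (a * L w)) \<le> cmod (p i) * D" unfolding norm_mult[of "p i"] by (intro mult_left_mono aL) auto
        show "cmod (q i * a) \<le> cmod (q i) * M" unfolding norm_mult by (intro mult_left_mono aM) auto
      qed
      then have 1: "cmod ((p i * (a * L w) + q i * a) * a ^ (N - i)) \<le> (cmod (p i) * D + cmod (q i) * M) * M ^ (N - i)"
        unfolding norm_mult[of _ "a ^ _"] norm_power using M0 D0 aM by (intro mult_mono power_mono) auto
      have 2: "cmod (\<Sum>k\<le>i. of_nat (i choose k) * (- a) ^ (i - k) * ?r k) \<le> (\<Sum>k\<le>i. real (i choose k) * M ^ (i - k) * ?T)"
      proof (intro order_trans[OF norm_sum] sum_mono)
        fix k assume k: "k \<in> {..i}"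
        have "cmod (?r k) \<le> ?T" using i k by (intro member_le_sum) auto
        then show "cmod (of_nat (i choose k) * (- a) ^ (i - k) * ?r k) \<le> real (i choose k) * M ^ (i - k) * ?T"
          using M0 aM by (simp only: norm_mult norm_power norm_of_nat norm_minus_cancel) (intro mult_mono power_mono; simp)
      qed
      have "cmod ((p i * (a * L w) + q i * a) * a ^ (N - i) * (\<Sum>k\<le>i. of_nat (i choose k) * (- a) ^ (i - k) * ?r k))
          \<le> (cmod (p i) * D + cmod (q i) * M) * M ^ (N - i) * (\<Sum>k\<le>i. real (i choose k) * M ^ (i - k) * ?T)"
        unfolding norm_mult[of _ "sum _ _"] using 1 2 M0 D0
        by (intro mult_mono mult_nonneg_nonneg add_nonneg_nonneg) auto
      then show "cmod ((p i * (a * L w) + q i * a) * a ^ (N - i) * (\<Sum>k\<le>i. of_nat (i choose k) * (- a) ^ (i - k) * ?r k))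
          \<le> (\<Sum>k\<le>i. ((cmod (p i) * D + cmod (q i) * M) * M ^ (N - i) * (real (i choose k) * M ^ (i - k))) * ?T)"
        by (simp only: sum_distrib_left mult.assoc)
    qed
    also have "\<dots> = C * ?T" unfolding C_def by (simp only: sum_distrib_right)
    finally show "cmod ((radial_deriv ^^ N) (\<lambda>z. \<phi> z ^ Suc N * L z * f z) w) \<le> C * ?T" .
  qed
qed

section \<open>Multipliers\<close>

text \<open>The norm of $L^2(\omega)$, including its Hardy space part, sees only the absolute values inside the
  ball. In particular, the dominated function may be compared with non-holomorphic multiples.\<close>

lemma L2_normsq_le_sum:
  fixes h :: "complex ^ 'd \<Rightarrow> complex" and g :: "nat \<Rightarrow> complex ^ 'd \<Rightarrow> complex"
  assumes g: "\<And>k. holomorphic_ball (g k)" and C: "0 \<le> C"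
    and le: "\<And>z. z \<in> ball 0 1 \<Longrightarrow> cmod (h z) \<le> C * (\<Sum>k\<le>n. cmod (g k z))"
  shows "L2_normsq \<mu> h \<le> (\<Sum>k\<le>n. ennreal (C\<^sup>2 * real (Suc n)) * L2_normsq \<mu> (g k))"
proof -
  let ?K = "C\<^sup>2 * real (Suc n)" and ?g = "\<lambda>k w. indicator (ball 0 1) w *\<^sub>R g k w"
  have [measurable]: "?g k \<in> borel_measurable borel" for k by (rule holomorphic_ball_measurable[OF g])
  have pointwise: "ennreal ((cmod (h z))\<^sup>2) \<le> (\<Sum>k\<le>n. ennreal ?K * ennreal ((cmod (?g k z))\<^sup>2))" if z: "z \<in> ball 0 1" for z
  proof -
    have "(cmod (h z))\<^sup>2 \<le> (C * (\<Sum>k\<le>n. cmod (g k z)))\<^sup>2"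
      by (intro power_mono le z) auto
    also have "\<dots> \<le> C\<^sup>2 * (real (Suc n) * (\<Sum>k\<le>n. (cmod (g k z))\<^sup>2))"
      using sum_squared_le_sum_of_squares[of "\<lambda>k. cmod (g k z)" "{..n}"]
      unfolding power_mult_distrib by (intro mult_left_mono) (auto simp: mult.commute)
    also have "\<dots> = (\<Sum>k\<le>n. ?K * (cmod (?g k z))\<^sup>2)"
      using z by (simp add: sum_distrib_left mult.assoc)
    finally have "ennreal ((cmod (h z))\<^sup>2) \<le> ennreal (\<Sum>k\<le>n. ?K * (cmod (?g k z))\<^sup>2)"
      by (rule ennreal_leI)
    also have "\<dots> = (\<Sum>k\<le>n. ennreal ?K * ennreal ((cmod (?g k z))\<^sup>2))"
      by (subst sum_ennreal[symmetric]) (auto simp: ennreal_mult)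
    finally show ?thesis .
  qed
  have ball: "(\<integral>\<^sup>+z\<in>ball 0 1. ennreal ((cmod (h z))\<^sup>2) \<partial>radial_measure \<mu>) \<le>
      (\<Sum>k\<le>n. ennreal ?K * (\<integral>\<^sup>+z\<in>ball 0 1. ennreal ((cmod (g k z))\<^sup>2) \<partial>radial_measure \<mu>))"
  proof -
    have [measurable_cong]: "sets (radial_measure \<mu> :: (complex ^ 'd) measure) = sets borel"
      by (simp add: radial_measure_def)
    have set_eq: "(\<integral>\<^sup>+z\<in>ball 0 1. ennreal ((cmod (g k z))\<^sup>2) \<partial>radial_measure \<mu>) =
        (\<integral>\<^sup>+z. ennreal ((cmod (?g k z))\<^sup>2) \<partial>radial_measure \<mu>)" for k
      by (intro nn_integral_cong) (auto simp: indicator_def)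
    have "(\<integral>\<^sup>+z\<in>ball 0 1. ennreal ((cmod (h z))\<^sup>2) \<partial>radial_measure \<mu>) \<le>
        (\<integral>\<^sup>+z. (\<Sum>k\<le>n. ennreal ?K * ennreal ((cmod (?g k z))\<^sup>2)) \<partial>radial_measure \<mu>)"
      using pointwise by (intro nn_integral_mono) (auto simp: indicator_def)
    also have "\<dots> = (\<Sum>k\<le>n. \<integral>\<^sup>+z. ennreal ?K * ennreal ((cmod (?g k z))\<^sup>2) \<partial>radial_measure \<mu>)"
      by (rule nn_integral_sum) measurable
    also have "\<dots> = (\<Sum>k\<le>n. ennreal ?K * (\<integral>\<^sup>+z. ennreal ((cmod (?g k z))\<^sup>2) \<partial>radial_measure \<mu>))"
      by (intro sum.cong refl nn_integral_cmult) measurable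
    finally show ?thesis by (simp only: set_eq)
  qed
  have hardy: "hardy_normsq h \<le> (\<Sum>k\<le>n. ennreal ?K * hardy_normsq (g k))"
    unfolding hardy_normsq_def[of h]
  proof (rule SUP_least)
    fix r :: real assume r: "r \<in> {0..<1}"
    let ?\<sigma> = "sphere_measure :: (complex ^ 'd) measure"
    have "(\<integral>\<^sup>+w. ennreal ((cmod (h (r *\<^sub>R w)))\<^sup>2) \<partial>?\<sigma>) \<le>
        (\<integral>\<^sup>+w. (\<Sum>k\<le>n. ennreal ?K * ennreal ((cmod (?g k (r *\<^sub>R w)))\<^sup>2)) \<partial>?\<sigma>)"
      using r pointwise by (intro nn_integral_mono_AE, rule_tac AE_mp[OF AE_sphere_measure], intro AE_I2 impI) auto
    also have "\<dots> = (\<Sum>k\<le>n. \<integral>\<^sup>+w. ennreal ?K * ennreal ((cmod (?g k (r *\<^sub>R w)))\<^sup>2) \<partial>?\<sigma>)"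
      by (rule nn_integral_sum) measurable
    also have "\<dots> = (\<Sum>k\<le>n. ennreal ?K * (\<integral>\<^sup>+w. ennreal ((cmod (?g k (r *\<^sub>R w)))\<^sup>2) \<partial>?\<sigma>))"
      by (intro sum.cong refl nn_integral_cmult) measurable
    also have "\<dots> \<le> (\<Sum>k\<le>n. ennreal ?K * hardy_normsq (g k))"
    proof (intro sum_mono mult_left_mono)
      fix k
      have "(\<integral>\<^sup>+w. ennreal ((cmod (?g k (r *\<^sub>R w)))\<^sup>2) \<partial>?\<sigma>) = (\<integral>\<^sup>+w. ennreal ((cmod (g k (r *\<^sub>R w)))\<^sup>2) \<partial>?\<sigma>)"
        using r by (intro nn_integral_cong_AE, rule_tac AE_mp[OF AE_sphere_measure], intro AE_I2 impI) auto
      also have "\<dots> \<le> hardy_normsq (g k)" unfolding hardy_normsq_def using r by (rule SUP_upper)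
      finally show "(\<integral>\<^sup>+w. ennreal ((cmod (?g k (r *\<^sub>R w)))\<^sup>2) \<partial>?\<sigma>) \<le> hardy_normsq (g k)" .
    qed simp
    finally show "(\<integral>\<^sup>+w. ennreal ((cmod (h (r *\<^sub>R w)))\<^sup>2) \<partial>?\<sigma>) \<le> (\<Sum>k\<le>n. ennreal ?K * hardy_normsq (g k))" .
  qed
  have "L2_normsq \<mu> h \<le> (\<Sum>k\<le>n. ennreal ?K * (\<integral>\<^sup>+z\<in>ball 0 1. ennreal ((cmod (g k z))\<^sup>2) \<partial>radial_measure \<mu>)) +
      emeasure \<mu> {1} * (\<Sum>k\<le>n. ennreal ?K * hardy_normsq (g k))"
    unfolding L2_normsq_def by (intro add_mono ball mult_left_mono hardy) simp
  also have "\<dots> = (\<Sum>k\<le>n. ennreal ?K * L2_normsq \<mu> (g k))"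
    unfolding L2_normsq_def by (simp only: sum_distrib_left sum.distrib[symmetric] distrib_left mult.left_commute[of "emeasure \<mu> {1}"])
  finally show ?thesis .
qed

text \<open>All powers $\phi^m = M_\phi^m 1$ satisfy $|\phi(z)|^m \le E C^m$ with constants that do not depend on $m$.\<close>

lemma besov_multiplier_bounded:
  fixes \<phi> :: "complex ^ 'd \<Rightarrow> complex"
  assumes \<mu>: "admissible \<mu>" and \<phi>: "\<phi> \<in> Mult (besov N \<mu>)"
  obtains M where "\<And>z. z \<in> ball 0 1 \<Longrightarrow> cmod (\<phi> z) \<le> M"
proof -
  interpret L2_function_space "besov N \<mu>" "besov_norm N \<mu>" "component_measure N \<mu>" component_map
    "{x :: nat \<times> (complex ^ 'd). norm (snd x) = 1}"
    by (rule besov_L2_function_space[OF \<mu>])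
  obtain C where C: "0 \<le> C" "\<And>f. f \<in> besov N \<mu> \<Longrightarrow> besov_norm N \<mu> (\<lambda>z. \<phi> z * f z) \<le> C * besov_norm N \<mu> f"
    using multiplier_bounded[OF \<phi>] by blast
  define M where "M = max C 1"
  have M: "0 < M" "C \<le> M" by (auto simp: M_def)
  have mem: "(\<lambda>z. \<phi> z ^ m) \<in> besov N \<mu>" for m
    by (rule Mult_imp_mem[OF Mult_power[OF \<phi>]])
  have power_le: "besov_norm N \<mu> (\<lambda>z. \<phi> z ^ m) \<le> M ^ m * besov_norm N \<mu> (\<lambda>z :: complex ^ 'd. 1)" for m
  proof (induction m)
    case (Suc m)
    have "besov_norm N \<mu> (\<lambda>z. \<phi> z * \<phi> z ^ m) \<le> C * besov_norm N \<mu> (\<lambda>z. \<phi> z ^ m)"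
      by (rule C(2)[OF mem])
    also have "\<dots> \<le> M * (M ^ m * besov_norm N \<mu> (\<lambda>z :: complex ^ 'd. 1))"
      using Suc M nrm_nonneg[OF mem] by (intro mult_mono) auto
    finally show ?case by (simp add: mult.assoc)
  qed simp
  show thesis
  proof (rule that[of M], rule ccontr)
    fix z :: "complex ^ 'd" assume z: "z \<in> ball 0 1" and "\<not> cmod (\<phi> z) \<le> M"
    then have gt: "1 < cmod (\<phi> z) / M" using M by (simp add: field_simps)
    obtain E where E: "0 \<le> E" "\<And>(f :: complex ^ 'd \<Rightarrow> complex) y. f \<in> besov N \<mu> \<Longrightarrow> norm y \<le> norm z \<Longrightarrow>
        cmod (f y) \<le> E * besov_norm N \<mu> f"
      using besov_evaluation_bound[OF \<mu>, of "norm z"] z by auto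
    obtain m where "E * besov_norm N \<mu> (\<lambda>z :: complex ^ 'd. 1) < (cmod (\<phi> z) / M) ^ m"
      using real_arch_pow[OF gt] by blast
    also have "\<dots> = cmod (\<phi> z ^ m) / M ^ m" by (simp add: power_divide norm_power)
    also have "\<dots> \<le> E * (M ^ m * besov_norm N \<mu> (\<lambda>z :: complex ^ 'd. 1)) / M ^ m"
      using E(2)[OF mem, of z m] mult_left_mono[OF power_le E(1), of m] M by (intro divide_right_mono) auto
    also have "\<dots> = E * besov_norm N \<mu> (\<lambda>z :: complex ^ 'd. 1)" using M by simp
    finally show False by simp
  qed
qed

text \<open>Two logarithms differ by a continuous function with values in $2\pi i\mathbb{Z}$, which is constant.\<close>

lemma analytic_log_bounded_Im:
  fixes \<phi> L :: "complex ^ 'd \<Rightarrow> complex"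
  assumes arg: "bounded_argument \<phi>" and L: "analytic_log \<phi> L"
  obtains B where "\<And>z. z \<in> ball 0 1 \<Longrightarrow> \<bar>Im (L z)\<bar> \<le> B"
proof -
  obtain L' where L': "analytic_log \<phi> L'" "bounded ((\<lambda>z. Im (L' z)) ` ball 0 1)"
    using arg by (auto simp: bounded_argument_def)
  have hol: "holomorphic_ball L" "holomorphic_ball L'" and
    e: "\<And>z. z \<in> ball 0 1 \<Longrightarrow> exp (L z) = \<phi> z" "\<And>z. z \<in> ball 0 1 \<Longrightarrow> exp (L' z) = \<phi> z"
    using L L'(1) by (auto simp: analytic_log_def)
  let ?d = "\<lambda>z. L z - L' z"
  have e1: "exp (?d z) = 1" if "z \<in> ball 0 1" for z
    using e[OF that] exp_not_eq_zero[of "L' z"] by (simp add: exp_diff)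
  have "?d constant_on ball 0 1"
  proof (rule continuous_discrete_range_constant)
    show "continuous_on (ball 0 1) ?d"
      by (intro continuous_intros holomorphic_ball_continuous_on hol)
    fix x :: "complex ^ 'd" assume x: "x \<in> ball 0 1"
    have "1 \<le> norm (?d y - ?d x)" if y: "y \<in> ball 0 1" "?d y \<noteq> ?d x" for y
    proof (rule ccontr)
      assume "\<not> 1 \<le> norm (?d y - ?d x)"
      then have "\<bar>Im (?d y - ?d x)\<bar> < pi"
        using abs_Im_le_cmod[of "?d y - ?d x"] pi_gt3 by linarith
      then have "Ln (exp (?d y - ?d x)) = ?d y - ?d x" by (intro Ln_exp) auto
      moreover have "exp (?d y - ?d x) = 1" using e1[OF x] e1[OF y(1)] by (simp add: exp_diff)
      ultimately show False using y(2) by simp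
    qed
    then show "\<exists>\<epsilon>>0. \<forall>y. y \<in> ball 0 1 \<and> ?d y \<noteq> ?d x \<longrightarrow> \<epsilon> \<le> norm (?d y - ?d x)"
      by (intro exI[of _ 1]) auto
  qed simp
  then obtain c where c: "\<And>z. z \<in> ball 0 1 \<Longrightarrow> ?d z = c" by (auto simp: constant_on_def)
  obtain B where "\<forall>z\<in>ball 0 1. \<bar>Im (L' z)\<bar> \<le> B"
    using L'(2) by (auto simp: bounded_iff)
  then have B: "\<bar>Im (L' z)\<bar> \<le> B" if "z \<in> ball 0 1" for z
    using that by blast
  show thesis
  proof (rule that[of "B + \<bar>Im c\<bar>"])
    fix z :: "complex ^ 'd" assume z: "z \<in> ball 0 1"
    have "L z = L' z + c" using c[OF z] by (simp add: algebra_simps)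
    then show "\<bar>Im (L z)\<bar> \<le> B + \<bar>Im c\<bar>" using B[OF z] by simp
  qed
qed

lemma power_mult_log_multiplier:
  fixes \<phi> L :: "complex ^ 'd \<Rightarrow> complex"
  assumes \<mu>: "admissible \<mu>" and \<phi>: "\<phi> \<in> Mult (besov N \<mu>)"
    and arg: "bounded_argument \<phi>" and L: "analytic_log \<phi> L"
  shows "(\<lambda>z. \<phi> z ^ Suc N * L z) \<in> Mult (besov N \<mu>)"
proof -
  interpret L2_function_space "besov N \<mu>" "besov_norm N \<mu>" "component_measure N \<mu>" component_map
    "{x :: nat \<times> (complex ^ 'd). norm (snd x) = 1}"
    by (rule besov_L2_function_space[OF \<mu>])
  have hol: "holomorphic_ball \<phi>" "holomorphic_ball L" and log: "\<And>z. z \<in> ball 0 1 \<Longrightarrow> exp (L z) = \<phi> z"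
    using L besov_holomorphic[OF Mult_imp_mem[OF \<phi>]] by (auto simp: analytic_log_def)
  obtain M where M: "\<And>z. z \<in> ball 0 1 \<Longrightarrow> cmod (\<phi> z) \<le> M"
    using besov_multiplier_bounded[OF \<mu> \<phi>] by blast
  obtain B where B: "\<And>z. z \<in> ball 0 1 \<Longrightarrow> \<bar>Im (L z)\<bar> \<le> B"
    using analytic_log_bounded_Im[OF arg L] by blast
  obtain C where C: "0 \<le> C" "\<And>f w. holomorphic_ball f \<Longrightarrow> w \<in> ball 0 1 \<Longrightarrow>
      cmod ((radial_deriv ^^ N) (\<lambda>z. \<phi> z ^ Suc N * L z * f z) w) \<le>
        C * (\<Sum>k\<le>N. cmod ((radial_deriv ^^ N) (\<lambda>z. \<phi> z ^ k * f z) w))"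
    using radial_deriv_iter_power_log_bound[OF hol log M B] by blast
  show ?thesis
    unfolding Mult_def
  proof safe
    fix f :: "complex ^ 'd \<Rightarrow> complex" assume f: "f \<in> besov N \<mu>"
    note f_hol = besov_holomorphic[OF f]
    have pf: "(\<lambda>z. \<phi> z ^ k * f z) \<in> besov N \<mu>" for k
      by (rule Mult_mult[OF Mult_power[OF \<phi>] f])
    have "L2_normsq \<mu> ((radial_deriv ^^ N) (\<lambda>z. \<phi> z ^ Suc N * L z * f z)) \<le>
        (\<Sum>k\<le>N. ennreal (C\<^sup>2 * real (Suc N)) * L2_normsq \<mu> ((radial_deriv ^^ N) (\<lambda>z. \<phi> z ^ k * f z)))"
      by (rule L2_normsq_le_sum[OF holomorphic_ball_radial_deriv_iter[OF besov_holomorphic[OF pf]] C(1) C(2)[OF f_hol]])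
    also have "\<dots> < \<infinity>"
      using pf by (auto simp: besov_def ennreal_mult_less_top)
    finally show "(\<lambda>z. \<phi> z ^ Suc N * L z * f z) \<in> besov N \<mu>"
      unfolding besov_def using hol f_hol
      by (auto intro!: holomorphic_ball_mult holomorphic_ball_power simp del: power_Suc)
  qed
qed

theorem theorem6p1:
  fixes \<mu> :: "real measure" and N :: nat and \<phi> L :: "complex ^ 'd \<Rightarrow> complex"
  assumes "admissible \<mu>"
    and "\<phi> \<in> Mult (besov N \<mu>)"
    and "\<forall>z\<in>ball 0 1. \<phi> z \<noteq> 0"
    and "bounded_argument \<phi>"
    and "analytic_log \<phi> L"
  shows "(\<exists>\<psi>\<in>Mult (besov N \<mu>). \<exists>n::nat. \<forall>z\<in>ball 0 1. L z = \<psi> z / \<phi> z ^ n) \<and>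
    (weak_star_seq_cyclic (besov N \<mu>) (besov_norm N \<mu>) \<phi> \<longrightarrow>
      L \<in> N_plus_star (besov N \<mu>) (besov_norm N \<mu>))"
proof -
  interpret L2_function_space "besov N \<mu>" "besov_norm N \<mu>" "component_measure N \<mu>" component_map
    "{x :: nat \<times> (complex ^ 'd). norm (snd x) = 1}"
    by (rule besov_L2_function_space[OF assms(1)])
  have \<psi>: "(\<lambda>z. \<phi> z ^ Suc N * L z) \<in> Mult (besov N \<mu>)"
    by (rule power_mult_log_multiplier[OF assms(1,2,4,5)])
  have eq: "L z = (\<phi> z ^ Suc N * L z) / \<phi> z ^ Suc N" if "z \<in> ball 0 1" for z
    using assms(3) that by simp
  have "L \<in> N_plus_star (besov N \<mu>) (besov_norm N \<mu>)"
    if cyc: "weak_star_seq_cyclic (besov N \<mu>) (besov_norm N \<mu>) \<phi>"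
    unfolding N_plus_star_def
    by (intro CollectI bexI[OF _ \<psi>] bexI[OF _ Mult_power[OF assms(2), of "Suc N"]] conjI ballI
        weak_star_seq_cyclic_power[OF cyc] eq)
  moreover have "\<exists>\<psi>\<in>Mult (besov N \<mu>). \<exists>n::nat. \<forall>z\<in>ball 0 1. L z = \<psi> z / \<phi> z ^ n"
    by (intro bexI[OF _ \<psi>] exI[of _ "Suc N"] ballI eq)
  ultimately show ?thesis by blast
qed

end
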